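(* For $i\in\{1,2\}$ let $$\mathcal{T}^{(i)}_t(X) := \int^T_0 \left(\beta^{X,i}1_{[0,t)}\right)(s)\,dX_s,\qquad \mathcal{B}^{(i)}_t(X) := \int^T_0 \left(\alpha^{X,i}1_{[0,t)}\right)(s)\,dX_s,\quad t\in[0,T].$$ Then $$\Gamma_T\left(\mathcal{T}^{(i)}(X)\right)=\Gamma_T\left(\widehat X^T\right)\qquad\text{and}\qquad \Gamma_T\left(\mathcal{B}^{(i)}(X)\right)=\Gamma_T(X),\quad i\in\{1,2\}.$$
   Context: **Process.** Fix $T>0$; $\lambda$ is Lebesgue measure. $X=(X_t)_{t\in[0,T]}$ is a continuous Volterra Gaussian process: $X_t=\int_0^t z_X(t,s)\,dW_s$ a.s., $t\in[0,T]$, with $W$ a standard Brownian motion and $z_X\in L^2([0,T]^2)$ satisfying $z_X(t,s)=0$ for $s\ge t$. The probability space $(\Omega,\mathcal F,\mathbb P)$ is the (completed) coordinate space of $X$: $\Omega=C([0,T])$, $X_t(\omega)=\omega(t)$, $\mathcal F=\mathcal F^X_T$. $R^X(s,t):=\mathrm{Cov}_{\mathbb P}(X_s,X_t)$. Standing assumptions: (i) $z_X$ is non-degenerate: $\{z_X(t,\cdot)\mid t\in(0,T]\}$ is linearly independent and generates a dense subspace of $L^2([0,T])$; (ii) $z_X(T,\cdot)\ne0$ $\lambda$-a.e.; (iii) $z_X(\cdot,s)$ has bounded variation on $[u,T]$ for all $u\in(s,T)$; (iv) for every $t\in(0,T]$ the equation $\mathbf K^Xf=z_X(T,\cdot)1_{[0,t)}$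 has a solution $f\in\check\Lambda_T(X)$, where $(\mathbf K^Xf)(s):=f(s)z_X(T,s)+\int_s^T(f(u)-f(s))\,z_X(du,s)$, $s\in(0,T)$, and $\check\Lambda_T(X)$ is the space of $f:[0,T]\to\mathbb R$ for which $\mathbf K^Xf$ is well-defined and $\int_0^T(\mathbf K^Xf)^2(s)\,ds<\infty$. **Chaos and Wiener integral.** For a Gaussian process $Y$ on $[0,T]$ with $Y_0=0$ a.s., $\Gamma_T(Y)$ is the closure of $\mathrm{span}\{Y_t\mid t\in[0,T]\}$ in $L^2(\mathbb P)$. $\Lambda_T(X)$ is the Hilbert space completion of $\mathrm{span}\{1_{[0,t)}\mid t\in(0,T]\}$ with respect to the scalar product $(1_{[0,s)},1_{[0,t)})_X:=R^X(s,t)$. The Wiener integral $f\mapsto\int_0^Tf(s)\,dX_s$ is the isometric isomorphism $\Lambda_T(X)\to\Gamma_T(X)$ with $1_{[0,t)}\mapsto X_t$. **Anticipative bridge.** $\widehat X^T_t:=X_t-\frac{R^X(t,T)}{R^X(T,T)}X_T$, $t\in[0,T]$. **Prediction martingale.** $M_t:=\mathrm E_{\mathbb P}(X_T\mid\mathcal F^X_t)=\int_0^tz_X(T,s)\,dW_s$, a continuous Gaussian martingale with strictly increasing quadratic variation $\langle M\rangle_t=\int_0^tz_X^2(T,s)\,ds$; $\langle M\rangle_{T,t}:=\langle M\rangle_T-\langle M\rangle_t$; $L^2_T(M):=L^2([0,T],d\langle M\rangle)$. **Operators.** On $L^2_T(M)$ define $$(\alpha^{M,1}f)(s)=f(s)-\tfrac1{\langle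 M\rangle_s}\int_0^sf(u)\,d\langle M\rangle_u,\qquad(\alpha^{M,2}f)(s)=f(s)-\tfrac1{\langle M\rangle_{T,s}}\int_s^Tf(u)\,d\langle M\rangle_u,$$ $$(\beta^{M,1}f)(s)=f(s)-\int_s^T\tfrac{f(u)}{\langle M\rangle_u}\,d\langle M\rangle_u,\qquad(\beta^{M,2}f)(s)=f(s)-\int_0^s\tfrac{f(u)}{\langle M\rangle_{T,u}}\,d\langle M\rangle_u.$$ Let $k(t,s):=z_X(t,s)/z_X(T,s)$ and let $\kappa:\Lambda_T(X)\to L^2_T(M)$ be the isometric isomorphism with $\kappa(1_{[0,t)})=k(t,\cdot)$, $t\in(0,T]$. Put $\alpha^{X,i}:=\kappa^{-1}\alpha^{M,i}\kappa$ and $\beta^{X,i}:=\kappa^{-1}\beta^{M,i}\kappa$ on $\Lambda_T(X)$, $i\in\{1,2\}$. *)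

theory Defs
  imports "HOL-Probability.Probability"
begin

text \<open>
  The Hilbert space \<open>L\<^sup>2(\<mu>)\<close> is handled through representatives: it is a set of functions, closed
  under a.e. equality, and statements about its elements are made up to a.e. equality.
\<close>

definition L2 :: "'a measure \<Rightarrow> ('a \<Rightarrow> real) set" where
  "L2 \<mu> = {f \<in> borel_measurable \<mu>. integrable \<mu> (\<lambda>x. (f x)\<^sup>2)}"

definition l2_norm :: "'a measure \<Rightarrow> ('a \<Rightarrow> real) \<Rightarrow> real" where
  "l2_norm \<mu> f = sqrt (LINT x|\<mu>. (f x)\<^sup>2)"

definition l2_closed_span :: "'a measure \<Rightarrow> 'i set \<Rightarrow> ('i \<Rightarrow> 'a \<Rightarrow> real) \<Rightarrow> ('a \<Rightarrow> real) set" where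
  "l2_closed_span \<mu> I Y =
     {Z \<in> L2 \<mu>. \<forall>e>0. \<exists>S c. finite S \<and> S \<subseteq> I \<and> l2_norm \<mu> (\<lambda>x. Z x - (\<Sum>t\<in>S. c t * Y t x)) < e}"

definition l2_independent :: "'a measure \<Rightarrow> 'i set \<Rightarrow> ('i \<Rightarrow> 'a \<Rightarrow> real) \<Rightarrow> bool" where
  "l2_independent \<mu> I Y \<longleftrightarrow>
     (\<forall>S c. finite S \<and> S \<subseteq> I \<and> (AE x in \<mu>. (\<Sum>t\<in>S. c t * Y t x) = 0) \<longrightarrow> (\<forall>t\<in>S. c t = 0))"

definition isometric_isomorphism ::
  "('h::real_inner \<Rightarrow> 'a \<Rightarrow> real) \<Rightarrow> 'a measure \<Rightarrow> ('a \<Rightarrow> real) set \<Rightarrow> bool" where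
  "isometric_isomorphism \<Phi> \<mu> V \<longleftrightarrow>
     (\<forall>h. \<Phi> h \<in> V) \<and>
     (\<forall>g h. AE x in \<mu>. \<Phi> (g + h) x = \<Phi> g x + \<Phi> h x) \<and>
     (\<forall>a h. AE x in \<mu>. \<Phi> (a *\<^sub>R h) x = a * \<Phi> h x) \<and>
     (\<forall>h. l2_norm \<mu> (\<Phi> h) = norm h) \<and>
     (\<forall>Z\<in>V. \<exists>h. AE x in \<mu>. \<Phi> h x = Z x)"

definition brownian_motion :: "'a measure \<Rightarrow> real \<Rightarrow> (real \<Rightarrow> 'a \<Rightarrow> real) \<Rightarrow> bool" where
  "brownian_motion P T W \<longleftrightarrow>
     prob_space P \<and>
     (\<forall>t\<in>{0..T}. W t \<in> borel_measurable P) \<and>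
     (AE \<omega> in P. W 0 \<omega> = 0) \<and>
     (AE \<omega> in P. continuous_on {0..T} (\<lambda>t. W t \<omega>)) \<and>
     (\<forall>s t. 0 \<le> s \<and> s < t \<and> t \<le> T \<longrightarrow>
        distributed P lborel (\<lambda>\<omega>. W t \<omega> - W s \<omega>) (normal_density 0 (sqrt (t - s)))) \<and>
     (\<forall>(n::nat) \<tau>. mono_on {..n} \<tau> \<and> \<tau> ` {..n} \<subseteq> {0..T} \<longrightarrow>
        prob_space.indep_vars P (\<lambda>_. borel) (\<lambda>i \<omega>. W (\<tau> (Suc i)) \<omega> - W (\<tau> i) \<omega>) {..<n})"

text \<open>
  \<open>Y = \<integral>\<^sub>0\<^sup>T h dW\<close> a.s.: the pair \<open>(h, Y)\<close> lies in the closure of the graph of the elementary integral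
  \<open>\<Sum> c\<^sub>t 1\<^bsub>[0,t)\<^esub> \<mapsto> \<Sum> c\<^sub>t W\<^sub>t\<close>, which by the Ito isometry is the graph of the Wiener integral.
\<close>

definition has_wiener_integral ::
  "'a measure \<Rightarrow> real \<Rightarrow> (real \<Rightarrow> 'a \<Rightarrow> real) \<Rightarrow> (real \<Rightarrow> real) \<Rightarrow> ('a \<Rightarrow> real) \<Rightarrow> bool" where
  "has_wiener_integral P T W h Y \<longleftrightarrow>
     h \<in> L2 (lebesgue_on {0..T}) \<and> Y \<in> L2 P \<and>
     (\<forall>e>0. \<exists>S c. finite S \<and> S \<subseteq> {0..T} \<and>
        l2_norm (lebesgue_on {0..T}) (\<lambda>s. h s - (\<Sum>t\<in>S. c t * indicator {0..<t} s)) < e \<and>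
        l2_norm P (\<lambda>\<omega>. Y \<omega> - (\<Sum>t\<in>S. c t * W t \<omega>)) < e)"

definition bounded_variation_on :: "(real \<Rightarrow> real) \<Rightarrow> real \<Rightarrow> real \<Rightarrow> bool" where
  "bounded_variation_on F a b \<longleftrightarrow>
     (\<exists>B. \<forall>(n::nat) \<tau>. mono_on {..n} \<tau> \<and> \<tau> ` {..n} \<subseteq> {a..b} \<longrightarrow>
        (\<Sum>i<n. \<bar>F (\<tau> (Suc i)) - F (\<tau> i)\<bar>) \<le> B)"

text \<open>
  Lebesgue-Stieltjes integral \<open>\<integral>\<^sub>a\<^sup>b g(u) F(du)\<close> over \<open>(a,b]\<close> for \<open>F\<close> of bounded variation on every
  \<open>[u,b]\<close> with \<open>u \<in> (a,b)\<close>, the variation on \<open>(a,b]\<close> itself possibly being infinite.  As usual, \<open>F\<close>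
  is replaced by its right-continuous modification; \<open>F(du)\<close> is then the difference \<open>\<mu> - \<nu>\<close> of two
  measures that are finite on \<open>(u,b]\<close> for \<open>u \<in> (a,b)\<close>.  Only \<open>g\<close> integrable with respect to both are
  admitted; the value does not depend on the decomposition.
\<close>

definition right_cont_mod :: "(real \<Rightarrow> real) \<Rightarrow> real \<Rightarrow> real \<Rightarrow> real" where
  "right_cont_mod F b v = (if v < b then Lim (at_right v) F else F b)"

definition has_stieltjes_integral ::
  "(real \<Rightarrow> real) \<Rightarrow> (real \<Rightarrow> real) \<Rightarrow> real \<Rightarrow> real \<Rightarrow> real \<Rightarrow> bool" where
  "has_stieltjes_integral g F a b I \<longleftrightarrow>
     (\<exists>\<mu> \<nu>. sets \<mu> = sets borel \<and> sets \<nu> = sets borel \<and>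
        (\<forall>u v. a < u \<and> u \<le> v \<and> v \<le> b \<longrightarrow>
           emeasure \<mu> {u<..v} < \<infinity> \<and> emeasure \<nu> {u<..v} < \<infinity> \<and>
           measure \<mu> {u<..v} - measure \<nu> {u<..v} = right_cont_mod F b v - right_cont_mod F b u) \<and>
        set_integrable (completion \<mu>) {a<..b} g \<and> set_integrable (completion \<nu>) {a<..b} g \<and>
        I = (LINT u:{a<..b}|completion \<mu>. g u) - (LINT u:{a<..b}|completion \<nu>. g u))"

definition K_well_defined_at :: "real \<Rightarrow> (real \<Rightarrow> real \<Rightarrow> real) \<Rightarrow> (real \<Rightarrow> real) \<Rightarrow> real \<Rightarrow> bool" where
  "K_well_defined_at T z f s \<longleftrightarrow>
     (\<exists>I. has_stieltjes_integral (\<lambda>u. f u - f s) (\<lambda>u. z u s) s T I)"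

definition K_op :: "real \<Rightarrow> (real \<Rightarrow> real \<Rightarrow> real) \<Rightarrow> (real \<Rightarrow> real) \<Rightarrow> real \<Rightarrow> real" where
  "K_op T z f s =
     f s * z T s + (THE I. has_stieltjes_integral (\<lambda>u. f u - f s) (\<lambda>u. z u s) s T I)"

definition Lambda_check :: "real \<Rightarrow> (real \<Rightarrow> real \<Rightarrow> real) \<Rightarrow> (real \<Rightarrow> real) set" where
  "Lambda_check T z =
     {f. (AE s in lebesgue_on {0..T}. K_well_defined_at T z f s) \<and>
         K_op T z f \<in> L2 (lebesgue_on {0..T})}"

definition path_space :: "real \<Rightarrow> (real \<Rightarrow> real) measure" where
  "path_space T = restrict_space (Pi\<^sub>M {0..T} (\<lambda>_. borel)) {\<omega>. continuous_on {0..T} \<omega>}"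

definition coord :: "real \<Rightarrow> (real \<Rightarrow> real) \<Rightarrow> real" where
  "coord t \<omega> = \<omega> t"

definition covariance :: "'a measure \<Rightarrow> ('a \<Rightarrow> real) \<Rightarrow> ('a \<Rightarrow> real) \<Rightarrow> real" where
  "covariance P Y Z = (LINT \<omega>|P. (Y \<omega> - (LINT \<omega>|P. Y \<omega>)) * (Z \<omega> - (LINT \<omega>|P. Z \<omega>)))"

definition R_cov :: "(real \<Rightarrow> real) measure \<Rightarrow> real \<Rightarrow> real \<Rightarrow> real" where
  "R_cov P s t = covariance P (coord s) (coord t)"

locale volterra_gaussian =
  fixes T :: real
    and z :: "real \<Rightarrow> real \<Rightarrow> real"
    and P :: "(real \<Rightarrow> real) measure"
    and W :: "real \<Rightarrow> (real \<Rightarrow> real) \<Rightarrow> real"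
  assumes T_pos: "0 < T"
    and coordinate_space:
      "\<exists>N. prob_space N \<and> sets N = sets (path_space T) \<and> P = completion N"
    and brownian: "brownian_motion P T W"
    and kernel_L2: "(\<lambda>(t, s). z t s) \<in> L2 (lebesgue_on ({0..T} \<times> {0..T}))"
    and kernel_volterra: "\<And>t s. t \<in> {0..T} \<Longrightarrow> s \<in> {0..T} \<Longrightarrow> t \<le> s \<Longrightarrow> z t s = 0"
    and representation:
      "\<And>t. t \<in> {0..T} \<Longrightarrow> has_wiener_integral P T W (\<lambda>s. indicator {0..<t} s * z t s) (coord t)"
    and kernel_independent: "l2_independent (lebesgue_on {0..T}) {0<..T} z"
    and kernel_dense: "l2_closed_span (lebesgue_on {0..T}) {0<..T} z = L2 (lebesgue_on {0..T})"
    and kernel_T_nonzero: "AE s in lebesgue_on {0..T}. z T s \<noteq> 0"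
    and kernel_BV:
      "\<And>s u. s \<in> {0<..<T} \<Longrightarrow> u \<in> {s<..<T} \<Longrightarrow> bounded_variation_on (\<lambda>t. z t s) u T"
    and K_solvable:
      "\<And>t. t \<in> {0<..T} \<Longrightarrow>
         \<exists>f\<in>Lambda_check T z. AE s in lebesgue_on {0..T}. K_op T z f s = z T s * indicator {0..<t} s"

definition Gamma_space ::
  "'a measure \<Rightarrow> real \<Rightarrow> (real \<Rightarrow> 'a \<Rightarrow> real) \<Rightarrow> ('a \<Rightarrow> real) set" where
  "Gamma_space P T Y = l2_closed_span P {0..T} Y"

definition step_functions :: "real \<Rightarrow> (real \<Rightarrow> real) set" where
  "step_functions T =
     {f. \<exists>S c. finite S \<and> S \<subseteq> {0<..T} \<and> f = (\<lambda>s. \<Sum>t\<in>S. c t * indicator {0..<t} s)}"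

text \<open>
  The complete inner product space \<open>'h\<close> together with the linear map \<open>J\<close> is the Hilbert space
  completion of the step functions with respect to \<open>(1\<^bsub>[0,s)\<^esub>, 1\<^bsub>[0,t)\<^esub>)\<^sub>X = R\<^sup>X(s,t)\<close>.  Completions
  are unique up to isometric isomorphism.
\<close>

definition Lambda_completion ::
  "(real \<Rightarrow> real) measure \<Rightarrow> real \<Rightarrow> ((real \<Rightarrow> real) \<Rightarrow> 'h::{real_inner,complete_space}) \<Rightarrow> bool" where
  "Lambda_completion P T J \<longleftrightarrow>
     (\<forall>f\<in>step_functions T. \<forall>g\<in>step_functions T. J (\<lambda>s. f s + g s) = J f + J g) \<and>
     (\<forall>a. \<forall>f\<in>step_functions T. J (\<lambda>s. a * f s) = a *\<^sub>R J f) \<and>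
     (\<forall>s\<in>{0<..T}. \<forall>t\<in>{0<..T}.
        inner (J (indicator {0..<s})) (J (indicator {0..<t})) = R_cov P s t) \<and>
     closure (J ` step_functions T) = UNIV"

text \<open>The choice of representatives is immaterial: the isometry is unique up to a.s. equality.\<close>

definition wiener_X ::
  "(real \<Rightarrow> real) measure \<Rightarrow> real \<Rightarrow> ((real \<Rightarrow> real) \<Rightarrow> 'h::{real_inner,complete_space}) \<Rightarrow>
   'h \<Rightarrow> (real \<Rightarrow> real) \<Rightarrow> real" where
  "wiener_X P T J =
     (SOME \<Phi>. isometric_isomorphism \<Phi> P (Gamma_space P T coord) \<and>
        (\<forall>t\<in>{0<..T}. AE \<omega> in P. \<Phi> (J (indicator {0..<t})) \<omega> = coord t \<omega>))"

definition bridge :: "(real \<Rightarrow> real) measure \<Rightarrow> real \<Rightarrow> real \<Rightarrow> (real \<Rightarrow> real) \<Rightarrow> real" where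
  "bridge P T t \<omega> = coord t \<omega> - R_cov P t T / R_cov P T T * coord T \<omega>"

text \<open>
  \<open>\<langle>M\<rangle>\<^sub>t = \<integral>\<^sub>0\<^sup>t z\<^sub>X(T,s)\<^sup>2 ds\<close> for the prediction martingale \<open>M\<^sub>t = E(X\<^sub>T | F\<^sup>X\<^sub>t) = \<integral>\<^sub>0\<^sup>t z\<^sub>X(T,s) dW\<^sub>s\<close>;
  \<open>M\<close> enters the operators only through this function and its Lebesgue-Stieltjes measure
  \<open>d\<langle>M\<rangle>\<close> on \<open>[0,T]\<close>, which is given by its density (see \<open>emeasure_dbracket\<close> below).
\<close>

definition bracket :: "real \<Rightarrow> (real \<Rightarrow> real \<Rightarrow> real) \<Rightarrow> real \<Rightarrow> real" where
  "bracket T z t = (LINT s:{0..t}|lebesgue. (z T s)\<^sup>2)"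

definition dbracket :: "real \<Rightarrow> (real \<Rightarrow> real \<Rightarrow> real) \<Rightarrow> real measure" where
  "dbracket T z = density (lebesgue_on {0..T}) (\<lambda>s. ennreal ((z T s)\<^sup>2))"

definition alpha_M ::
  "real \<Rightarrow> (real \<Rightarrow> real \<Rightarrow> real) \<Rightarrow> nat \<Rightarrow> (real \<Rightarrow> real) \<Rightarrow> real \<Rightarrow> real" where
  "alpha_M T z i f s =
     (if i = 1
      then f s - 1 / bracket T z s * (LINT u:{0..s}|dbracket T z. f u)
      else f s - 1 / (bracket T z T - bracket T z s) * (LINT u:{s..T}|dbracket T z. f u))"

definition beta_M ::
  "real \<Rightarrow> (real \<Rightarrow> real \<Rightarrow> real) \<Rightarrow> nat \<Rightarrow> (real \<Rightarrow> real) \<Rightarrow> real \<Rightarrow> real" where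
  "beta_M T z i f s =
     (if i = 1
      then f s - (LINT u:{s..T}|dbracket T z. f u / bracket T z u)
      else f s - (LINT u:{0..s}|dbracket T z. f u / (bracket T z T - bracket T z u)))"

definition kappa ::
  "real \<Rightarrow> (real \<Rightarrow> real \<Rightarrow> real) \<Rightarrow> ((real \<Rightarrow> real) \<Rightarrow> 'h::{real_inner,complete_space}) \<Rightarrow>
   'h \<Rightarrow> real \<Rightarrow> real" where
  "kappa T z J =
     (SOME \<Phi>. isometric_isomorphism \<Phi> (dbracket T z) (L2 (dbracket T z)) \<and>
        (\<forall>t\<in>{0<..T}. AE s in dbracket T z. \<Phi> (J (indicator {0..<t})) s = z t s / z T s))"

definition kappa_inv ::
  "real \<Rightarrow> (real \<Rightarrow> real \<Rightarrow> real) \<Rightarrow> ((real \<Rightarrow> real) \<Rightarrow> 'h::{real_inner,complete_space}) \<Rightarrow>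
   (real \<Rightarrow> real) \<Rightarrow> 'h" where
  "kappa_inv T z J f = (THE h. AE s in dbracket T z. kappa T z J h s = f s)"

definition alpha_X ::
  "real \<Rightarrow> (real \<Rightarrow> real \<Rightarrow> real) \<Rightarrow> ((real \<Rightarrow> real) \<Rightarrow> 'h::{real_inner,complete_space}) \<Rightarrow>
   nat \<Rightarrow> 'h \<Rightarrow> 'h" where
  "alpha_X T z J i h = kappa_inv T z J (alpha_M T z i (kappa T z J h))"

definition beta_X ::
  "real \<Rightarrow> (real \<Rightarrow> real \<Rightarrow> real) \<Rightarrow> ((real \<Rightarrow> real) \<Rightarrow> 'h::{real_inner,complete_space}) \<Rightarrow>
   nat \<Rightarrow> 'h \<Rightarrow> 'h" where
  "beta_X T z J i h = kappa_inv T z J (beta_M T z i (kappa T z J h))"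

definition T_proc ::
  "real \<Rightarrow> (real \<Rightarrow> real \<Rightarrow> real) \<Rightarrow> (real \<Rightarrow> real) measure \<Rightarrow>
   ((real \<Rightarrow> real) \<Rightarrow> 'h::{real_inner,complete_space}) \<Rightarrow> nat \<Rightarrow> real \<Rightarrow> (real \<Rightarrow> real) \<Rightarrow> real" where
  "T_proc T z P J i t = wiener_X P T J (beta_X T z J i (J (indicator {0..<t})))"

definition B_proc ::
  "real \<Rightarrow> (real \<Rightarrow> real \<Rightarrow> real) \<Rightarrow> (real \<Rightarrow> real) measure \<Rightarrow>
   ((real \<Rightarrow> real) \<Rightarrow> 'h::{real_inner,complete_space}) \<Rightarrow> nat \<Rightarrow> real \<Rightarrow> (real \<Rightarrow> real) \<Rightarrow> real" where
  "B_proc T z P J i t = wiener_X P T J (alpha_X T z J i (J (indicator {0..<t})))"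

lemma emeasure_dbracket:
  assumes zT: "z T \<in> L2 (lebesgue_on {0..T})" and ab: "0 \<le> a" "a \<le> b" "b \<le> T"
  shows "emeasure (dbracket T z) {a<..b} = ennreal (bracket T z b - bracket T z a)"
proof -
  have int0: "integrable (lebesgue_on {0..T}) (\<lambda>s. (z T s)\<^sup>2)"
    and meas: "(\<lambda>s. (z T s)\<^sup>2) \<in> borel_measurable (lebesgue_on {0..T})"
    using zT by (auto simp: L2_def)
  have intT: "set_integrable lebesgue {0..T} (\<lambda>s. (z T s)\<^sup>2)"
    using int0 by (simp add: integrable_restrict_space set_integrable_def)
  have sub: "set_integrable lebesgue A (\<lambda>s. (z T s)\<^sup>2)" if "A \<in> sets lebesgue" "A \<subseteq> {0..T}" for A
    using set_integrable_subset[OF intT] that by auto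
  have "emeasure (dbracket T z) {a<..b} =
      (\<integral>\<^sup>+s. ennreal ((z T s)\<^sup>2) * indicator {a<..b} s \<partial>lebesgue_on {0..T})"
    unfolding dbracket_def using meas ab by (subst emeasure_density) (auto simp: sets_restrict_space_iff)
  also have "\<dots> = (\<integral>\<^sup>+s. ennreal (indicator {a<..b} s *\<^sub>R (z T s)\<^sup>2) \<partial>lebesgue)"
    using ab by (subst nn_integral_restrict_space)
      (auto intro!: nn_integral_cong simp: indicator_def split: if_splits)
  also have "\<dots> = ennreal (LINT s:{a<..b}|lebesgue. (z T s)\<^sup>2)"
    unfolding set_lebesgue_integral_def
  proof (rule nn_integral_eq_integral)
    have "{a<..b} \<subseteq> {0..T}" using ab by auto
    then show "integrable lebesgue (\<lambda>s. indicator {a<..b} s *\<^sub>R (z T s)\<^sup>2)"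
      using sub[of "{a<..b}"] by (simp add: set_integrable_def)
  qed auto
  also have "(LINT s:{a<..b}|lebesgue. (z T s)\<^sup>2) = bracket T z b - bracket T z a"
  proof -
    have "{0..b} = {0..a} \<union> {a<..b}" using ab by auto
    moreover have "{0..a} \<subseteq> {0..T}" "{a<..b} \<subseteq> {0..T}" using ab by auto
    ultimately have "bracket T z b = bracket T z a + (LINT s:{a<..b}|lebesgue. (z T s)\<^sup>2)"
      unfolding bracket_def using sub[of "{0..a}"] sub[of "{a<..b}"]
      by (auto intro!: set_integral_Un)
    then show ?thesis by simp
  qed
  finally show ?thesis .
qed

end

theory Submission
  imports Defs
begin

text \<open>
  Everything is read off in the completion \<open>'h\<close> of the step functions.  Write \<open>e\<^sub>t\<close> for the image of
  \<open>1\<^bsub>[0,t)\<^esub>\<close> there, \<open>\<Phi>\<close> for the Wiener integral and \<open>\<kappa>\<close> for the isometry onto \<open>L\<^sup>2(\<mu>)\<close> with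
  \<open>\<mu> = d\<langle>M\<rangle>\<close>.  An isometry carries closed spans to closed spans (\<open>l2_closed_span_isometry\<close>), so the
  four spaces \<open>\<Gamma>\<^sub>T\<close> are the images under \<open>\<Phi>\<close> of four closed subspaces of \<open>'h\<close>.  For \<open>X\<close> it is
  the whole space, for the bridge it is \<open>e\<^sub>T\<^sup>\<bottom>\<close>, because \<open>e\<^sub>t - (R(t,T)/R(T,T)) e\<^sub>T\<close> is the orthogonal
  projection of \<open>e\<^sub>t\<close> onto it.  As the \<open>e\<^sub>t\<close> are total and the operators bounded, the spaces of
  \<open>\<B>\<^sup>(\<^sup>i\<^sup>)\<close> and \<open>\<T>\<^sup>(\<^sup>i\<^sup>)\<close> are the closures of the ranges of \<open>\<alpha>\<^sup>M\<^sup>,\<^sup>i\<close> and \<open>\<beta>\<^sup>M\<^sup>,\<^sup>i\<close>; and \<open>\<kappa> e\<^sub>T = 1\<close>.  So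
  the claim is that the range of \<open>\<alpha>\<close> is dense in \<open>L\<^sup>2(\<mu>)\<close> and that the closed range of \<open>\<beta>\<close> is the
  space of functions with mean zero.

  Both cases of \<open>i\<close> are the same statement: with \<open>G = \<langle>M\<rangle>\<close> for \<open>i = 1\<close> and \<open>G = \<langle>M\<rangle>\<^sub>T - \<langle>M\<rangle>\<close> for
  \<open>i = 2\<close>, the function \<open>G\<close> is uniformly distributed on \<open>[0,m]\<close> under \<open>\<mu>\<close>, where \<open>m = \<langle>M\<rangle>\<^sub>T\<close>, and
  \<open>\<alpha>\<close>, \<open>\<beta>\<close> are the identity minus the Hardy averaging operator over \<open>{G \<le> G(s)}\<close> and minus its adjoint.
  Boundedness is Hardy's inequality, obtained from a Schur test (\<open>schur_test\<close>).  For the ranges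
  it suffices to follow one total family, \<open>h\<^sub>y = 1\<^bsub>{G > y}\<^esub>/G\<close> (\<open>upper_inverse_total\<close>):
  \<open>\<alpha> 1\<^bsub>{G \<le> y}\<^esub> = - y h\<^sub>y\<close> shows that the range of \<open>\<alpha>\<close> is dense, while
  \<open>\<beta> h\<^sub>y = 1/m - 1\<^bsub>{G \<le> y}\<^esub>/y\<close> has mean zero, and a function of mean zero orthogonal to all of these
  has vanishing integrals over all \<open>{G \<le> y}\<close> and is therefore \<open>0\<close>.

  The isometries \<open>\<Phi>\<close> and \<open>\<kappa>\<close> exist (\<open>isometric_isomorphism_exists\<close>) because the Gram matrices agree:
  the Ito isometry (\<open>wiener_isometry\<close>) turns \<open>R\<^sup>X(s,t)\<close> into the \<open>L\<^sup>2\<close> product of the kernels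
  \<open>z(s,\<cdot>)\<close> and \<open>z(t,\<cdot>)\<close>, which is the product of \<open>z(s,\<cdot>)/z(T,\<cdot>)\<close> and \<open>z(t,\<cdot>)/z(T,\<cdot>)\<close> in \<open>L\<^sup>2(\<mu>)\<close>.
\<close>

section \<open>The space of square integrable functions\<close>

definition l2_inner :: "'a measure \<Rightarrow> ('a \<Rightarrow> real) \<Rightarrow> ('a \<Rightarrow> real) \<Rightarrow> real" where
  "l2_inner M f g = (LINT x|M. f x * g x)"

lemma L2_measurable [measurable_dest]: "f \<in> L2 M \<Longrightarrow> f \<in> borel_measurable M"
  by (simp add: L2_def)

lemma L2_integrable_mult:
  assumes f: "f \<in> L2 M" and g: "g \<in> L2 M"
  shows "integrable M (\<lambda>x. f x * g x)"
proof (rule Bochner_Integration.integrable_bound)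
  show "integrable M (\<lambda>x. (f x)\<^sup>2 + (g x)\<^sup>2)"
    using f g by (auto simp: L2_def)
  show "(\<lambda>x. f x * g x) \<in> borel_measurable M"
    using f g by (auto simp: L2_def)
  have "\<bar>a * b\<bar> \<le> a\<^sup>2 + b\<^sup>2" for a b :: real
    using sum_squares_bound[of a b] sum_squares_bound[of "-a" b] zero_le_power2[of a] zero_le_power2[of b]
    by (simp add: abs_le_iff)
  then show "AE x in M. norm (f x * g x) \<le> norm ((f x)\<^sup>2 + (g x)\<^sup>2)"
    by (auto intro!: AE_I2 simp del: abs_mult)
qed

lemma L2_scale: "f \<in> L2 M \<Longrightarrow> (\<lambda>x. c * f x) \<in> L2 M"
  by (auto simp: L2_def power_mult_distrib)

lemma L2_add:
  assumes f: "f \<in> L2 M" and g: "g \<in> L2 M"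
  shows "(\<lambda>x. f x + g x) \<in> L2 M"
proof -
  have "integrable M (\<lambda>x. (f x)\<^sup>2 + (g x)\<^sup>2 + 2 * (f x * g x))"
    using f g L2_integrable_mult[OF f g]
    by (intro Bochner_Integration.integrable_add integrable_mult_right) (auto simp: L2_def)
  then show ?thesis
    using f g by (auto simp: L2_def power2_sum ac_simps)
qed

lemma L2_diff: "f \<in> L2 M \<Longrightarrow> g \<in> L2 M \<Longrightarrow> (\<lambda>x. f x - g x) \<in> L2 M"
  using L2_add[of f M "\<lambda>x. - 1 * g x"] L2_scale[of g M "-1"] by simp

lemma L2_zero: "(\<lambda>x. 0) \<in> L2 M"
  by (simp add: L2_def)

lemma L2_sum: "(\<And>t. t \<in> S \<Longrightarrow> f t \<in> L2 M) \<Longrightarrow> (\<lambda>x. \<Sum>t\<in>S. f t x) \<in> L2 M"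
  by (induction S rule: infinite_finite_induct) (auto intro: L2_zero L2_add)

lemma L2_cong_AE:
  "f \<in> L2 M \<Longrightarrow> g \<in> borel_measurable M \<Longrightarrow> (AE x in M. f x = g x) \<Longrightarrow> g \<in> L2 M"
  unfolding L2_def by (auto intro: Bochner_Integration.integrable_cong_AE_imp)

lemma l2_inner_commute: "l2_inner M f g = l2_inner M g f"
  by (simp add: l2_inner_def mult.commute)

lemma l2_inner_cong_AE:
  assumes "f \<in> borel_measurable M" "f' \<in> borel_measurable M" "g \<in> borel_measurable M"
    "g' \<in> borel_measurable M" "AE x in M. f x = f' x" "AE x in M. g x = g' x"
  shows "l2_inner M f g = l2_inner M f' g'"
  unfolding l2_inner_def using assms by (intro integral_cong_AE) auto

lemma l2_inner_add_left:
  "f \<in> L2 M \<Longrightarrow> g \<in> L2 M \<Longrightarrow> h \<in> L2 M \<Longrightarrow>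
    l2_inner M (\<lambda>x. f x + g x) h = l2_inner M f h + l2_inner M g h"
  by (simp add: l2_inner_def distrib_right L2_integrable_mult)

lemma l2_inner_diff_left:
  "f \<in> L2 M \<Longrightarrow> g \<in> L2 M \<Longrightarrow> h \<in> L2 M \<Longrightarrow>
    l2_inner M (\<lambda>x. f x - g x) h = l2_inner M f h - l2_inner M g h"
  by (simp add: l2_inner_def left_diff_distrib L2_integrable_mult)

lemma l2_inner_scale_left: "l2_inner M (\<lambda>x. c * f x) h = c * l2_inner M f h"
  by (simp add: l2_inner_def mult.assoc)

lemma l2_inner_add_right:
  "f \<in> L2 M \<Longrightarrow> g \<in> L2 M \<Longrightarrow> h \<in> L2 M \<Longrightarrow>
    l2_inner M h (\<lambda>x. f x + g x) = l2_inner M h f + l2_inner M h g"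
  by (simp add: l2_inner_def distrib_left L2_integrable_mult)

lemma l2_inner_scale_right: "l2_inner M h (\<lambda>x. c * f x) = c * l2_inner M h f"
  by (simp add: l2_inner_def mult.left_commute)

lemma l2_inner_sum_left:
  "(\<And>t. t \<in> S \<Longrightarrow> f t \<in> L2 M) \<Longrightarrow> h \<in> L2 M \<Longrightarrow>
    l2_inner M (\<lambda>x. \<Sum>t\<in>S. c t * f t x) h = (\<Sum>t\<in>S. c t * l2_inner M (f t) h)"
proof (induction S rule: infinite_finite_induct)
  case (insert s S)
  have "l2_inner M (\<lambda>x. c s * f s x + (\<Sum>t\<in>S. c t * f t x)) h
      = l2_inner M (\<lambda>x. c s * f s x) h + l2_inner M (\<lambda>x. \<Sum>t\<in>S. c t * f t x) h"
    using insert by (intro l2_inner_add_left L2_sum L2_scale) auto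
  then show ?case
    using insert by (simp add: l2_inner_scale_left)
qed (auto simp: l2_inner_def)

lemma l2_inner_sum_sum:
  assumes "\<And>t. t \<in> S \<Longrightarrow> f t \<in> L2 M" "\<And>t. t \<in> S' \<Longrightarrow> g t \<in> L2 M"
  shows "l2_inner M (\<lambda>x. \<Sum>s\<in>S. c s * f s x) (\<lambda>x. \<Sum>t\<in>S'. d t * g t x)
    = (\<Sum>s\<in>S. \<Sum>t\<in>S'. c s * d t * l2_inner M (f s) (g t))"
proof -
  have "l2_inner M (\<lambda>x. \<Sum>s\<in>S. c s * f s x) (\<lambda>x. \<Sum>t\<in>S'. d t * g t x)
    = (\<Sum>s\<in>S. c s * l2_inner M (\<lambda>x. \<Sum>t\<in>S'. d t * g t x) (f s))"
    using assms by (subst l2_inner_sum_left) (auto intro!: L2_sum L2_scale simp: l2_inner_commute)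
  also have "\<dots> = (\<Sum>s\<in>S. c s * (\<Sum>t\<in>S'. d t * l2_inner M (f s) (g t)))"
    using assms by (intro sum.cong refl arg_cong2[where f="(*)"], subst l2_inner_sum_left)
       (auto simp: l2_inner_commute)
  finally show ?thesis
    by (simp add: sum_distrib_left mult.assoc)
qed

lemma l2_norm_square: "(l2_norm M f)\<^sup>2 = l2_inner M f f"
  by (simp add: l2_norm_def l2_inner_def power2_eq_square[symmetric])

lemma l2_norm_nonneg [simp]: "0 \<le> l2_norm M f"
  by (simp add: l2_norm_def)

lemma l2_norm_eqI: "l2_inner M f f = l2_inner N g g \<Longrightarrow> l2_norm M f = l2_norm N g"
  by (metis l2_norm_nonneg l2_norm_square power2_eq_iff_nonneg)

lemma l2_norm_commute: "l2_norm M (\<lambda>x. f x - g x) = l2_norm M (\<lambda>x. g x - f x)"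
  by (simp add: l2_norm_def power2_commute)

lemma l2_norm_cong_AE:
  "f \<in> borel_measurable M \<Longrightarrow> g \<in> borel_measurable M \<Longrightarrow> (AE x in M. f x = g x) \<Longrightarrow>
    l2_norm M f = l2_norm M g"
  by (rule l2_norm_eqI) (rule l2_inner_cong_AE)

lemma l2_norm_eq_0_iff:
  assumes "f \<in> L2 M"
  shows "l2_norm M f = 0 \<longleftrightarrow> (AE x in M. f x = 0)"
  using assms by (simp add: l2_norm_def L2_def integral_nonneg_eq_0_iff_AE)

lemma nn_integral_square_L2:
  "f \<in> L2 M \<Longrightarrow> (\<integral>\<^sup>+x. ennreal ((f x)\<^sup>2) \<partial>M) = ennreal ((l2_norm M f)\<^sup>2)"
  by (subst nn_integral_eq_integral) (auto simp: L2_def l2_norm_def)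

lemma L2_iff_nn_integral:
  "f \<in> L2 M \<longleftrightarrow> f \<in> borel_measurable M \<and> (\<integral>\<^sup>+x. ennreal ((f x)\<^sup>2) \<partial>M) < \<infinity>"
  by (auto simp: L2_def integrable_iff_bounded)

lemma l2_Cauchy_Schwarz:
  assumes f: "f \<in> L2 M" and g: "g \<in> L2 M"
  shows "\<bar>l2_inner M f g\<bar> \<le> l2_norm M f * l2_norm M g"
proof -
  have [measurable]: "f \<in> borel_measurable M" "g \<in> borel_measurable M"
    using f g by (auto simp: L2_def)
  have "ennreal \<bar>l2_inner M f g\<bar> \<le> (\<integral>\<^sup>+x. ennreal \<bar>f x\<bar> * ennreal \<bar>g x\<bar> \<partial>M)"
    using integral_norm_bound_ennreal[OF L2_integrable_mult[OF f g]]
    by (simp add: l2_inner_def abs_mult ennreal_mult)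
  then have "(ennreal \<bar>l2_inner M f g\<bar>)\<^sup>2 \<le> (\<integral>\<^sup>+x. ennreal \<bar>f x\<bar> * ennreal \<bar>g x\<bar> \<partial>M)\<^sup>2"
    by (rule power_mono) simp
  also have "\<dots> \<le> (\<integral>\<^sup>+x. (ennreal \<bar>f x\<bar>)\<^sup>2 \<partial>M) * (\<integral>\<^sup>+x. (ennreal \<bar>g x\<bar>)\<^sup>2 \<partial>M)"
    by (rule Cauchy_Schwarz_nn_integral) auto
  also have "\<dots> = ennreal ((l2_norm M f * l2_norm M g)\<^sup>2)"
    using nn_integral_square_L2[OF f] nn_integral_square_L2[OF g]
    by (simp add: ennreal_power ennreal_mult power_mult_distrib)
  finally have "\<bar>l2_inner M f g\<bar>\<^sup>2 \<le> (l2_norm M f * l2_norm M g)\<^sup>2"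
    by (simp add: ennreal_power)
  then show ?thesis
    by (rule power2_le_imp_le) simp
qed

lemma l2_norm_triangle:
  assumes f: "f \<in> L2 M" and g: "g \<in> L2 M"
  shows "l2_norm M (\<lambda>x. f x + g x) \<le> l2_norm M f + l2_norm M g"
proof (rule power2_le_imp_le)
  have "l2_inner M h (\<lambda>x. f x + g x) = l2_inner M f h + l2_inner M g h" if "h \<in> L2 M" for h
    using that assms by (subst l2_inner_commute) (rule l2_inner_add_left)
  then have "(l2_norm M (\<lambda>x. f x + g x))\<^sup>2 = l2_inner M f f + 2 * l2_inner M f g + l2_inner M g g"
    using assms l2_inner_commute[of M g f] by (simp add: l2_norm_square l2_inner_add_left L2_add)
  also have "\<dots> \<le> (l2_norm M f + l2_norm M g)\<^sup>2"
    using l2_Cauchy_Schwarz[OF f g] by (simp add: power2_sum l2_norm_square abs_le_iff)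
  finally show "(l2_norm M (\<lambda>x. f x + g x))\<^sup>2 \<le> (l2_norm M f + l2_norm M g)\<^sup>2" .
qed (simp add: add_nonneg_nonneg)

lemma l2_norm_triangle_diff:
  assumes "f \<in> L2 M" "g \<in> L2 M" "h \<in> L2 M"
  shows "l2_norm M (\<lambda>x. f x - h x) \<le> l2_norm M (\<lambda>x. f x - g x) + l2_norm M (\<lambda>x. g x - h x)"
  using l2_norm_triangle[of "\<lambda>x. f x - g x" M "\<lambda>x. g x - h x"] assms by (simp add: L2_diff)

lemma l2_norm_diff_square:
  assumes "f \<in> L2 M" "g \<in> L2 M"
  shows "(l2_norm M (\<lambda>x. f x - g x))\<^sup>2 = l2_inner M f f - 2 * l2_inner M f g + l2_inner M g g"
proof -
  have "l2_inner M h (\<lambda>x. f x - g x) = l2_inner M f h - l2_inner M g h" if "h \<in> L2 M" for h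
    using that assms by (subst l2_inner_commute) (rule l2_inner_diff_left)
  then show ?thesis
    using assms l2_inner_commute[of M g f] by (simp add: l2_norm_square l2_inner_diff_left L2_diff)
qed

lemma AE_eq_if_l2_norm_diff_0:
  assumes "f \<in> L2 M" "g \<in> L2 M" "l2_norm M (\<lambda>x. f x - g x) = 0"
  shows "AE x in M. f x = g x"
  using l2_norm_eq_0_iff[OF L2_diff[OF assms(1,2)]] assms(3) by simp

lemma l2_inner_tendsto:
  assumes L2: "\<And>n. f n \<in> L2 M" "f' \<in> L2 M" "\<And>n. g n \<in> L2 M" "g' \<in> L2 M"
    and f: "(\<lambda>n. l2_norm M (\<lambda>x. f n x - f' x)) \<longlonglongrightarrow> 0"
    and g: "(\<lambda>n. l2_norm M (\<lambda>x. g n x - g' x)) \<longlonglongrightarrow> 0"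
  shows "(\<lambda>n. l2_inner M (f n) (g n)) \<longlonglongrightarrow> l2_inner M f' g'"
proof (rule LIM_zero_cancel, rule Lim_null_comparison)
  let ?b = "\<lambda>n. l2_norm M (\<lambda>x. f n x - f' x) * (l2_norm M (\<lambda>x. g n x - g' x) + l2_norm M g')
    + l2_norm M f' * l2_norm M (\<lambda>x. g n x - g' x)"
  show "?b \<longlonglongrightarrow> 0"
    using f g by (auto intro!: tendsto_eq_intros)
  have "\<bar>l2_inner M (f n) (g n) - l2_inner M f' g'\<bar> \<le> ?b n" for n
  proof -
    let ?d = "\<lambda>x. f n x - f' x" and ?e = "\<lambda>x. g n x - g' x"
    have d: "?d \<in> L2 M" and e: "?e \<in> L2 M"
      using L2 by (auto intro: L2_diff)
    have "l2_norm M (g n) \<le> l2_norm M ?e + l2_norm M g'"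
      using l2_norm_triangle[OF e L2(4)] by simp
    then have 1: "\<bar>l2_inner M ?d (g n)\<bar> \<le> l2_norm M ?d * (l2_norm M ?e + l2_norm M g')"
      using l2_Cauchy_Schwarz[OF d L2(3)[of n]] by (smt (verit) l2_norm_nonneg mult_left_mono)
    have 2: "\<bar>l2_inner M f' ?e\<bar> \<le> l2_norm M f' * l2_norm M ?e"
      by (rule l2_Cauchy_Schwarz[OF L2(2) e])
    have "l2_inner M (f n) (g n) - l2_inner M f' g' = l2_inner M ?d (g n) + l2_inner M f' ?e"
      using L2 by (simp add: l2_inner_diff_left l2_inner_commute[of M f' ?e])
        (simp add: l2_inner_commute)
    with 1 2 show ?thesis by linarith
  qed
  then show "\<forall>\<^sub>F n in sequentially. norm (l2_inner M (f n) (g n) - l2_inner M f' g') \<le> ?b n"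
    by simp
qed

text \<open>Riesz--Fischer.  Along a subsequence with increments \<open>d\<^sub>k\<close> of norm at most \<open>4\<^sup>-\<^sup>k\<close> the function
  \<open>\<Sum>\<^sub>k 4\<^sup>k d\<^sub>k\<^sup>2\<close> is integrable, hence finite almost everywhere; this forces \<open>\<bar>d\<^sub>k\<bar> \<le> C 2\<^sup>-\<^sup>k\<close> pointwise, so
  the subsequence converges almost everywhere, and Fatou's lemma gives convergence in norm.\<close>

lemma l2_complete:
  assumes L2: "\<And>n. f n \<in> L2 M"
    and Cauchy: "\<And>e. e > 0 \<Longrightarrow> \<exists>N. \<forall>m\<ge>N. \<forall>n\<ge>N. l2_norm M (\<lambda>x. f m x - f n x) < e"
  obtains g where "g \<in> L2 M" "(\<lambda>n. l2_norm M (\<lambda>x. f n x - g x)) \<longlonglongrightarrow> 0"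
proof -
  have [measurable]: "f n \<in> borel_measurable M" for n
    using L2[of n] by (simp add: L2_def)
  obtain N where N: "\<And>k m n. m \<ge> N k \<Longrightarrow> n \<ge> N k \<Longrightarrow> l2_norm M (\<lambda>x. f m x - f n x) < (1/4)^k"
    using Cauchy[of "(1/4)^k" for k] by (simp add: ) metis
  define r where "r k = (\<Sum>j\<le>k. N j) + k" for k
  have rN: "N k \<le> r k" "r k \<le> r (Suc k)" "k \<le> r k" for k
    unfolding r_def by (auto simp: intro!: trans_le_add1 member_le_sum)
  define d where "d k x = f (r (Suc k)) x - f (r k) x" for k x
  have d_L2: "d k \<in> L2 M" for k
    unfolding d_def by (intro L2_diff L2)
  then have [measurable]: "d k \<in> borel_measurable M" for k
    by (rule L2_measurable)
  have d_norm: "l2_norm M (d k) \<le> (1/4)^k" for k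
    unfolding d_def using N[of k "r (Suc k)" "r k"] rN[of k] by simp
  have "(\<integral>\<^sup>+x. (\<Sum>k. ennreal (4^k * (d k x)\<^sup>2)) \<partial>M) = (\<Sum>k. \<integral>\<^sup>+x. ennreal (4^k * (d k x)\<^sup>2) \<partial>M)"
    by (rule nn_integral_suminf) simp
  also have "\<dots> \<le> (\<Sum>k. ennreal ((1/4)^k))"
  proof (rule suminf_le)
    fix k
    have "(\<integral>\<^sup>+x. ennreal (4^k * (d k x)\<^sup>2) \<partial>M) = ennreal (4^k) * ennreal ((l2_norm M (d k))\<^sup>2)"
      using nn_integral_square_L2[OF d_L2] by (simp add: ennreal_mult nn_integral_cmult)
    also have "\<dots> \<le> ennreal (4^k) * ennreal (((1/4)^k)\<^sup>2)"
      using d_norm by (intro mult_left_mono ennreal_leI power_mono) auto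
    also have "\<dots> = ennreal ((1/4)^k)"
      by (simp add: ennreal_mult[symmetric] power2_eq_square power_divide)
    finally show "(\<integral>\<^sup>+x. ennreal (4^k * (d k x)\<^sup>2) \<partial>M) \<le> ennreal ((1/4)^k)" .
  qed auto
  also have "\<dots> < \<infinity>"
    by (subst suminf_ennreal2) (auto simp: summable_geometric)
  finally have "AE x in M. (\<Sum>k. ennreal (4^k * (d k x)\<^sup>2)) \<noteq> \<infinity>"
    by (intro nn_integral_PInf_AE) auto
  then have conv: "AE x in M. convergent (\<lambda>k. f (r k) x)"
  proof eventually_elim
    case (elim x)
    define H where "H = (\<Sum>k. ennreal (4^k * (d k x)\<^sup>2))"
    have "H \<noteq> \<infinity>"
      using elim unfolding H_def by simp
    then obtain H' where H': "H = ennreal H'" "0 \<le> H'"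
      by (cases H rule: ennreal_cases) (simp_all only: infinity_ennreal_def simp_thms)
    have "\<bar>d k x\<bar> \<le> sqrt H' * (1/2)^k" for k
    proof -
      have "ennreal (4^k * (d k x)\<^sup>2) \<le> H"
      proof -
        have "(\<Sum>j\<in>{k}. ennreal (4^j * (d j x)\<^sup>2)) \<le> H"
          unfolding H_def by (rule sum_le_suminf) (rule summableI, rule finite.intros, rule finite.intros, rule zero_le)
        then show ?thesis by (simp only: sum.insert finite.emptyI sum.empty empty_iff add_0_right not_False_eq_True)
      qed
      then have "4^k * (d k x)\<^sup>2 \<le> H'"
        unfolding H'(1) by (simp only: ennreal_le_iff[OF H'(2)])
      then have "(2^k * \<bar>d k x\<bar>)\<^sup>2 \<le> H'"
        using power_mult_distrib[of "2::real" 2 k] by (simp add: power2_eq_square ac_simps)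
      then have "2^k * \<bar>d k x\<bar> \<le> sqrt H'"
        by (rule real_le_rsqrt)
      then show ?thesis by (simp add: pos_le_divide_eq power_one_over mult.commute)
    qed
    moreover have "summable (\<lambda>k. sqrt H' * (1/2)^k)"
      by (intro summable_mult summable_geometric) simp
    ultimately have "summable (\<lambda>k. d k x)"
      by (metis (no_types, lifting) real_norm_def summable_comparison_test')
    then have "convergent (\<lambda>n. \<Sum>k<n. f (r (Suc k)) x - f (r k) x)"
      unfolding d_def by (simp add: summable_iff_convergent)
    then have "convergent (\<lambda>n. f (r n) x - f (r 0) x)"
      by (simp only: sum_lessThan_telescope[of "\<lambda>n. f (r n) x"])
    then have "convergent (\<lambda>n. (f (r n) x - f (r 0) x) + f (r 0) x)"
      by (intro convergent_add convergent_const)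
    then show ?case by simp
  qed
  define g where "g x = lim (\<lambda>k. f (r k) x)" for x
  have g_meas [measurable]: "g \<in> borel_measurable M"
    unfolding g_def by (rule borel_measurable_lim_metric) simp
  have close: "(\<integral>\<^sup>+x. ennreal ((f n x - g x)\<^sup>2) \<partial>M) \<le> ennreal (e\<^sup>2)"
    if e: "e > 0" and n: "\<And>m. m \<ge> n \<Longrightarrow> l2_norm M (\<lambda>x. f n x - f m x) < e" for n e
  proof -
    have "(\<integral>\<^sup>+x. ennreal ((f n x - g x)\<^sup>2) \<partial>M)
        = (\<integral>\<^sup>+x. liminf (\<lambda>k. ennreal ((f n x - f (r k) x)\<^sup>2)) \<partial>M)"
    proof (rule nn_integral_cong_AE, use conv in eventually_elim)
      case (elim x)
      then have "(\<lambda>k. f (r k) x) \<longlonglongrightarrow> g x"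
        by (simp add: g_def convergent_LIMSEQ_iff)
      then have "(\<lambda>k. ennreal ((f n x - f (r k) x)\<^sup>2)) \<longlonglongrightarrow> ennreal ((f n x - g x)\<^sup>2)"
        by (intro tendsto_intros)
      then show ?case
        by (rule lim_imp_Liminf[OF trivial_limit_sequentially, symmetric])
    qed
    also have "\<dots> \<le> liminf (\<lambda>k. \<integral>\<^sup>+x. ennreal ((f n x - f (r k) x)\<^sup>2) \<partial>M)"
      by (rule nn_integral_liminf) simp
    also have "\<dots> \<le> ennreal (e\<^sup>2)"
    proof (rule Liminf_le, simp, rule eventually_sequentiallyI)
      fix k assume "n \<le> k"
      then have "n \<le> r k" using rN(3)[of k] by simp
      then show "(\<integral>\<^sup>+x. ennreal ((f n x - f (r k) x)\<^sup>2) \<partial>M) \<le> ennreal (e\<^sup>2)"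
        using n[of "r k"] nn_integral_square_L2[OF L2_diff[OF L2 L2], of n "r k"]
        by (auto intro!: ennreal_leI power_mono)
    qed
    finally show ?thesis .
  qed
  have "\<exists>n. (\<lambda>x. f n x - g x) \<in> L2 M"
  proof -
    obtain n where "\<And>m. m \<ge> n \<Longrightarrow> l2_norm M (\<lambda>x. f n x - f m x) < 1"
      using Cauchy[of 1] by (metis order_refl zero_less_one)
    from close[OF _ this] have "(\<lambda>x. f n x - g x) \<in> L2 M"
      by (auto simp: L2_iff_nn_integral order_le_less_trans)
    then show ?thesis ..
  qed
  then obtain n0 where "(\<lambda>x. f n0 x - g x) \<in> L2 M" ..
  from L2_diff[OF L2[of n0] this] have g: "g \<in> L2 M" by simp
  have "(\<lambda>n. l2_norm M (\<lambda>x. f n x - g x)) \<longlonglongrightarrow> 0"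
  proof (rule LIMSEQ_I)
    fix e :: real assume e: "e > 0"
    obtain K where K: "\<And>m n. m \<ge> K \<Longrightarrow> n \<ge> K \<Longrightarrow> l2_norm M (\<lambda>x. f m x - f n x) < e / 2"
      using Cauchy[of "e/2"] e by auto
    have half: "l2_norm M (\<lambda>x. f n x - g x) \<le> e / 2" if "n \<ge> K" for n
    proof (rule power2_le_imp_le)
      show "(l2_norm M (\<lambda>x. f n x - g x))\<^sup>2 \<le> (e/2)\<^sup>2"
        using close[of "e/2" n] K that e nn_integral_square_L2[OF L2_diff[OF L2[of n] g]] by simp
    qed (use e in simp)
    have "l2_norm M (\<lambda>x. f n x - g x) < e" if "n \<ge> K" for n
      using half[OF that] e by linarith
    then show "\<exists>K. \<forall>n\<ge>K. norm (l2_norm M (\<lambda>x. f n x - g x) - 0) < e"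
      by (intro exI[of _ K]) simp
  qed
  with g show ?thesis by (rule that)
qed

section \<open>Orthogonal complements in Hilbert space\<close>

lemma subspace_closure:
  fixes S :: "'b::real_normed_vector set"
  assumes S: "subspace S"
  shows "subspace (closure S)"
  unfolding subspace_def
proof (intro conjI ballI allI)
  show "0 \<in> closure S"
    using subspace_0[OF S] closure_subset by blast
next
  fix x y assume "x \<in> closure S" "y \<in> closure S"
  then obtain a b where "\<And>n. a n \<in> S" "a \<longlonglongrightarrow> x" "\<And>n. b n \<in> S" "b \<longlonglongrightarrow> y"
    by (auto simp: closure_sequential)
  then show "x + y \<in> closure S"
    unfolding closure_sequential using subspace_add[OF S]
    by (intro exI[of _ "\<lambda>n. a n + b n"]) (auto intro: tendsto_add)
next
  fix r x assume "x \<in> closure S"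
  then obtain a where "\<And>n. a n \<in> S" "a \<longlonglongrightarrow> x"
    by (auto simp: closure_sequential)
  then show "r *\<^sub>R x \<in> closure S"
    unfolding closure_sequential using subspace_scale[OF S]
    by (intro exI[of _ "\<lambda>n. r *\<^sub>R a n"]) (auto intro: tendsto_scaleR)
qed

lemma closed_subspace_projection:
  fixes C :: "'h::{real_inner,complete_space} set"
  assumes C: "subspace C" "closed C"
  obtains p where "p \<in> C" "\<And>x. x \<in> C \<Longrightarrow> inner (w - p) x = 0"
proof -
  define N where "N = (\<lambda>x. (norm (w - x))\<^sup>2) ` C"
  have N: "N \<noteq> {}" "bdd_below N"
    using subspace_0[OF C(1)] by (auto simp: N_def intro!: bdd_belowI2[of _ 0])
  have lower: "Inf N \<le> (norm (w - x))\<^sup>2" if "x \<in> C" for x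
    using that N by (auto simp: N_def intro!: cInf_lower)
  have "\<exists>x\<in>C. (norm (w - x))\<^sup>2 < Inf N + 1 / Suc n" for n :: nat
    using cInf_lessD[of N "Inf N + 1 / Suc n"] N by (auto simp: N_def)
  then obtain p where p: "\<And>n. p n \<in> C" "\<And>n::nat. (norm (w - p n))\<^sup>2 < Inf N + 1 / Suc n"
    by metis
  \<comment> \<open>parallelogram law: the midpoint of two almost minimizers is no closer than the infimum\<close>
  have mid: "(norm (p m - p n))\<^sup>2 \<le> 2 / Suc m + 2 / Suc n" for m n
  proof -
    have "(1/2) *\<^sub>R (p m + p n) \<in> C"
      using p(1) C(1) by (intro subspace_mul subspace_add)
    from lower[OF this] have "4 * Inf N \<le> 4 * (norm (w - (1/2) *\<^sub>R (p m + p n)))\<^sup>2" by simp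
    also have "\<dots> + (norm (p m - p n))\<^sup>2 = 2 * (norm (w - p m))\<^sup>2 + 2 * (norm (w - p n))\<^sup>2"
      by (simp add: power2_norm_eq_inner inner_simps inner_commute algebra_simps)
    finally show ?thesis
      using p(2)[of m] p(2)[of n] by simp
  qed
  have "Cauchy p"
  proof (rule metric_CauchyI)
    fix e :: real assume e: "e > 0"
    obtain K :: nat where K: "4 / e\<^sup>2 < Suc K"
      by (metis reals_Archimedean2 less_Suc_eq of_nat_less_iff order_less_trans)
    have "dist (p m) (p n) < e" if "m \<ge> K" "n \<ge> K" for m n
    proof (rule power2_less_imp_less)
      have "2 / Suc m \<le> 2 / Suc K" "2 / Suc n \<le> 2 / Suc K"
        using that by (auto intro!: divide_left_mono)
      then have "(norm (p m - p n))\<^sup>2 \<le> 4 / Suc K"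
        using mid[of m n] by linarith
      also have "\<dots> < e\<^sup>2"
        using K e by (simp add: field_simps)
      finally show "(dist (p m) (p n))\<^sup>2 < e\<^sup>2"
        by (simp add: dist_norm)
    qed (use e in simp)
    then show "\<exists>M. \<forall>m\<ge>M. \<forall>n\<ge>M. dist (p m) (p n) < e" by blast
  qed
  then obtain q where q: "p \<longlonglongrightarrow> q"
    using Cauchy_convergent convergent_def by blast
  have qC: "q \<in> C"
    using C(2) p(1) q closed_sequentially by blast
  have "(norm (w - q))\<^sup>2 \<le> Inf N"
  proof (rule LIMSEQ_le)
    show "(\<lambda>n. (norm (w - p n))\<^sup>2) \<longlonglongrightarrow> (norm (w - q))\<^sup>2"
      by (intro tendsto_intros q)
    show "(\<lambda>n. Inf N + 1 / Suc n) \<longlonglongrightarrow> Inf N"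
      using tendsto_add[OF tendsto_const LIMSEQ_inverse_real_of_nat] by (simp add: inverse_eq_divide)
  qed (use p(2) in \<open>auto intro: less_imp_le\<close>)
  then have best: "(norm (w - q))\<^sup>2 \<le> (norm (w - x))\<^sup>2" if "x \<in> C" for x
    using lower[OF that] by linarith
  have "inner (w - q) x = 0" if x: "x \<in> C" for x
  proof (rule ccontr)
    assume ne: "inner (w - q) x \<noteq> 0"
    then have x0: "inner x x > 0" by auto
    define t where "t = inner (w - q) x / inner x x"
    have "q + t *\<^sub>R x \<in> C"
      using qC x C(1) by (intro subspace_add subspace_mul)
    from best[OF this] have "(norm (w - q))\<^sup>2 \<le> (norm ((w - q) - t *\<^sub>R x))\<^sup>2"
      by (simp add: algebra_simps)
    also have "\<dots> = (norm (w - q))\<^sup>2 - 2 * t * inner (w - q) x + t\<^sup>2 * inner x x"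
      unfolding power2_norm_eq_inner
      by (simp add: inner_diff_left inner_diff_right inner_commute power2_eq_square algebra_simps)
    also have "\<dots> = (norm (w - q))\<^sup>2 - (inner (w - q) x)\<^sup>2 / inner x x"
      using x0 by (simp add: t_def power2_eq_square field_simps)
    finally show False
      using ne x0 by (simp add: divide_le_0_iff)
  qed
  with qC show ?thesis by (rule that)
qed

text \<open>For a vector orthogonal to \<open>u\<close>, the difference from its projection onto the closed span of \<open>X\<close> is
  orthogonal both to \<open>u\<close> and to \<open>X\<close>, hence zero.  The case \<open>u = 0\<close> is the density criterion.\<close>

lemma closure_span_eq_orthogonal:
  fixes X :: "'h::{real_inner,complete_space} set"
  assumes orth: "\<And>x. x \<in> X \<Longrightarrow> inner u x = 0"
    and total: "\<And>v. inner u v = 0 \<Longrightarrow> (\<And>x. x \<in> X \<Longrightarrow> inner v x = 0) \<Longrightarrow> v = 0"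
  shows "closure (span X) = {v. inner u v = 0}"
proof
  have closed: "closed {v. inner u v = 0}"
    by (intro closed_Collect_eq continuous_intros)
  have "span X \<subseteq> {v. inner u v = 0}"
    by (rule span_minimal) (auto simp: orth subspace_hyperplane)
  then show "closure (span X) \<subseteq> {v. inner u v = 0}"
    using closed by (rule closure_minimal)
next
  show "{v. inner u v = 0} \<subseteq> closure (span X)"
  proof
    fix w assume w: "w \<in> {v. inner u v = 0}"
    have cs: "subspace (closure (span X))" "closed (closure (span X))"
      by (auto intro: subspace_closure)
    obtain p where p: "p \<in> closure (span X)" "\<And>x. x \<in> closure (span X) \<Longrightarrow> inner (w - p) x = 0"
      using closed_subspace_projection[OF cs] by metis
    have "p \<in> {v. inner u v = 0}"
    proof -
      have "span X \<subseteq> {v. inner u v = 0}"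
        by (rule span_minimal) (auto simp: orth subspace_hyperplane)
      moreover have "closed {v. inner u v = 0}"
        by (intro closed_Collect_eq continuous_intros)
      ultimately show ?thesis
        using p(1) closure_minimal by blast
    qed
    then have "inner u (w - p) = 0"
      using w by (simp add: inner_diff_right)
    moreover have "inner (w - p) x = 0" if "x \<in> X" for x
      using p(2) that span_base closure_subset by blast
    ultimately have "w - p = 0"
      by (rule total)
    then show "w \<in> closure (span X)"
      using p(1) by simp
  qed
qed

section \<open>Isometries determined by Gram matrices\<close>

lemma span_image_obtain_sum:
  fixes y :: "'i \<Rightarrow> 'b::real_vector"
  assumes "x \<in> span (y ` I)"
  obtains S c where "finite S" "S \<subseteq> I" "x = (\<Sum>t\<in>S. c t *\<^sub>R y t)"
proof -
  obtain A r where A: "finite A" "A \<subseteq> y ` I" "x = (\<Sum>a\<in>A. r a *\<^sub>R a)"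
    using assms by (auto simp: span_explicit)
  obtain S where S: "S \<subseteq> I" "inj_on y S" "A = y ` S"
    using A(2) by (auto simp: subset_image_inj)
  show ?thesis
  proof (rule that)
    show "finite S"
      using A(1) S finite_imageD by blast
    show "x = (\<Sum>t\<in>S. r (y t) *\<^sub>R y t)"
      using A(3) S by (simp add: sum.reindex)
  qed (rule S)
qed

lemma sum_in_span_image:
  "S \<subseteq> I \<Longrightarrow> (\<Sum>t\<in>S. c t *\<^sub>R y t) \<in> span (y ` I)"
  by (intro span_sum span_scale span_base) auto

lemma choice_pair: "(\<And>n. \<exists>x y. Q n x y) \<Longrightarrow> \<exists>f g. \<forall>n. Q n (f n) (g n)"
  by metis

lemma l2_closed_span_sequence:
  assumes "Z \<in> l2_closed_span M I k"
  obtains S c where "\<And>n::nat. finite (S n)" "\<And>n. S n \<subseteq> I"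
    "(\<lambda>n. l2_norm M (\<lambda>x. (\<Sum>t\<in>S n. c n t * k t x) - Z x)) \<longlonglongrightarrow> 0"
proof -
  have "\<exists>S c. finite S \<and> S \<subseteq> I \<and> l2_norm M (\<lambda>x. Z x - (\<Sum>t\<in>S. c t * k t x)) < 1 / Suc n" for n :: nat
    using assms by (simp add: l2_closed_span_def)
  then obtain S c where S: "\<And>n. finite (S n)" "\<And>n. S n \<subseteq> I"
    "\<And>n::nat. l2_norm M (\<lambda>x. Z x - (\<Sum>t\<in>S n. c n t * k t x)) < 1 / Suc n"
    by metis
  have "(\<lambda>n. l2_norm M (\<lambda>x. (\<Sum>t\<in>S n. c n t * k t x) - Z x)) \<longlonglongrightarrow> 0"
  proof (rule Lim_null_comparison[OF _ LIMSEQ_inverse_real_of_nat])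
    show "\<forall>\<^sub>F n in sequentially. norm (l2_norm M (\<lambda>x. (\<Sum>t\<in>S n. c n t * k t x) - Z x)) \<le> inverse (real (Suc n))"
      using S(3) by (intro always_eventually allI) (simp add: l2_norm_commute inverse_eq_divide less_imp_le)
  qed
  with S(1,2) show ?thesis by (rule that)
qed

text \<open>A total family \<open>e\<close> in a Hilbert space and a family \<open>k\<close> in \<open>L\<^sup>2(M)\<close> with the same Gram matrix.
  The closure of the graph \<open>\<Sum> c\<^sub>t e\<^sub>t \<mapsto> \<Sum> c\<^sub>t k\<^sub>t\<close> is the graph of an isometry.\<close>

context
  fixes e :: "'i \<Rightarrow> 'h::{real_inner,complete_space}" and k :: "'i \<Rightarrow> 'a \<Rightarrow> real"
    and M :: "'a measure" and I :: "'i set"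
  assumes k_L2: "\<And>t. t \<in> I \<Longrightarrow> k t \<in> L2 M"
    and gram: "\<And>s t. s \<in> I \<Longrightarrow> t \<in> I \<Longrightarrow> inner (e s) (e t) = l2_inner M (k s) (k t)"
    and dense: "closure (span (e ` I)) = UNIV"
begin

definition represents :: "'h \<Rightarrow> ('a \<Rightarrow> real) \<Rightarrow> bool" where
  "represents h Z \<longleftrightarrow> Z \<in> L2 M \<and>
     (\<exists>S c. (\<forall>n::nat. finite (S n) \<and> S n \<subseteq> I) \<and> (\<lambda>n. \<Sum>t\<in>S n. c n t *\<^sub>R e t) \<longlonglongrightarrow> h \<and>
        (\<lambda>n. l2_norm M (\<lambda>x. (\<Sum>t\<in>S n. c n t * k t x) - Z x)) \<longlonglongrightarrow> 0)"

lemma combination_L2: "S \<subseteq> I \<Longrightarrow> (\<lambda>x. \<Sum>t\<in>S. c t * k t x) \<in> L2 M"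
  using k_L2 by (intro L2_sum L2_scale) auto

lemma combination_inner:
  assumes "S \<subseteq> I" "S' \<subseteq> I"
  shows "l2_inner M (\<lambda>x. \<Sum>t\<in>S. c t * k t x) (\<lambda>x. \<Sum>t\<in>S'. d t * k t x)
    = inner (\<Sum>t\<in>S. c t *\<^sub>R e t) (\<Sum>t\<in>S'. d t *\<^sub>R e t)"
proof -
  have "l2_inner M (\<lambda>x. \<Sum>t\<in>S. c t * k t x) (\<lambda>x. \<Sum>t\<in>S'. d t * k t x)
    = (\<Sum>s\<in>S. \<Sum>t\<in>S'. c s * d t * l2_inner M (k s) (k t))"
    using assms k_L2 by (intro l2_inner_sum_sum) auto
  also have "\<dots> = (\<Sum>s\<in>S. \<Sum>t\<in>S'. c s * d t * inner (e s) (e t))"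
    using assms gram by (intro sum.cong refl) (auto simp: subset_iff)
  finally show ?thesis
    by (simp add: inner_sum_left inner_sum_right mult.assoc mult.left_commute sum_distrib_left sum.swap[of _ S' S])
qed

lemma combination_norm_diff:
  assumes "S \<subseteq> I" "S' \<subseteq> I"
  shows "l2_norm M (\<lambda>x. (\<Sum>t\<in>S. c t * k t x) - (\<Sum>t\<in>S'. d t * k t x))
    = norm ((\<Sum>t\<in>S. c t *\<^sub>R e t) - (\<Sum>t\<in>S'. d t *\<^sub>R e t))"
proof -
  have "(l2_norm M (\<lambda>x. (\<Sum>t\<in>S. c t * k t x) - (\<Sum>t\<in>S'. d t * k t x)))\<^sup>2
    = (norm ((\<Sum>t\<in>S. c t *\<^sub>R e t) - (\<Sum>t\<in>S'. d t *\<^sub>R e t)))\<^sup>2"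
    using assms by (simp only: l2_norm_diff_square combination_L2 combination_inner power2_norm_eq_inner)
      (simp add: inner_diff_left inner_diff_right inner_commute)
  then show ?thesis by (simp add: power2_eq_iff_nonneg)
qed

text \<open>Preservation of inner products passes to the limit, and it alone yields uniqueness, linearity
  and surjectivity below: in each case a difference has norm zero after expanding its square.\<close>

lemma represents_inner:
  assumes "represents h Z" "represents h' Z'"
  shows "l2_inner M Z Z' = inner h h'"
proof -
  obtain S c where 1: "Z \<in> L2 M" "\<And>n::nat. S n \<subseteq> I" "(\<lambda>n. \<Sum>t\<in>S n. c n t *\<^sub>R e t) \<longlonglongrightarrow> h"
    "(\<lambda>n. l2_norm M (\<lambda>x. (\<Sum>t\<in>S n. c n t * k t x) - Z x)) \<longlonglongrightarrow> 0"
    using assms(1) unfolding represents_def by blast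
  obtain S' c' where 2: "Z' \<in> L2 M" "\<And>n::nat. S' n \<subseteq> I" "(\<lambda>n. \<Sum>t\<in>S' n. c' n t *\<^sub>R e t) \<longlonglongrightarrow> h'"
    "(\<lambda>n. l2_norm M (\<lambda>x. (\<Sum>t\<in>S' n. c' n t * k t x) - Z' x)) \<longlonglongrightarrow> 0"
    using assms(2) unfolding represents_def by blast
  have "(\<lambda>n. l2_inner M (\<lambda>x. \<Sum>t\<in>S n. c n t * k t x) (\<lambda>x. \<Sum>t\<in>S' n. c' n t * k t x))
      \<longlonglongrightarrow> l2_inner M Z Z'"
    using 1 2 by (intro l2_inner_tendsto combination_L2) auto
  moreover have "(\<lambda>n. inner (\<Sum>t\<in>S n. c n t *\<^sub>R e t) (\<Sum>t\<in>S' n. c' n t *\<^sub>R e t)) \<longlonglongrightarrow> inner h h'"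
    by (intro tendsto_inner 1 2)
  ultimately show ?thesis
    using 1(2) 2(2) by (simp add: combination_inner LIMSEQ_unique)
qed

lemma represents_AE_unique:
  assumes "represents h Z" "represents h Z'"
  shows "AE x in M. Z x = Z' x"
proof (rule AE_eq_if_l2_norm_diff_0)
  show L2: "Z \<in> L2 M" "Z' \<in> L2 M"
    using assms by (auto simp: represents_def)
  have "(l2_norm M (\<lambda>x. Z x - Z' x))\<^sup>2 = 0"
    using assms by (simp add: l2_norm_diff_square[OF L2] represents_inner)
  then show "l2_norm M (\<lambda>x. Z x - Z' x) = 0" by simp
qed

lemma represents_exists: "\<exists>Z. represents h Z"
proof -
  obtain x where x: "\<And>n. x n \<in> span (e ` I)" "x \<longlonglongrightarrow> h"
    using dense closure_sequential[of h "span (e ` I)"] by auto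
  have "\<exists>S c. finite S \<and> S \<subseteq> I \<and> x n = (\<Sum>t\<in>S. c t *\<^sub>R e t)" for n
    using span_image_obtain_sum[OF x(1)[of n]] by metis
  then obtain S c where S: "\<And>n. finite (S n)" "\<And>n. S n \<subseteq> I" "\<And>n. x n = (\<Sum>t\<in>S n. c n t *\<^sub>R e t)"
    by metis
  let ?f = "\<lambda>n x. \<Sum>t\<in>S n. c n t * k t x"
  have "Cauchy x"
    using x(2) by (intro convergent_Cauchy) (auto simp: convergent_def)
  then have f_Cauchy: "\<exists>N. \<forall>m\<ge>N. \<forall>n\<ge>N. l2_norm M (\<lambda>x. ?f m x - ?f n x) < r" if "r > 0" for r
    using that S by (simp add: combination_norm_diff Cauchy_def dist_norm)
  obtain Z where "Z \<in> L2 M" "(\<lambda>n. l2_norm M (\<lambda>x. ?f n x - Z x)) \<longlonglongrightarrow> 0"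
    by (rule l2_complete[of ?f M, OF combination_L2[OF S(2)] f_Cauchy])
  moreover have "(\<lambda>n. \<Sum>t\<in>S n. c n t *\<^sub>R e t) \<longlonglongrightarrow> h"
    using x(2) by (simp flip: S(3))
  ultimately show ?thesis
    using S(1,2) unfolding represents_def by blast
qed

lemma represents_basis:
  assumes "t \<in> I"
  shows "represents (e t) (k t)"
  unfolding represents_def using assms k_L2
  by (intro conjI exI[of _ "\<lambda>n. {t}"] exI[of _ "\<lambda>n t. 1"]) (auto simp: l2_norm_def)

lemma represents_closed_span:
  assumes "represents h Z"
  shows "Z \<in> l2_closed_span M I k"
proof -
  obtain S c where 1: "Z \<in> L2 M" "\<And>n::nat. finite (S n)" "\<And>n::nat. S n \<subseteq> I"
    "(\<lambda>n. l2_norm M (\<lambda>x. (\<Sum>t\<in>S n. c n t * k t x) - Z x)) \<longlonglongrightarrow> 0"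
    using assms(1) unfolding represents_def by blast
  have "\<exists>S c. finite S \<and> S \<subseteq> I \<and> l2_norm M (\<lambda>x. Z x - (\<Sum>t\<in>S. c t * k t x)) < r" if "r > 0" for r
  proof -
    from LIMSEQ_D[OF 1(4) that]
    obtain n where "norm (l2_norm M (\<lambda>x. (\<Sum>t\<in>S n. c n t * k t x) - Z x) - 0) < r"
      by blast
    then have "l2_norm M (\<lambda>x. (\<Sum>t\<in>S n. c n t * k t x) - Z x) < r"
      by simp
    then have "l2_norm M (\<lambda>x. Z x - (\<Sum>t\<in>S n. c n t * k t x)) < r"
      by (subst l2_norm_commute)
    with 1(2,3) show ?thesis by blast
  qed
  with 1(1) show ?thesis by (simp add: l2_closed_span_def)
qed

lemma closed_span_represents:
  assumes "Z \<in> l2_closed_span M I k"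
  obtains h where "represents h Z"
proof -
  obtain S c where S: "\<And>n::nat. finite (S n)" "\<And>n. S n \<subseteq> I"
    "(\<lambda>n. l2_norm M (\<lambda>x. (\<Sum>t\<in>S n. c n t * k t x) - Z x)) \<longlonglongrightarrow> 0"
    using assms by (rule l2_closed_span_sequence) blast
  have Z: "Z \<in> L2 M"
    using assms by (simp add: l2_closed_span_def)
  let ?f = "\<lambda>n x. \<Sum>t\<in>S n. c n t * k t x"
  let ?x = "\<lambda>n. \<Sum>t\<in>S n. c n t *\<^sub>R e t"
  have "Cauchy ?x"
  proof (rule metric_CauchyI)
    fix r :: real assume "r > 0"
    then obtain N where N: "\<And>n. n \<ge> N \<Longrightarrow> l2_norm M (\<lambda>x. ?f n x - Z x) < r / 2"
      using LIMSEQ_D[OF S(3), of "r/2"] by auto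
    have "dist (?x m) (?x n) < r" if "m \<ge> N" "n \<ge> N" for m n
    proof -
      have "dist (?x m) (?x n) = l2_norm M (\<lambda>x. ?f m x - ?f n x)"
        using S(2) by (simp add: combination_norm_diff dist_norm)
      also have "\<dots> \<le> l2_norm M (\<lambda>x. ?f m x - Z x) + l2_norm M (\<lambda>x. Z x - ?f n x)"
        by (intro l2_norm_triangle_diff combination_L2 S Z)
      also have "\<dots> < r"
        using N[OF that(1)] N[OF that(2)] l2_norm_commute[of M Z "?f n"] by simp
      finally show ?thesis .
    qed
    then show "\<exists>M. \<forall>m\<ge>M. \<forall>n\<ge>M. dist (?x m) (?x n) < r" by blast
  qed
  then obtain h where "?x \<longlonglongrightarrow> h"
    using Cauchy_convergent convergent_def by blast
  with S Z have "represents h Z"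
    unfolding represents_def by blast
  then show ?thesis by (rule that)
qed

lemma isometric_isomorphism_exists:
  "\<exists>\<Phi>. isometric_isomorphism \<Phi> M (l2_closed_span M I k) \<and> (\<forall>t\<in>I. AE x in M. \<Phi> (e t) x = k t x)"
proof -
  obtain \<Phi> where \<Phi>: "\<And>h. represents h (\<Phi> h)"
    using represents_exists by metis
  have L2: "\<Phi> h \<in> L2 M" for h
    using \<Phi>[of h] by (simp add: represents_def)
  note inner = represents_inner[OF \<Phi> \<Phi>]
  have add: "AE x in M. \<Phi> (g + h) x = \<Phi> g x + \<Phi> h x" for g h
  proof (rule AE_eq_if_l2_norm_diff_0[OF L2 L2_add[OF L2 L2]])
    have "(l2_norm M (\<lambda>x. \<Phi> (g + h) x - (\<Phi> g x + \<Phi> h x)))\<^sup>2 = 0"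
      by (simp add: l2_norm_diff_square L2 L2_add l2_inner_add_left l2_inner_add_right inner
        inner_add_left inner_add_right inner_commute)
    then show "l2_norm M (\<lambda>x. \<Phi> (g + h) x - (\<Phi> g x + \<Phi> h x)) = 0" by simp
  qed
  have scale: "AE x in M. \<Phi> (a *\<^sub>R h) x = a * \<Phi> h x" for a h
  proof (rule AE_eq_if_l2_norm_diff_0[OF L2 L2_scale[OF L2]])
    have "(l2_norm M (\<lambda>x. \<Phi> (a *\<^sub>R h) x - a * \<Phi> h x))\<^sup>2 = 0"
      by (simp add: l2_norm_diff_square L2 L2_scale l2_inner_scale_left l2_inner_scale_right inner)
    then show "l2_norm M (\<lambda>x. \<Phi> (a *\<^sub>R h) x - a * \<Phi> h x) = 0" by simp
  qed
  have norm: "l2_norm M (\<Phi> h) = norm h" for h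
    using inner[of h h] by (simp add: l2_norm_square[symmetric] power2_norm_eq_inner[symmetric] power2_eq_iff_nonneg)
  have surj: "\<exists>h. AE x in M. \<Phi> h x = Z x" if Z: "Z \<in> l2_closed_span M I k" for Z
  proof -
    obtain h where "represents h Z"
      using Z by (rule closed_span_represents)
    then show ?thesis
      using represents_AE_unique[OF \<Phi>] by blast
  qed
  have "isometric_isomorphism \<Phi> M (l2_closed_span M I k)"
    unfolding isometric_isomorphism_def
    using represents_closed_span[OF \<Phi>] add scale norm surj by blast
  moreover have "AE x in M. \<Phi> (e t) x = k t x" if "t \<in> I" for t
    using represents_AE_unique[OF \<Phi> represents_basis[OF that]] .
  ultimately show ?thesis by blast
qed

end

context
  fixes \<Phi> :: "'h::{real_inner,complete_space} \<Rightarrow> 'a \<Rightarrow> real" and M :: "'a measure" and V :: "('a \<Rightarrow> real) set"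
  assumes iso: "isometric_isomorphism \<Phi> M V" and V: "V \<subseteq> L2 M"
begin

lemma isometry_L2: "\<Phi> h \<in> L2 M"
  using iso V by (auto simp: isometric_isomorphism_def)

lemma isometry_add: "AE x in M. \<Phi> (g + h) x = \<Phi> g x + \<Phi> h x"
  using iso by (simp add: isometric_isomorphism_def)

lemma isometry_scale: "AE x in M. \<Phi> (a *\<^sub>R h) x = a * \<Phi> h x"
  using iso by (simp add: isometric_isomorphism_def)

lemma isometry_norm: "l2_norm M (\<Phi> h) = norm h"
  using iso by (simp add: isometric_isomorphism_def)

lemma isometry_diff: "AE x in M. \<Phi> (g - h) x = \<Phi> g x - \<Phi> h x"
  using isometry_add[of "g - h" h] by eventually_elim simp

lemma isometry_zero: "AE x in M. \<Phi> 0 x = 0"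
  using isometry_diff[of 0 0] by eventually_elim simp

lemma isometry_norm_diff: "l2_norm M (\<lambda>x. \<Phi> g x - \<Phi> h x) = norm (g - h)"
proof -
  have "l2_norm M (\<lambda>x. \<Phi> g x - \<Phi> h x) = l2_norm M (\<Phi> (g - h))"
    using isometry_diff[of g h]
    by (intro l2_norm_cong_AE) (auto intro!: L2_measurable L2_diff isometry_L2)
  then show ?thesis by (simp add: isometry_norm)
qed

lemma isometry_inner: "l2_inner M (\<Phi> g) (\<Phi> h) = inner g h"
proof -
  have "(l2_norm M (\<lambda>x. \<Phi> g x - \<Phi> h x))\<^sup>2 = (norm (g - h))\<^sup>2"
    by (simp add: isometry_norm_diff)
  then show ?thesis
    by (simp add: l2_norm_diff_square isometry_L2 l2_norm_square[symmetric] isometry_norm)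
      (simp add: power2_norm_eq_inner inner_diff_left inner_diff_right inner_commute)
qed

lemma isometry_inject: "AE x in M. \<Phi> g x = \<Phi> h x \<Longrightarrow> g = h"
  using isometry_norm_diff[of g h] l2_norm_eq_0_iff[OF L2_diff[OF isometry_L2 isometry_L2], of g h]
  by simp

lemma isometry_sum: "finite S \<Longrightarrow> AE x in M. \<Phi> (\<Sum>t\<in>S. c t *\<^sub>R y t) x = (\<Sum>t\<in>S. c t * \<Phi> (y t) x)"
proof (induction S rule: finite_induct)
  case empty
  then show ?case using isometry_zero by simp
next
  case (insert s S)
  from insert.IH isometry_add[of "c s *\<^sub>R y s" "\<Sum>t\<in>S. c t *\<^sub>R y t"] isometry_scale[of "c s" "y s"]
  show ?case
    by eventually_elim (use insert.hyps in simp)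
qed

text \<open>Combinations of \<open>Y\<close> that converge in \<open>L\<^sup>2(M)\<close> are the images of a Cauchy sequence of the Hilbert space,
  so their limit is the image of the limit taken there.\<close>

lemma l2_closed_span_isometry:
  assumes Y_L2: "\<And>t. t \<in> I \<Longrightarrow> Y t \<in> L2 M"
    and Y: "\<And>t. t \<in> I \<Longrightarrow> AE x in M. Y t x = \<Phi> (y t) x"
  shows "l2_closed_span M I Y = {Z \<in> L2 M. \<exists>h\<in>closure (span (y ` I)). AE x in M. Z x = \<Phi> h x}"
proof -
  have sum: "AE x in M. (\<Sum>t\<in>S. c t * Y t x) = \<Phi> (\<Sum>t\<in>S. c t *\<^sub>R y t) x" if "finite S" "S \<subseteq> I" for S c
  proof -
    have "AE x in M. \<forall>t\<in>S. Y t x = \<Phi> (y t) x"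
      using that Y by (intro AE_finite_allI) auto
    with isometry_sum[OF that(1), of c y] show ?thesis
      by eventually_elim simp
  qed
  have sum_L2: "(\<lambda>x. \<Sum>t\<in>S. c t * Y t x) \<in> L2 M" if "S \<subseteq> I" for S c
    using that Y_L2 by (intro L2_sum L2_scale) auto
  have norm: "l2_norm M (\<lambda>x. Z x - (\<Sum>t\<in>S. c t * Y t x)) = l2_norm M (\<lambda>x. Z x - \<Phi> (\<Sum>t\<in>S. c t *\<^sub>R y t) x)"
    if "finite S" "S \<subseteq> I" "Z \<in> L2 M" for Z S c
    using sum[OF that(1,2), of c] that
    by (intro l2_norm_cong_AE) (auto intro!: L2_measurable L2_diff sum_L2 isometry_L2)
  show ?thesis
  proof (intro equalityI subsetI)
    fix Z assume Z: "Z \<in> l2_closed_span M I Y"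
    then have Z_L2: "Z \<in> L2 M" by (simp add: l2_closed_span_def)
    obtain S c where S: "\<And>n::nat. finite (S n)" "\<And>n. S n \<subseteq> I"
      "(\<lambda>n. l2_norm M (\<lambda>x. (\<Sum>t\<in>S n. c n t * Y t x) - Z x)) \<longlonglongrightarrow> 0"
      using Z by (rule l2_closed_span_sequence) blast
    define x where "x n = (\<Sum>t\<in>S n. c n t *\<^sub>R y t)" for n
    have lim: "(\<lambda>n. l2_norm M (\<lambda>\<omega>. Z \<omega> - \<Phi> (x n) \<omega>)) \<longlonglongrightarrow> 0"
      using S(3) unfolding x_def norm[OF S(1,2) Z_L2, symmetric] by (subst l2_norm_commute)
    have "Cauchy x"
    proof (rule metric_CauchyI)
      fix r :: real assume "r > 0"
      then obtain N where N: "\<And>n. n \<ge> N \<Longrightarrow> l2_norm M (\<lambda>\<omega>. Z \<omega> - \<Phi> (x n) \<omega>) < r / 2"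
        using LIMSEQ_D[OF lim, of "r/2"] by auto
      have "dist (x m) (x n) < r" if "m \<ge> N" "n \<ge> N" for m n
      proof -
        have "dist (x m) (x n) = l2_norm M (\<lambda>\<omega>. \<Phi> (x m) \<omega> - \<Phi> (x n) \<omega>)"
          by (simp add: isometry_norm_diff dist_norm)
        also have "\<dots> \<le> l2_norm M (\<lambda>\<omega>. \<Phi> (x m) \<omega> - Z \<omega>) + l2_norm M (\<lambda>\<omega>. Z \<omega> - \<Phi> (x n) \<omega>)"
          by (intro l2_norm_triangle_diff isometry_L2 Z_L2)
        also have "\<dots> < r"
          using N[OF that(1)] N[OF that(2)] l2_norm_commute[of M Z "\<Phi> (x m)"] by simp
        finally show ?thesis .
      qed
      then show "\<exists>M. \<forall>m\<ge>M. \<forall>n\<ge>M. dist (x m) (x n) < r" by blast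
    qed
    then obtain h where h: "x \<longlonglongrightarrow> h"
      using Cauchy_convergent convergent_def by blast
    have "l2_norm M (\<lambda>\<omega>. Z \<omega> - \<Phi> h \<omega>) \<le> 0"
    proof (rule LIMSEQ_le_const)
      have "(\<lambda>n. norm (x n - h)) \<longlonglongrightarrow> 0"
        using h by (simp add: LIM_zero tendsto_norm_zero)
      from tendsto_add[OF lim this]
      show "(\<lambda>n. l2_norm M (\<lambda>\<omega>. Z \<omega> - \<Phi> (x n) \<omega>) + norm (x n - h)) \<longlonglongrightarrow> 0"
        by simp
      show "\<exists>N. \<forall>n\<ge>N. l2_norm M (\<lambda>\<omega>. Z \<omega> - \<Phi> h \<omega>) \<le> l2_norm M (\<lambda>\<omega>. Z \<omega> - \<Phi> (x n) \<omega>) + norm (x n - h)"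
        unfolding isometry_norm_diff[symmetric]
        by (intro exI allI impI l2_norm_triangle_diff Z_L2 isometry_L2)
    qed
    then have "AE \<omega> in M. Z \<omega> = \<Phi> h \<omega>"
      using l2_norm_nonneg[of M "\<lambda>\<omega>. Z \<omega> - \<Phi> h \<omega>"]
      by (intro AE_eq_if_l2_norm_diff_0 Z_L2 isometry_L2) linarith
    moreover have "h \<in> closure (span (y ` I))"
      unfolding closure_sequential using h S(2) sum_in_span_image[of "S _" I]
      by (intro exI[of _ x]) (auto simp: x_def)
    ultimately show "Z \<in> {Z \<in> L2 M. \<exists>h\<in>closure (span (y ` I)). AE x in M. Z x = \<Phi> h x}"
      using Z_L2 by blast
  next
    fix Z assume "Z \<in> {Z \<in> L2 M. \<exists>h\<in>closure (span (y ` I)). AE x in M. Z x = \<Phi> h x}"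
    then obtain h where Z: "Z \<in> L2 M" "h \<in> closure (span (y ` I))" "AE x in M. Z x = \<Phi> h x"
      by blast
    have "\<exists>S c. finite S \<and> S \<subseteq> I \<and> l2_norm M (\<lambda>x. Z x - (\<Sum>t\<in>S. c t * Y t x)) < r" if "r > 0" for r
    proof -
      obtain x where x: "x \<in> span (y ` I)" "dist x h < r"
        using Z(2) \<open>r > 0\<close> by (auto simp: closure_approachable)
      obtain S c where S: "finite S" "S \<subseteq> I" "x = (\<Sum>t\<in>S. c t *\<^sub>R y t)"
        using x(1) by (rule span_image_obtain_sum)
      have "l2_norm M (\<lambda>x. Z x - (\<Sum>t\<in>S. c t * Y t x)) = l2_norm M (\<lambda>\<omega>. Z \<omega> - \<Phi> x \<omega>)"
        unfolding S(3) using S(1,2) Z(1) by (rule norm)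
      also have "\<dots> = l2_norm M (\<lambda>\<omega>. \<Phi> h \<omega> - \<Phi> x \<omega>)"
        using Z by (intro l2_norm_cong_AE) (auto intro!: L2_measurable L2_diff isometry_L2)
      also have "\<dots> < r"
        using x(2) by (simp add: isometry_norm_diff dist_norm norm_minus_commute)
      finally show ?thesis
        using S(1,2) by blast
    qed
    with Z(1) show "Z \<in> l2_closed_span M I Y"
      by (simp add: l2_closed_span_def)
  qed
qed

end

section \<open>Operators on square integrable functions\<close>

text \<open>Linearity is required up to null sets only, and the last clause makes the operator well
  defined on classes of functions that agree almost everywhere.\<close>

definition l2_bounded_operator :: "'a measure \<Rightarrow> real \<Rightarrow> (('a \<Rightarrow> real) \<Rightarrow> 'a \<Rightarrow> real) \<Rightarrow> bool" where
  "l2_bounded_operator M C A \<longleftrightarrow>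
     (\<forall>f\<in>L2 M. A f \<in> L2 M \<and> l2_norm M (A f) \<le> C * l2_norm M f) \<and>
     (\<forall>f\<in>L2 M. \<forall>g\<in>L2 M. AE x in M. A (\<lambda>x. f x + g x) x = A f x + A g x) \<and>
     (\<forall>c. \<forall>f\<in>L2 M. AE x in M. A (\<lambda>x. c * f x) x = c * A f x) \<and>
     (\<forall>f\<in>L2 M. \<forall>g\<in>L2 M. (AE x in M. f x = g x) \<longrightarrow> (AE x in M. A f x = A g x))"

lemma bounded_linear_transport:
  fixes \<Phi> :: "'h::{real_inner,complete_space} \<Rightarrow> 'a \<Rightarrow> real"
  assumes iso: "isometric_isomorphism \<Phi> M (L2 M)"
    and op: "l2_bounded_operator M C A"
    and B: "\<And>h. AE x in M. \<Phi> (B h) x = A (\<Phi> h) x"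
  shows "bounded_linear B"
proof (rule bounded_linear_intro)
  note L2 = isometry_L2[OF iso subset_refl]
  note add = isometry_add[OF iso subset_refl] and scale = isometry_scale[OF iso subset_refl]
  note inject = isometry_inject[OF iso subset_refl]
  fix g h and r :: real
  have "AE x in M. A (\<Phi> (g + h)) x = A (\<lambda>x. \<Phi> g x + \<Phi> h x) x"
    using op L2 add[of g h] by (auto simp: l2_bounded_operator_def L2_add)
  moreover have "AE x in M. A (\<lambda>x. \<Phi> g x + \<Phi> h x) x = A (\<Phi> g) x + A (\<Phi> h) x"
    using op L2 by (auto simp: l2_bounded_operator_def)
  ultimately have "AE x in M. \<Phi> (B (g + h)) x = \<Phi> (B g + B h) x"
    using B[of "g + h"] B[of g] B[of h] add[of "B g" "B h"] by eventually_elim simp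
  then show "B (g + h) = B g + B h"
    by (rule inject)
  have "AE x in M. A (\<Phi> (r *\<^sub>R h)) x = A (\<lambda>x. r * \<Phi> h x) x"
    using op L2 scale[of r h] by (auto simp: l2_bounded_operator_def L2_scale)
  moreover have "AE x in M. A (\<lambda>x. r * \<Phi> h x) x = r * A (\<Phi> h) x"
    using op L2 by (auto simp: l2_bounded_operator_def)
  ultimately have "AE x in M. \<Phi> (B (r *\<^sub>R h)) x = \<Phi> (r *\<^sub>R B h) x"
    using B[of "r *\<^sub>R h"] B[of h] scale[of r "B h"] by eventually_elim simp
  then show "B (r *\<^sub>R h) = r *\<^sub>R B h"
    by (rule inject)
  have A: "A (\<Phi> h) \<in> L2 M" "l2_norm M (A (\<Phi> h)) \<le> C * l2_norm M (\<Phi> h)"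
    using op L2 by (auto simp: l2_bounded_operator_def)
  have "norm (B h) = l2_norm M (\<Phi> (B h))"
    by (simp add: isometry_norm[OF iso subset_refl])
  also have "\<dots> = l2_norm M (A (\<Phi> h))"
    by (intro l2_norm_cong_AE L2_measurable L2 A B)
  also have "\<dots> \<le> norm h * C"
    using A by (simp add: isometry_norm[OF iso subset_refl] mult.commute)
  finally show "norm (B h) \<le> norm h * C" .
qed

lemma inner_bounded_linear_vanishes:
  fixes B :: "'h::real_inner \<Rightarrow> 'h"
  assumes B: "bounded_linear B" and dense: "closure (span E) = UNIV"
    and zero: "\<And>x. x \<in> E \<Longrightarrow> inner v (B x) = 0"
  shows "inner v (B x) = 0"
proof -
  interpret B: bounded_linear B by (rule B)
  have "subspace {x. inner v (B x) = 0}"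
    by (auto simp: subspace_def B.zero B.add B.scaleR inner_add_right)
  then have "span E \<subseteq> {x. inner v (B x) = 0}"
    using zero by (intro span_minimal) auto
  moreover have "closed {x. inner v (B x) = 0}"
    by (intro closed_Collect_eq continuous_intros B.continuous_on)
  ultimately have "closure (span E) \<subseteq> {x. inner v (B x) = 0}"
    by (rule closure_minimal)
  then show ?thesis using dense by auto
qed

text \<open>The kernel is given in factorised form \<open>A B\<close>; Cauchy--Schwarz applied to \<open>A \<cdot> (B f)\<close> in each row,
  followed by Tonelli, reduces the bound to the two one-dimensional estimates.\<close>

lemma (in sigma_finite_measure) schur_test:
  fixes A B :: "'a \<Rightarrow> 'a \<Rightarrow> ennreal"
  assumes [measurable]: "case_prod A \<in> borel_measurable (M \<Otimes>\<^sub>M M)"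
    "case_prod B \<in> borel_measurable (M \<Otimes>\<^sub>M M)" "c \<in> borel_measurable M" "f \<in> borel_measurable M"
    and row: "AE s in M. (\<integral>\<^sup>+u. (A s u)\<^sup>2 \<partial>M) \<le> c s"
    and col: "AE u in M. (\<integral>\<^sup>+s. c s * (B s u)\<^sup>2 \<partial>M) \<le> C"
  shows "(\<integral>\<^sup>+s. (\<integral>\<^sup>+u. A s u * (B s u * f u) \<partial>M)\<^sup>2 \<partial>M) \<le> C * (\<integral>\<^sup>+u. (f u)\<^sup>2 \<partial>M)"
proof -
  interpret P: pair_sigma_finite M M ..
  have "(\<integral>\<^sup>+s. (\<integral>\<^sup>+u. A s u * (B s u * f u) \<partial>M)\<^sup>2 \<partial>M)
      \<le> (\<integral>\<^sup>+s. c s * (\<integral>\<^sup>+u. (B s u * f u)\<^sup>2 \<partial>M) \<partial>M)"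
  proof (rule nn_integral_mono_AE, use row AE_space in eventually_elim)
    case (elim s)
    then have [measurable]: "A s \<in> borel_measurable M" "B s \<in> borel_measurable M"
      using measurable_Pair2[OF assms(1), of s] measurable_Pair2[OF assms(2), of s] by simp_all
    have "(\<integral>\<^sup>+u. A s u * (B s u * f u) \<partial>M)\<^sup>2 \<le> (\<integral>\<^sup>+u. (A s u)\<^sup>2 \<partial>M) * (\<integral>\<^sup>+u. (B s u * f u)\<^sup>2 \<partial>M)"
      by (rule Cauchy_Schwarz_nn_integral) auto
    also have "\<dots> \<le> c s * (\<integral>\<^sup>+u. (B s u * f u)\<^sup>2 \<partial>M)"
      using elim by (intro mult_right_mono) auto
    finally show ?case .
  qed
  also have "\<dots> = (\<integral>\<^sup>+s. (\<integral>\<^sup>+u. c s * (B s u)\<^sup>2 * (f u)\<^sup>2 \<partial>M) \<partial>M)"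
  proof (rule nn_integral_cong)
    fix s assume "s \<in> space M"
    then have [measurable]: "B s \<in> borel_measurable M"
      using measurable_Pair2[OF assms(2), of s] by simp
    show "c s * (\<integral>\<^sup>+u. (B s u * f u)\<^sup>2 \<partial>M) = (\<integral>\<^sup>+u. c s * (B s u)\<^sup>2 * (f u)\<^sup>2 \<partial>M)"
      by (subst nn_integral_cmult[symmetric]) (auto simp: power_mult_distrib mult.assoc)
  qed
  also have "\<dots> = (\<integral>\<^sup>+u. (\<integral>\<^sup>+s. c s * (B s u)\<^sup>2 * (f u)\<^sup>2 \<partial>M) \<partial>M)"
    by (rule P.Fubini'[symmetric]) measurable
  also have "\<dots> \<le> (\<integral>\<^sup>+u. C * (f u)\<^sup>2 \<partial>M)"
  proof (rule nn_integral_mono_AE, use col AE_space in eventually_elim)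
    case (elim u)
    then have [measurable]: "(\<lambda>s. B s u) \<in> borel_measurable M"
      using measurable_Pair1[OF assms(2), of u] by simp
    have "(\<integral>\<^sup>+s. c s * (B s u)\<^sup>2 * (f u)\<^sup>2 \<partial>M) = (\<integral>\<^sup>+s. c s * (B s u)\<^sup>2 \<partial>M) * (f u)\<^sup>2"
      by (rule nn_integral_multc) simp
    also have "\<dots> \<le> C * (f u)\<^sup>2"
      using elim by (intro mult_right_mono) auto
    finally show ?case .
  qed
  also have "\<dots> = C * (\<integral>\<^sup>+u. (f u)\<^sup>2 \<partial>M)"
    by (rule nn_integral_cmult) simp
  finally show ?thesis .
qed

lemma ennreal_abs_integral_le:
  fixes f :: "'a \<Rightarrow> real"
  shows "ennreal \<bar>\<integral>x. f x \<partial>M\<bar> \<le> (\<integral>\<^sup>+x. ennreal \<bar>f x\<bar> \<partial>M)"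
  using integral_norm_bound_ennreal[of M f]
  by (cases "integrable M f") (auto simp: not_integrable_integral_eq)

lemma l2_bound_from_domination:
  assumes f: "f \<in> L2 M" and [measurable]: "g \<in> borel_measurable M"
    and dom: "AE s in M. ennreal \<bar>g s\<bar> \<le> F s"
    and F: "(\<integral>\<^sup>+s. (F s)\<^sup>2 \<partial>M) \<le> ennreal (C\<^sup>2) * (\<integral>\<^sup>+s. (ennreal \<bar>f s\<bar>)\<^sup>2 \<partial>M)"
    and C: "0 \<le> C"
  shows "g \<in> L2 M" "l2_norm M g \<le> C * l2_norm M f"
proof -
  have "(\<integral>\<^sup>+s. ennreal ((g s)\<^sup>2) \<partial>M) = (\<integral>\<^sup>+s. (ennreal \<bar>g s\<bar>)\<^sup>2 \<partial>M)"
    by (simp add: ennreal_power)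
  also have "\<dots> \<le> (\<integral>\<^sup>+s. (F s)\<^sup>2 \<partial>M)"
    by (rule nn_integral_mono_AE, use dom in eventually_elim) (rule power_mono, auto)
  also have "\<dots> \<le> ennreal (C\<^sup>2) * (\<integral>\<^sup>+s. ennreal ((f s)\<^sup>2) \<partial>M)"
    using F by (simp add: ennreal_power)
  also have "\<dots> = ennreal ((C * l2_norm M f)\<^sup>2)"
    by (simp add: nn_integral_square_L2[OF f] ennreal_mult power_mult_distrib)
  finally have le: "(\<integral>\<^sup>+s. ennreal ((g s)\<^sup>2) \<partial>M) \<le> ennreal ((C * l2_norm M f)\<^sup>2)" .
  then show g: "g \<in> L2 M"
    by (auto simp: L2_iff_nn_integral order_le_less_trans)
  have "(l2_norm M g)\<^sup>2 \<le> (C * l2_norm M f)\<^sup>2"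
    using le by (simp add: nn_integral_square_L2[OF g])
  then show "l2_norm M g \<le> C * l2_norm M f"
    by (rule power2_le_imp_le) (simp add: C)
qed

section \<open>Hardy averaging with respect to a uniformly distributed rank\<close>

lemma powr_square: "(x powr a)\<^sup>2 = x powr (2 * a)" for x a :: real
  by (simp add: power2_eq_square powr_add[symmetric])

text \<open>The function \<open>G\<close> ranks the points of the space, so that \<open>{G \<le> y}\<close> plays the part of the interval
  \<open>[0,y]\<close>.  The last assumption says that these sets generate the \<open>\<sigma>\<close>-algebra up to null sets.\<close>

locale uniform_rank = finite_measure M for M :: "'a measure" +
  fixes G :: "'a \<Rightarrow> real" and m :: real
  assumes G_measurable [measurable]: "G \<in> borel_measurable M"
    and G_nonneg: "\<And>x. x \<in> space M \<Longrightarrow> 0 \<le> G x"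
    and G_le: "\<And>x. x \<in> space M \<Longrightarrow> G x \<le> m"
    and m_pos: "0 < m"
    and uniform: "\<And>y. 0 \<le> y \<Longrightarrow> y \<le> m \<Longrightarrow> measure M {x \<in> space M. G x \<le> y} = y"
    and determining: "\<And>g::'a \<Rightarrow> real. integrable M g \<Longrightarrow>
      (\<And>y. 0 \<le> y \<Longrightarrow> y \<le> m \<Longrightarrow> (\<integral>x. (if G x \<le> y then g x else 0) \<partial>M) = 0) \<Longrightarrow> AE x in M. g x = 0"
begin

lemma distr_G: "distr M borel G = density lborel (indicator {0..m})"
proof (rule measure_eqI_lessThan)
  fix y :: real
  show "emeasure (distr M borel G) {y<..} < \<infinity>"
    by (simp add: emeasure_distr emeasure_eq_measure)
  have space: "measure M (space M) = m"
    using uniform[of m] m_pos G_le by (simp add: Collect_conj_eq) (metis (mono_tags, lifting) Collect_mem_eq Int_absorb2 mem_Collect_eq subsetI)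
  have "measure M {x \<in> space M. y < G x} = (if y < 0 then m else if y \<le> m then m - y else 0)"
  proof (cases "y < 0 \<or> m < y")
    case True
    then have "{x \<in> space M. y < G x} = (if y < 0 then space M else {})"
      using G_nonneg G_le m_pos by (force simp: not_less)
    then show ?thesis using True space by auto
  next
    case False
    have "measure M {x \<in> space M. y < G x} = measure M (space M) - measure M {x \<in> space M. G x \<le> y}"
      by (subst finite_measure_compl[symmetric]) (auto intro!: arg_cong[where f="measure M"])
    then show ?thesis
      using False space uniform[of y] by simp
  qed
  moreover have "{0..m} \<inter> {y<..} = (if y < 0 then {0..m} else {y<..m})"
    by auto
  ultimately show "emeasure (distr M borel G) {y<..} = emeasure (density lborel (indicator {0..m})) {y<..}"
    using m_pos by (simp add: emeasure_distr emeasure_eq_measure emeasure_density vimage_def Int_def conj_commute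
        indicator_inter_arith[symmetric])
qed auto

lemma nn_integral_G:
  assumes [measurable]: "\<phi> \<in> borel_measurable borel"
  shows "(\<integral>\<^sup>+x. \<phi> (G x) \<partial>M) = (\<integral>\<^sup>+y. indicator {0..m} y * \<phi> y \<partial>lborel)"
proof -
  have "(\<integral>\<^sup>+x. \<phi> (G x) \<partial>M) = (\<integral>\<^sup>+y. \<phi> y \<partial>distr M borel G)"
    by (simp add: nn_integral_distr)
  also have "\<dots> = (\<integral>\<^sup>+y. indicator {0..m} y * \<phi> y \<partial>lborel)"
    unfolding distr_G by (rule nn_integral_density) auto
  finally show ?thesis .
qed

lemma G_pos: "AE x in M. 0 < G x"
proof -
  have "emeasure M {x \<in> space M. G x \<le> 0} = 0"
    using uniform[of 0] m_pos by (simp add: emeasure_eq_measure)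
  then have "AE x in M. \<not> G x \<le> 0"
    by (subst AE_iff_measurable[OF _ refl]) auto
  then show ?thesis by (auto simp: not_le)
qed

text \<open>The next two lemmas are the row and column estimates for the Hardy kernel with Schur weight
  \<open>G\<^sup>-\<^sup>1\<^sup>/\<^sup>2\<close>.\<close>

lemma nn_integral_lower_inverse_sqrt:
  assumes "x \<in> space M"
  shows "(\<integral>\<^sup>+u. (if G u \<le> G x then ennreal (G u powr (-1/2)) else 0) \<partial>M) = ennreal (2 * G x powr (1/2))"
proof -
  let ?y = "G x"
  have y: "0 \<le> ?y" "?y \<le> m" using assms by (auto intro: G_nonneg G_le)
  have "(\<integral>\<^sup>+u. (if G u \<le> ?y then ennreal (G u powr (-1/2)) else 0) \<partial>M)
      = (\<integral>\<^sup>+v. indicator {0..m} v * (if v \<le> ?y then ennreal (v powr (-1/2)) else 0) \<partial>lborel)"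
    by (rule nn_integral_G) measurable
  also have "\<dots> = (\<integral>\<^sup>+v. ennreal (if v \<in> {0..?y} then v powr (-1/2) else 0) \<partial>lborel)"
    using y by (intro nn_integral_cong) (auto simp: indicator_def)
  also have "\<dots> = ennreal (?y powr (-1/2 + 1) / (-1/2 + 1))"
  proof (rule nn_integral_has_integral_lborel)
    show "((\<lambda>v. if v \<in> {0..?y} then v powr (-1/2) else 0) has_integral (?y powr (-1/2 + 1) / (-1/2 + 1))) UNIV"
      unfolding has_integral_restrict_UNIV using y by (intro has_integral_powr_from_0) auto
  next
    show "(\<lambda>v. if v \<in> {0..?y} then v powr (-1/2) else 0) \<in> borel_measurable borel"
      by measurable
  qed simp
  finally show ?thesis by (simp add: mult.commute)
qed

lemma nn_integral_upper_inverse_powr: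
  assumes "0 < G x"
  shows "(\<integral>\<^sup>+u. (if G x \<le> G u then ennreal (G u powr (-3/2)) else 0) \<partial>M) \<le> ennreal (2 * G x powr (-1/2))"
proof -
  let ?y = "G x"
  have "(\<integral>\<^sup>+u. (if ?y \<le> G u then ennreal (G u powr (-3/2)) else 0) \<partial>M)
      = (\<integral>\<^sup>+v. indicator {0..m} v * (if ?y \<le> v then ennreal (v powr (-3/2)) else 0) \<partial>lborel)"
    by (rule nn_integral_G) measurable
  also have "\<dots> \<le> (\<integral>\<^sup>+v. ennreal (if v \<in> {?y..} then v powr (-3/2) else 0) \<partial>lborel)"
    by (intro nn_integral_mono) (auto simp: indicator_def)
  also have "\<dots> = ennreal (- (?y powr (-3/2 + 1)) / (-3/2 + 1))"
  proof (rule nn_integral_has_integral_lborel)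
    show "((\<lambda>v. if v \<in> {?y..} then v powr (-3/2) else 0) has_integral (- (?y powr (-3/2 + 1)) / (-3/2 + 1))) UNIV"
      unfolding has_integral_restrict_UNIV using assms by (intro has_integral_powr_to_inf) auto
  next
    show "(\<lambda>v. if v \<in> {?y..} then v powr (-3/2) else 0) \<in> borel_measurable borel"
      by measurable
  qed simp
  finally show ?thesis by (simp add: mult.commute)
qed

lemma integral_inverse_square:
  assumes a: "0 < a" "a \<le> m"
  shows "(\<integral>u. (if a \<le> G u then 1 / (G u)\<^sup>2 else 0) \<partial>M) = 1 / a - 1 / m"
    and "(\<integral>u. (if a < G u then 1 / (G u)\<^sup>2 else 0) \<partial>M) = 1 / a - 1 / m"
proof -
  have FTC: "(\<integral>\<^sup>+v. ennreal (1 / v\<^sup>2) * indicator {a..m} v \<partial>lborel) = ennreal (- 1 / m - (- 1 / a))"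
    using a by (intro nn_integral_FTC_Icc)
      (auto intro!: derivative_eq_intros simp: power2_eq_square)
  have closed: "(\<integral>\<^sup>+u. ennreal (if a \<le> G u then 1 / (G u)\<^sup>2 else 0) \<partial>M) = ennreal (- 1 / m - (- 1 / a))"
    unfolding FTC[symmetric] using a
    by (subst nn_integral_G[of "\<lambda>v. ennreal (if a \<le> v then 1 / v\<^sup>2 else 0)"])
       (auto intro!: nn_integral_cong simp: indicator_def)
  have "(\<integral>\<^sup>+u. ennreal (if a < G u then 1 / (G u)\<^sup>2 else 0) \<partial>M)
     = (\<integral>\<^sup>+v. indicator {0..m} v * ennreal (if a < v then 1 / v\<^sup>2 else 0) \<partial>lborel)"
    by (rule nn_integral_G) measurable
  also have "\<dots> = (\<integral>\<^sup>+v. ennreal (1 / v\<^sup>2) * indicator {a..m} v \<partial>lborel)"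
    using AE_lborel_singleton[of a] a
    by (intro nn_integral_cong_AE) (auto simp: indicator_def)
  finally have opn: "(\<integral>\<^sup>+u. ennreal (if a < G u then 1 / (G u)\<^sup>2 else 0) \<partial>M) = ennreal (- 1 / m - (- 1 / a))"
    by (simp only: FTC)
  have "- 1 / m - (- 1 / a) \<ge> 0"
    using a by (simp add: frac_le)
  then show "(\<integral>u. (if a \<le> G u then 1 / (G u)\<^sup>2 else 0) \<partial>M) = 1 / a - 1 / m"
    "(\<integral>u. (if a < G u then 1 / (G u)\<^sup>2 else 0) \<partial>M) = 1 / a - 1 / m"
    by (subst integral_eq_nn_integral; simp add: closed opn)+
qed

definition lower_mean :: "('a \<Rightarrow> real) \<Rightarrow> 'a \<Rightarrow> real" where
  "lower_mean f s = 1 / G s * (\<integral>u. (if G u \<le> G s then f u else 0) \<partial>M)"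

definition upper_integral :: "('a \<Rightarrow> real) \<Rightarrow> 'a \<Rightarrow> real" where
  "upper_integral f s = (\<integral>u. (if G s \<le> G u then f u / G u else 0) \<partial>M)"

lemma lower_mean_measurable [measurable]:
  assumes [measurable]: "f \<in> borel_measurable M"
  shows "lower_mean f \<in> borel_measurable M"
  unfolding lower_mean_def[abs_def] by measurable

lemma upper_integral_measurable [measurable]:
  assumes [measurable]: "f \<in> borel_measurable M"
  shows "upper_integral f \<in> borel_measurable M"
  unfolding upper_integral_def[abs_def] by measurable

text \<open>The kernel \<open>1\<^bsub>G(u) \<le> G(s)\<^esub> / G(s)\<close> is split as \<open>G(u)\<^sup>-\<^sup>1\<^sup>/\<^sup>4\<close> times \<open>G(u)\<^sup>1\<^sup>/\<^sup>4 / G(s)\<close>, which leaves an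
  integrable power in both variables and yields Hardy's constant \<open>2\<close>.\<close>

lemma lower_mean_bound:
  assumes f: "f \<in> L2 M"
  shows "lower_mean f \<in> L2 M" "l2_norm M (lower_mean f) \<le> 2 * l2_norm M f"
proof -
  have [measurable]: "f \<in> borel_measurable M" using f by (simp add: L2_def)
  define A where "A s u = (if G u \<le> G s then ennreal (G u powr (-1/4)) else 0)" for s u
  define B where "B s u = (if G u \<le> G s then ennreal (G u powr (1/4) / G s) else 0)" for s u
  have meas: "case_prod A \<in> borel_measurable (M \<Otimes>\<^sub>M M)" "case_prod B \<in> borel_measurable (M \<Otimes>\<^sub>M M)"
    unfolding A_def[abs_def] B_def[abs_def] by measurable
  have "(\<integral>\<^sup>+s. (\<integral>\<^sup>+u. A s u * (B s u * ennreal \<bar>f u\<bar>) \<partial>M)\<^sup>2 \<partial>M) \<le> 4 * (\<integral>\<^sup>+u. (ennreal \<bar>f u\<bar>)\<^sup>2 \<partial>M)"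
  proof (rule schur_test[OF meas])
    show "AE s in M. (\<integral>\<^sup>+u. (A s u)\<^sup>2 \<partial>M) \<le> ennreal (2 * G s powr (1/2))"
    proof (rule AE_I2)
      fix s assume s: "s \<in> space M"
      have "(\<integral>\<^sup>+u. (A s u)\<^sup>2 \<partial>M) = (\<integral>\<^sup>+u. (if G u \<le> G s then ennreal (G u powr (-1/2)) else 0) \<partial>M)"
        by (intro nn_integral_cong) (auto simp: A_def ennreal_power powr_square)
      with nn_integral_lower_inverse_sqrt[OF s]
      show "(\<integral>\<^sup>+u. (A s u)\<^sup>2 \<partial>M) \<le> ennreal (2 * G s powr (1/2))" by simp
    qed
    show "AE u in M. (\<integral>\<^sup>+s. ennreal (2 * G s powr (1/2)) * (B s u)\<^sup>2 \<partial>M) \<le> 4"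
      using G_pos
    proof eventually_elim
      case (elim u)
      have "ennreal (2 * G s powr (1/2)) * (B s u)\<^sup>2
          = ennreal (2 * G u powr (1/2)) * (if G u \<le> G s then ennreal (G s powr (-3/2)) else 0)" for s
      proof (cases "G u \<le> G s")
        case True
        then have s: "0 < G s" using elim by simp
        have "G s powr (1/2) = G s powr (-3/2) * (G s)\<^sup>2"
          using s by (simp add: powr_add[symmetric] flip: powr_numeral)
        moreover have "(G u powr (1/4))\<^sup>2 = G u powr (1/2)"
          by (simp add: powr_square)
        ultimately have "2 * G s powr (1/2) * (G u powr (1/4) / G s)\<^sup>2 = 2 * G u powr (1/2) * G s powr (-3/2)"
          using s by (simp add: power_divide)
        then show ?thesis
          using True s by (simp add: B_def ennreal_power ennreal_mult[symmetric])
      qed (simp add: B_def)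
      then have "(\<integral>\<^sup>+s. ennreal (2 * G s powr (1/2)) * (B s u)\<^sup>2 \<partial>M)
          = ennreal (2 * G u powr (1/2)) * (\<integral>\<^sup>+s. (if G u \<le> G s then ennreal (G s powr (-3/2)) else 0) \<partial>M)"
        by (simp add: nn_integral_cmult)
      also have "\<dots> \<le> ennreal (2 * G u powr (1/2)) * ennreal (2 * G u powr (-1/2))"
        using elim by (intro mult_left_mono nn_integral_upper_inverse_powr) auto
      also have "\<dots> = 4"
        using elim by (simp add: ennreal_mult[symmetric] powr_add[symmetric])
      finally show ?case .
    qed
  qed measurable
  then have F: "(\<integral>\<^sup>+s. (\<integral>\<^sup>+u. A s u * (B s u * ennreal \<bar>f u\<bar>) \<partial>M)\<^sup>2 \<partial>M) \<le> ennreal (2\<^sup>2) * (\<integral>\<^sup>+u. (ennreal \<bar>f u\<bar>)\<^sup>2 \<partial>M)"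
    by simp
  have dom: "AE s in M. ennreal \<bar>lower_mean f s\<bar> \<le> (\<integral>\<^sup>+u. A s u * (B s u * ennreal \<bar>f u\<bar>) \<partial>M)"
    using G_pos
  proof eventually_elim
    case (elim s)
    have "ennreal \<bar>lower_mean f s\<bar> = ennreal (1 / G s) * ennreal \<bar>\<integral>u. (if G u \<le> G s then f u else 0) \<partial>M\<bar>"
      using elim by (simp add: lower_mean_def abs_mult ennreal_mult[symmetric])
    also have "\<dots> \<le> ennreal (1 / G s) * (\<integral>\<^sup>+u. ennreal \<bar>if G u \<le> G s then f u else 0\<bar> \<partial>M)"
      by (intro mult_left_mono ennreal_abs_integral_le) auto
    also have "\<dots> = (\<integral>\<^sup>+u. ennreal (1 / G s) * ennreal \<bar>if G u \<le> G s then f u else 0\<bar> \<partial>M)"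
      by (rule nn_integral_cmult[symmetric]) measurable
    also have "\<dots> = (\<integral>\<^sup>+u. A s u * (B s u * ennreal \<bar>f u\<bar>) \<partial>M)"
    proof (rule nn_integral_cong_AE, use G_pos in eventually_elim)
      case u: (elim u)
      then have "G u powr (-1/4) * (G u powr (1/4) / G s * \<bar>f u\<bar>) = 1 / G s * \<bar>f u\<bar>"
        by (simp add: powr_add[symmetric] flip: mult.assoc times_divide_eq_right)
      then show ?case
        using u elim by (auto simp: A_def B_def ennreal_mult[symmetric])
    qed
    finally show ?case .
  qed
  show "lower_mean f \<in> L2 M" "l2_norm M (lower_mean f) \<le> 2 * l2_norm M f"
    using l2_bound_from_domination[OF f _ dom F] by auto
qed

text \<open>The transposed kernel \<open>1\<^bsub>G(s) \<le> G(u)\<^esub> / G(u)\<close>, split as \<open>G(u)\<^sup>-\<^sup>3\<^sup>/\<^sup>4\<close> times \<open>G(u)\<^sup>-\<^sup>1\<^sup>/\<^sup>4\<close>.\<close>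

lemma upper_integral_bound:
  assumes f: "f \<in> L2 M"
  shows "upper_integral f \<in> L2 M" "l2_norm M (upper_integral f) \<le> 2 * l2_norm M f"
proof -
  have [measurable]: "f \<in> borel_measurable M" using f by (simp add: L2_def)
  define A where "A s u = (if G s \<le> G u then ennreal (G u powr (-3/4)) else 0)" for s u
  define B where "B s u = (if G s \<le> G u then ennreal (G u powr (-1/4)) else 0)" for s u
  have meas: "case_prod A \<in> borel_measurable (M \<Otimes>\<^sub>M M)" "case_prod B \<in> borel_measurable (M \<Otimes>\<^sub>M M)"
    unfolding A_def[abs_def] B_def[abs_def] by measurable
  have "(\<integral>\<^sup>+s. (\<integral>\<^sup>+u. A s u * (B s u * ennreal \<bar>f u\<bar>) \<partial>M)\<^sup>2 \<partial>M) \<le> 4 * (\<integral>\<^sup>+u. (ennreal \<bar>f u\<bar>)\<^sup>2 \<partial>M)"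
  proof (rule schur_test[OF meas])
    show "AE s in M. (\<integral>\<^sup>+u. (A s u)\<^sup>2 \<partial>M) \<le> ennreal (2 * G s powr (-1/2))"
      using G_pos
    proof eventually_elim
      case (elim s)
      have "(\<integral>\<^sup>+u. (A s u)\<^sup>2 \<partial>M) = (\<integral>\<^sup>+u. (if G s \<le> G u then ennreal (G u powr (-3/2)) else 0) \<partial>M)"
        by (intro nn_integral_cong) (auto simp: A_def ennreal_power powr_square)
      with nn_integral_upper_inverse_powr[OF elim] show ?case by simp
    qed
    show "AE u in M. (\<integral>\<^sup>+s. ennreal (2 * G s powr (-1/2)) * (B s u)\<^sup>2 \<partial>M) \<le> 4"
      using G_pos AE_space
    proof eventually_elim
      case (elim u)
      have "ennreal (2 * G s powr (-1/2)) * (B s u)\<^sup>2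
          = ennreal (2 * G u powr (-1/2)) * (if G s \<le> G u then ennreal (G s powr (-1/2)) else 0)" for s
        by (simp add: B_def ennreal_power ennreal_mult[symmetric] powr_square)
      then have "(\<integral>\<^sup>+s. ennreal (2 * G s powr (-1/2)) * (B s u)\<^sup>2 \<partial>M)
          = ennreal (2 * G u powr (-1/2)) * (\<integral>\<^sup>+s. (if G s \<le> G u then ennreal (G s powr (-1/2)) else 0) \<partial>M)"
        by (simp add: nn_integral_cmult)
      also have "\<dots> = ennreal (2 * G u powr (-1/2)) * ennreal (2 * G u powr (1/2))"
        using elim(2) by (simp add: nn_integral_lower_inverse_sqrt)
      also have "\<dots> = 4"
        using elim by (simp add: ennreal_mult[symmetric] powr_add[symmetric])
      finally show ?case by simp
    qed
  qed measurable
  then have F: "(\<integral>\<^sup>+s. (\<integral>\<^sup>+u. A s u * (B s u * ennreal \<bar>f u\<bar>) \<partial>M)\<^sup>2 \<partial>M) \<le> ennreal (2\<^sup>2) * (\<integral>\<^sup>+u. (ennreal \<bar>f u\<bar>)\<^sup>2 \<partial>M)"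
    by simp
  have dom: "AE s in M. ennreal \<bar>upper_integral f s\<bar> \<le> (\<integral>\<^sup>+u. A s u * (B s u * ennreal \<bar>f u\<bar>) \<partial>M)"
  proof (rule AE_I2)
    fix s
    have "ennreal \<bar>upper_integral f s\<bar> \<le> (\<integral>\<^sup>+u. ennreal \<bar>if G s \<le> G u then f u / G u else 0\<bar> \<partial>M)"
      unfolding upper_integral_def by (rule ennreal_abs_integral_le)
    also have "\<dots> = (\<integral>\<^sup>+u. A s u * (B s u * ennreal \<bar>f u\<bar>) \<partial>M)"
    proof (rule nn_integral_cong_AE, use G_pos in eventually_elim)
      case u: (elim u)
      then have "G u powr (-3/4) * (G u powr (-1/4) * \<bar>f u\<bar>) = \<bar>f u\<bar> / G u"
        by (simp add: powr_add[symmetric] powr_minus_divide flip: mult.assoc)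
      then show ?case
        using u by (auto simp: A_def B_def ennreal_mult[symmetric])
    qed
    finally show "ennreal \<bar>upper_integral f s\<bar> \<le> (\<integral>\<^sup>+u. A s u * (B s u * ennreal \<bar>f u\<bar>) \<partial>M)" .
  qed
  show "upper_integral f \<in> L2 M" "l2_norm M (upper_integral f) \<le> 2 * l2_norm M f"
    using l2_bound_from_domination[OF f _ dom F] by auto
qed

lemma L2_integrable: "f \<in> L2 M \<Longrightarrow> integrable M f"
  by (rule square_integrable_imp_integrable) (auto simp: L2_def)

lemma integrable_lower: "f \<in> L2 M \<Longrightarrow> integrable M (\<lambda>u. if G u \<le> y then f u else 0)"
  by (rule Bochner_Integration.integrable_bound[OF L2_integrable]) (auto simp: L2_def)

lemma integrable_upper:
  assumes f: "f \<in> L2 M" and y: "0 < y" and [measurable]: "Measurable.pred M P"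
    and P: "\<And>u. P u \<Longrightarrow> y \<le> G u"
  shows "integrable M (\<lambda>u. if P u then f u / G u else 0)"
proof (rule Bochner_Integration.integrable_bound)
  show "integrable M (\<lambda>u. f u / y)"
    using L2_integrable[OF f] by simp
  show "(\<lambda>u. if P u then f u / G u else 0) \<in> borel_measurable M"
    using f by (auto simp: L2_def)
  have "\<bar>f u / G u\<bar> \<le> \<bar>f u / y\<bar>" if "P u" for u
    using P[OF that] y by (auto simp: abs_divide intro!: divide_left_mono)
  then show "AE u in M. norm (if P u then f u / G u else 0) \<le> norm (f u / y)"
    by (auto simp del: abs_divide)
qed

definition alpha :: "('a \<Rightarrow> real) \<Rightarrow> 'a \<Rightarrow> real" where
  "alpha f s = f s - lower_mean f s"

definition beta :: "('a \<Rightarrow> real) \<Rightarrow> 'a \<Rightarrow> real" where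
  "beta f s = f s - upper_integral f s"

lemma l2_diff_bound:
  assumes "f \<in> L2 M" "g \<in> L2 M" "l2_norm M g \<le> 2 * l2_norm M f"
  shows "(\<lambda>s. f s - g s) \<in> L2 M \<and> l2_norm M (\<lambda>s. f s - g s) \<le> 3 * l2_norm M f"
  using l2_norm_triangle_diff[of f M "\<lambda>_. 0" g] l2_norm_commute[of M "\<lambda>_. 0" g] assms L2_zero[of M]
  by (simp add: L2_diff)

lemma alpha_bounded: "l2_bounded_operator M 3 alpha"
  unfolding l2_bounded_operator_def
proof (intro conjI ballI allI impI)
  fix f assume f: "f \<in> L2 M"
  have "alpha f \<in> L2 M \<and> l2_norm M (alpha f) \<le> 3 * l2_norm M f"
    unfolding alpha_def[abs_def] using f lower_mean_bound[OF f] by (rule l2_diff_bound)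
  then show "alpha f \<in> L2 M" "l2_norm M (alpha f) \<le> 3 * l2_norm M f" by auto
  show "AE x in M. alpha (\<lambda>x. c * f x) x = c * alpha f x" for c
  proof (rule AE_I2)
    fix s
    have "(\<integral>u. (if G u \<le> G s then c * f u else 0) \<partial>M) = (\<integral>u. c * (if G u \<le> G s then f u else 0) \<partial>M)"
      by (intro Bochner_Integration.integral_cong) auto
    then show "alpha (\<lambda>x. c * f x) s = c * alpha f s"
      by (simp add: alpha_def lower_mean_def algebra_simps)
  qed
next
  fix f g assume fg: "f \<in> L2 M" "g \<in> L2 M"
  show "AE x in M. alpha (\<lambda>x. f x + g x) x = alpha f x + alpha g x"
  proof (rule AE_I2)
    fix s
    have "(\<integral>u. (if G u \<le> G s then f u + g u else 0) \<partial>M)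
        = (\<integral>u. (if G u \<le> G s then f u else 0) + (if G u \<le> G s then g u else 0) \<partial>M)"
      by (intro Bochner_Integration.integral_cong) auto
    then show "alpha (\<lambda>x. f x + g x) s = alpha f s + alpha g s"
      by (simp add: alpha_def lower_mean_def algebra_simps integrable_lower fg)
  qed
  assume eq: "AE x in M. f x = g x"
  have "lower_mean f s = lower_mean g s" for s
    unfolding lower_mean_def using eq fg by (intro arg_cong2[where f="(*)"] refl integral_cong_AE) (auto simp: L2_def)
  then show "AE x in M. alpha f x = alpha g x"
    using eq by (auto simp: alpha_def)
qed

lemma beta_bounded: "l2_bounded_operator M 3 beta"
  unfolding l2_bounded_operator_def
proof (intro conjI ballI allI impI)
  fix f assume f: "f \<in> L2 M"
  have "beta f \<in> L2 M \<and> l2_norm M (beta f) \<le> 3 * l2_norm M f"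
    unfolding beta_def[abs_def] using f upper_integral_bound[OF f] by (rule l2_diff_bound)
  then show "beta f \<in> L2 M" "l2_norm M (beta f) \<le> 3 * l2_norm M f" by auto
  show "AE x in M. beta (\<lambda>x. c * f x) x = c * beta f x" for c
  proof (rule AE_I2)
    fix s
    have "(\<integral>u. (if G s \<le> G u then c * f u / G u else 0) \<partial>M) = (\<integral>u. c * (if G s \<le> G u then f u / G u else 0) \<partial>M)"
      by (intro Bochner_Integration.integral_cong) auto
    then show "beta (\<lambda>x. c * f x) s = c * beta f s"
      by (simp add: beta_def upper_integral_def algebra_simps)
  qed
next
  fix f g assume fg: "f \<in> L2 M" "g \<in> L2 M"
  show "AE x in M. beta (\<lambda>x. f x + g x) x = beta f x + beta g x"
    using G_pos
  proof eventually_elim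
    case (elim s)
    have "(\<integral>u. (if G s \<le> G u then (f u + g u) / G u else 0) \<partial>M)
        = (\<integral>u. (if G s \<le> G u then f u / G u else 0) + (if G s \<le> G u then g u / G u else 0) \<partial>M)"
      by (intro Bochner_Integration.integral_cong) (auto simp: add_divide_distrib)
    also have "\<dots> = upper_integral f s + upper_integral g s"
      unfolding upper_integral_def using elim
      by (intro Bochner_Integration.integral_add integrable_upper[OF fg(1) elim] integrable_upper[OF fg(2) elim]) auto
    finally show ?case
      by (simp add: beta_def upper_integral_def)
  qed
  assume eq: "AE x in M. f x = g x"
  have "upper_integral f s = upper_integral g s" for s
    unfolding upper_integral_def using eq fg by (intro integral_cong_AE) (auto simp: L2_def)
  then show "AE x in M. beta f x = beta g x"
    using eq by (auto simp: beta_def)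
qed


section \<open>The ranges of the operators\<close>

definition upper_inverse :: "real \<Rightarrow> 'a \<Rightarrow> real" where
  "upper_inverse y u = (if y < G u then 1 / G u else 0)"

definition lower_indicator :: "real \<Rightarrow> 'a \<Rightarrow> real" where
  "lower_indicator y u = (if G u \<le> y then 1 else 0)"

lemma L2_bounded:
  assumes [measurable]: "f \<in> borel_measurable M" and "\<And>x. \<bar>f x\<bar> \<le> C"
  shows "f \<in> L2 M"
proof -
  have "(f x)\<^sup>2 \<le> C\<^sup>2" for x
    using assms(2)[of x] by (metis abs_ge_zero power2_abs power_mono)
  then have "integrable M (\<lambda>x. (f x)\<^sup>2)"
    by (intro integrable_const_bound[where B="C\<^sup>2"]) auto
  then show ?thesis by (simp add: L2_def)
qed

lemma upper_inverse_L2: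
  assumes "0 < y"
  shows "upper_inverse y \<in> L2 M"
proof (rule L2_bounded)
  show "upper_inverse y \<in> borel_measurable M"
    unfolding upper_inverse_def[abs_def] by measurable
  show "\<bar>upper_inverse y u\<bar> \<le> 1 / y" for u
    using assms by (auto simp: upper_inverse_def frac_le)
qed

lemma lower_indicator_L2: "lower_indicator y \<in> L2 M"
proof (rule L2_bounded)
  show "lower_indicator y \<in> borel_measurable M"
    unfolding lower_indicator_def[abs_def] by measurable
  show "\<bar>lower_indicator y u\<bar> \<le> 1" for u
    by (auto simp: lower_indicator_def)
qed

lemma const_L2: "(\<lambda>_. c) \<in> L2 M"
  by (rule L2_bounded[where C="\<bar>c\<bar>"]) auto

lemma integral_lower_indicator:
  assumes "0 \<le> y" "y \<le> m"
  shows "(\<integral>u. lower_indicator y u \<partial>M) = y"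
proof -
  have "(\<integral>u. lower_indicator y u \<partial>M) = (\<integral>u. indicator {x \<in> space M. G x \<le> y} u \<partial>M)"
    by (intro Bochner_Integration.integral_cong) (auto simp: lower_indicator_def)
  then show ?thesis
    using uniform[OF assms] by simp
qed

lemma total_measure: "measure M (space M) = m"
proof -
  have "{x \<in> space M. G x \<le> m} = space M"
    using G_le by auto
  then show ?thesis
    using uniform[of m] m_pos by simp
qed

text \<open>Orthogonality to all \<open>1\<^bsub>{G > y}\<^esub>/G\<close> kills the integrals of \<open>g/G\<close> over \<open>{\<epsilon> < G \<le> y}\<close>; the cut-off at
  \<open>\<epsilon> = 1/(n+1)\<close> keeps \<open>g/G\<close> integrable.\<close>

lemma upper_inverse_total:
  assumes g: "g \<in> L2 M" and orth: "\<And>y. 0 < y \<Longrightarrow> y \<le> m \<Longrightarrow> l2_inner M g (upper_inverse y) = 0"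
  shows "AE x in M. g x = 0"
proof -
  have [measurable]: "g \<in> borel_measurable M" using g by (simp add: L2_def)
  have "AE x in M. (if 1 / Suc n < G x then g x / G x else 0) = 0" for n :: nat
  proof (rule determining)
    let ?e = "1 / real (Suc n)"
    have int: "integrable M (\<lambda>x. if y < G x then g x / G x else 0)" if "0 < y" for y
      using that by (intro integrable_upper[OF g that]) auto
    show "integrable M (\<lambda>x. if ?e < G x then g x / G x else 0)"
      by (rule int) simp
    have inner: "(\<integral>x. (if y < G x then g x / G x else 0) \<partial>M) = 0" if "0 < y" for y
    proof -
      have "(\<integral>x. (if y < G x then g x / G x else 0) \<partial>M) = l2_inner M g (upper_inverse y)"
        unfolding l2_inner_def by (intro Bochner_Integration.integral_cong) (auto simp: upper_inverse_def)
      moreover have "l2_inner M g (upper_inverse y) = (\<integral>x. 0 \<partial>M)" if "m < y"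
        unfolding l2_inner_def using that G_le
        by (intro Bochner_Integration.integral_cong) (force simp: upper_inverse_def)+
      ultimately show ?thesis using orth[OF that] by (cases "y \<le> m") auto
    qed
    fix y :: real
    have "(\<integral>x. (if G x \<le> y then if ?e < G x then g x / G x else 0 else 0) \<partial>M)
        = (\<integral>x. (if ?e < G x then g x / G x else 0) - (if max ?e y < G x then g x / G x else 0) \<partial>M)"
      by (intro Bochner_Integration.integral_cong) auto
    also have "\<dots> = 0"
      by (subst Bochner_Integration.integral_diff) (auto simp: int inner less_max_iff_disj simp del: max_less_iff_conj)
    finally show "(\<integral>x. (if G x \<le> y then if ?e < G x then g x / G x else 0 else 0) \<partial>M) = 0" .
  qed
  then have "AE x in M. \<forall>n::nat. (if 1 / Suc n < G x then g x / G x else 0) = 0"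
    by (simp add: AE_all_countable)
  with G_pos show ?thesis
  proof eventually_elim
    case (elim x)
    obtain n :: nat where "1 / real (Suc n) < G x"
      using elim(1) nat_approx_posE by blast
    then show ?case
      using elim by (metis divide_eq_0_iff less_numeral_extra(3))
  qed
qed

lemma alpha_lower_indicator:
  assumes y: "0 < y" "y \<le> m"
  shows "AE s in M. alpha (lower_indicator y) s = - y * upper_inverse y s"
  using G_pos AE_space
proof eventually_elim
  case (elim s)
  have "(\<integral>u. (if G u \<le> G s then lower_indicator y u else 0) \<partial>M) = (\<integral>u. lower_indicator (min y (G s)) u \<partial>M)"
    by (intro Bochner_Integration.integral_cong) (auto simp: lower_indicator_def)
  also have "\<dots> = min y (G s)"
    using elim y G_le[OF elim(2)] by (intro integral_lower_indicator) auto
  finally show ?case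
    using elim by (auto simp: alpha_def lower_mean_def lower_indicator_def upper_inverse_def)
qed

lemma beta_upper_inverse:
  assumes y: "0 < y" "y \<le> m"
  shows "AE s in M. beta (upper_inverse y) s = 1 / m - lower_indicator y s / y"
  using AE_space
proof eventually_elim
  case (elim s)
  show ?case
  proof (cases "G s \<le> y")
    case True
    have "upper_integral (upper_inverse y) s = (\<integral>u. (if y < G u then 1 / (G u)\<^sup>2 else 0) \<partial>M)"
      unfolding upper_integral_def using True
      by (intro Bochner_Integration.integral_cong) (auto simp: upper_inverse_def power2_eq_square)
    then show ?thesis
      using True y by (simp add: beta_def upper_inverse_def lower_indicator_def integral_inverse_square)
  next
    case False
    have "upper_integral (upper_inverse y) s = (\<integral>u. (if G s \<le> G u then 1 / (G u)\<^sup>2 else 0) \<partial>M)"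
      unfolding upper_integral_def using False
      by (intro Bochner_Integration.integral_cong) (auto simp: upper_inverse_def power2_eq_square)
    then show ?thesis
      using False y G_le[OF elim] by (simp add: beta_def upper_inverse_def lower_indicator_def integral_inverse_square)
  qed
qed

lemma beta_image_L2: "(\<lambda>s. 1 / m - lower_indicator y s / y) \<in> L2 M"
  using L2_diff[OF const_L2 L2_scale[OF lower_indicator_L2[of y], of "1 / y"], of "1 / m"] by simp

lemma beta_image_mean_zero:
  assumes y: "0 < y" "y \<le> m"
  shows "l2_inner M (\<lambda>s. 1 / m - lower_indicator y s / y) (\<lambda>_. 1) = 0"
  using y m_pos L2_integrable[OF lower_indicator_L2]
  by (simp add: l2_inner_def integral_lower_indicator total_measure)

text \<open>For \<open>g\<close> of mean zero the constant \<open>1/m\<close> does not contribute, so orthogonality to the images of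
  \<open>\<beta>\<close> says that \<open>g\<close> has integral zero over every \<open>{G \<le> y}\<close>.\<close>

lemma mean_zero_orthogonal_lower_indicators:
  assumes g: "g \<in> L2 M" and mean: "l2_inner M (\<lambda>_. 1) g = 0"
    and orth: "\<And>y. 0 < y \<Longrightarrow> y \<le> m \<Longrightarrow> l2_inner M g (\<lambda>s. 1 / m - lower_indicator y s / y) = 0"
  shows "AE x in M. g x = 0"
proof (rule determining)
  have [measurable]: "g \<in> borel_measurable M" using g by (simp add: L2_def)
  show "integrable M g" by (rule L2_integrable[OF g])
  fix y assume y: "0 \<le> y" "y \<le> m"
  have eq: "(\<integral>x. (if G x \<le> y then g x else 0) \<partial>M) = l2_inner M g (lower_indicator y)"
    unfolding l2_inner_def by (intro Bochner_Integration.integral_cong) (auto simp: lower_indicator_def)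
  show "(\<integral>x. (if G x \<le> y then g x else 0) \<partial>M) = 0"
  proof (cases "y = 0")
    case True
    have "(\<integral>x. (if G x \<le> y then g x else 0) \<partial>M) = (\<integral>x. 0 \<partial>M)"
      using G_pos by (intro integral_cong_AE) (auto simp: True)
    then show ?thesis by simp
  next
    case False
    have "l2_inner M g (\<lambda>s. 1 / m - lower_indicator y s / y)
        = 1 / m * l2_inner M g (\<lambda>_. 1) - 1 / y * l2_inner M g (lower_indicator y)"
    proof -
      have "(\<lambda>s. 1 / m - lower_indicator y s / y) = (\<lambda>s. 1 / m * 1 + (- 1 / y) * lower_indicator y s)"
        by auto
      then show ?thesis
        using g by (simp only: l2_inner_add_right l2_inner_scale_right L2_scale const_L2 lower_indicator_L2)
    qed
    then have "l2_inner M g (lower_indicator y) = 0"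
      using mean orth[of y] y False by (simp add: l2_inner_commute)
    then show ?thesis by (simp add: eq)
  qed
qed

context
  fixes \<Phi> :: "'h::{real_inner,complete_space} \<Rightarrow> 'a \<Rightarrow> real" and E :: "'h set"
  assumes iso: "isometric_isomorphism \<Phi> M (L2 M)" and dense: "closure (span E) = UNIV"
begin

lemma isometry_onto:
  assumes "f \<in> L2 M"
  obtains h where "AE x in M. \<Phi> h x = f x"
  using iso assms by (auto simp: isometric_isomorphism_def)

lemmas isometry_facts = isometry_L2[OF iso subset_refl] isometry_inner[OF iso subset_refl]
  isometry_inject[OF iso subset_refl] isometry_zero[OF iso subset_refl]

lemma isometry_eq_0: "AE x in M. \<Phi> h x = 0 \<Longrightarrow> h = 0"
  using isometry_facts(4) by (intro isometry_facts(3)) (auto elim: eventually_elim2)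

lemma operator_image:
  assumes op: "l2_bounded_operator M C A" and B: "\<And>h. AE x in M. \<Phi> (B h) x = A (\<Phi> h) x"
    and f: "f \<in> L2 M" and g: "g \<in> L2 M" and Af: "AE x in M. A f x = g x"
    and h: "AE x in M. \<Phi> h x = f x"
  shows "AE x in M. \<Phi> (B h) x = g x"
proof -
  have "AE x in M. A (\<Phi> h) x = A f x"
    using op h f isometry_facts(1)[of h] by (auto simp: l2_bounded_operator_def)
  with B[of h] Af show ?thesis by eventually_elim simp
qed

lemma inner_eq_l2_inner:
  assumes "f \<in> L2 M" "AE x in M. \<Phi> h x = f x"
  shows "inner v h = l2_inner M (\<Phi> v) f"
  unfolding isometry_facts(2)[symmetric] using assms
  by (intro l2_inner_cong_AE L2_measurable isometry_facts(1)) auto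

text \<open>By continuity a vector orthogonal to \<open>B ` E\<close> is orthogonal to the whole range of \<open>B\<close>, whose image
  under \<open>\<Phi>\<close> contains the total family of all \<open>- y 1\<^bsub>{G > y}\<^esub>/G\<close>.\<close>

lemma alpha_range_dense:
  assumes B: "\<And>h. AE x in M. \<Phi> (B h) x = alpha (\<Phi> h) x"
  shows "closure (span (B ` E)) = UNIV"
proof -
  have lin: "bounded_linear B"
    by (rule bounded_linear_transport[OF iso alpha_bounded B])
  have "closure (span (B ` E)) = {v. inner 0 v = 0}"
  proof (rule closure_span_eq_orthogonal)
    fix v assume vE: "\<And>x. x \<in> B ` E \<Longrightarrow> inner v x = 0"
    have v: "inner v (B h) = 0" for h
      by (rule inner_bounded_linear_vanishes[OF lin dense]) (auto intro: vE)
    have "AE x in M. \<Phi> v x = 0"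
    proof (rule upper_inverse_total[OF isometry_facts(1)])
      fix y :: real assume y: "0 < y" "y \<le> m"
      obtain h where h: "AE x in M. \<Phi> h x = lower_indicator y x"
        using isometry_onto[OF lower_indicator_L2] by metis
      have L2: "(\<lambda>x. - y * upper_inverse y x) \<in> L2 M"
        by (intro L2_scale upper_inverse_L2 y)
      have "AE x in M. \<Phi> (B h) x = - y * upper_inverse y x"
        by (rule operator_image[OF alpha_bounded B lower_indicator_L2 L2 alpha_lower_indicator[OF y] h])
      then have "0 = l2_inner M (\<Phi> v) (\<lambda>x. - y * upper_inverse y x)"
        using inner_eq_l2_inner[OF L2] v by metis
      then show "l2_inner M (\<Phi> v) (upper_inverse y) = 0"
        using y by (simp only: l2_inner_scale_right) simp
    qed
    then show "v = 0" by (rule isometry_eq_0)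
  qed simp
  then show ?thesis by simp
qed

text \<open>The functional \<open>h \<mapsto> (u, B h)\<close> is continuous and vanishes on the preimages of the total family
  \<open>1\<^bsub>{G > y}\<^esub>/G\<close>, hence everywhere: the range is contained in the complement of \<open>u\<close>.  Equality holds
  because a function of mean zero orthogonal to the images of this family is zero.\<close>

lemma beta_range_closure:
  assumes B: "\<And>h. AE x in M. \<Phi> (B h) x = beta (\<Phi> h) x"
    and u: "AE x in M. \<Phi> u x = 1"
  shows "closure (span (B ` E)) = {v. inner u v = 0}"
proof (rule closure_span_eq_orthogonal)
  have lin: "bounded_linear B"
    by (rule bounded_linear_transport[OF iso beta_bounded B])
  have inner_u: "inner v u = l2_inner M (\<Phi> v) (\<lambda>_. 1)" for v
    by (rule inner_eq_l2_inner[OF const_L2 u])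
  have image: "AE x in M. \<Phi> (B h) x = 1 / m - lower_indicator y x / y"
    if y: "0 < y" "y \<le> m" and h: "AE x in M. \<Phi> h x = upper_inverse y x" for y h
    by (rule operator_image[OF beta_bounded B upper_inverse_L2[OF y(1)] beta_image_L2 beta_upper_inverse[OF y] h])
  define X where "X = {h. \<exists>y. 0 < y \<and> y \<le> m \<and> (AE x in M. \<Phi> h x = upper_inverse y x)}"
  have "closure (span X) = {v. inner 0 v = 0}"
  proof (rule closure_span_eq_orthogonal)
    fix v assume v: "\<And>x. x \<in> X \<Longrightarrow> inner v x = 0"
    have "AE x in M. \<Phi> v x = 0"
    proof (rule upper_inverse_total[OF isometry_facts(1)])
      fix y :: real assume y: "0 < y" "y \<le> m"
      obtain h where h: "AE x in M. \<Phi> h x = upper_inverse y x"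
        using isometry_onto[OF upper_inverse_L2[OF y(1)]] by metis
      then have "inner v h = 0"
        using y by (intro v) (auto simp: X_def)
      then show "l2_inner M (\<Phi> v) (upper_inverse y) = 0"
        using inner_eq_l2_inner[OF upper_inverse_L2[OF y(1)] h] by simp
    qed
    then show "v = 0" by (rule isometry_eq_0)
  qed simp
  then have dense_X: "closure (span X) = UNIV" by simp
  have "inner u (B h) = 0" if hX: "h \<in> X" for h
  proof -
    obtain y where y: "0 < y" "y \<le> m" and h: "AE x in M. \<Phi> h x = upper_inverse y x"
      using hX by (auto simp: X_def)
    show ?thesis
      using inner_eq_l2_inner[OF beta_image_L2 image[OF y h], of u] inner_u[of "B h"]
        l2_inner_cong_AE[of "\<Phi> (B h)" M "\<lambda>s. 1 / m - lower_indicator y s / y" "\<lambda>_. 1" "\<lambda>_. 1"]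
        beta_image_mean_zero[OF y] image[OF y h] L2_measurable[OF isometry_facts(1)]
        L2_measurable[OF beta_image_L2[of y]]
      by (simp add: inner_commute)
  qed
  then have "inner u (B h) = 0" for h
    by (rule inner_bounded_linear_vanishes[OF lin dense_X])
  then show "inner u x = 0" if "x \<in> B ` E" for x
    using that by auto
  fix v assume uv: "inner u v = 0" and vE: "\<And>x. x \<in> B ` E \<Longrightarrow> inner v x = 0"
  have v: "inner v (B h) = 0" for h
    by (rule inner_bounded_linear_vanishes[OF lin dense]) (auto intro: vE)
  have "AE x in M. \<Phi> v x = 0"
  proof (rule mean_zero_orthogonal_lower_indicators[OF isometry_facts(1)])
    show "l2_inner M (\<lambda>_. 1) (\<Phi> v) = 0"
      using uv inner_u[of v] by (simp add: inner_commute l2_inner_commute)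
    fix y assume y: "0 < y" "y \<le> m"
    obtain h where h: "AE x in M. \<Phi> h x = upper_inverse y x"
      using isometry_onto[OF upper_inverse_L2[OF y(1)]] by metis
    show "l2_inner M (\<Phi> v) (\<lambda>s. 1 / m - lower_indicator y s / y) = 0"
      unfolding inner_eq_l2_inner[OF beta_image_L2 image[OF y h], symmetric] by (rule v)
  qed
  then show "v = 0" by (rule isometry_eq_0)
qed

end

end

section \<open>The Ito isometry and the covariance of the process\<close>

lemma integral_eq_0_iff_balanced:
  fixes f :: "'a \<Rightarrow> real"
  assumes "integrable M f"
  shows "(\<integral>x. f x \<partial>M) = 0 \<longleftrightarrow> (\<integral>\<^sup>+x. ennreal (f x) \<partial>M) = (\<integral>\<^sup>+x. ennreal (- f x) \<partial>M)"
proof -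
  have fin: "(\<integral>\<^sup>+x. ennreal (f x) \<partial>M) \<noteq> \<infinity>" "(\<integral>\<^sup>+x. ennreal (- f x) \<partial>M) \<noteq> \<infinity>"
    using assms by (auto simp: real_integrable_def)
  then show ?thesis
    unfolding real_lebesgue_integral_def[OF assms]
    by (metis cancel_comm_monoid_add_class.diff_cancel eq_iff_diff_eq_0 ennreal_enn2real top.not_eq_extremum infinity_ennreal_def)
qed

text \<open>The positive and negative parts of \<open>f\<close> induce finite Borel measures that agree on half-lines, hence
  on all Borel sets; Lebesgue measurable sets differ from Borel sets by null sets.\<close>

lemma AE_zero_if_initial_integrals_zero:
  fixes f :: "real \<Rightarrow> real"
  assumes f: "integrable (lebesgue_on {0..T}) f" and T: "0 < T"
    and zero: "\<And>t. 0 \<le> t \<Longrightarrow> t \<le> T \<Longrightarrow> (\<integral>s. (if s \<le> t then f s else 0) \<partial>lebesgue_on {0..T}) = 0"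
  shows "AE s in lebesgue_on {0..T}. f s = 0"
proof -
  let ?M = "lebesgue_on {0..T}"
  have [measurable]: "f \<in> borel_measurable ?M" using f by simp
  have id [measurable]: "(\<lambda>s. s) \<in> borel_measurable ?M"
    by (rule continuous_imp_measurable_on_sets_lebesgue) auto
  have int: "integrable ?M (\<lambda>s. if s \<in> A then f s else 0)" if "A \<in> sets borel" for A
  proof (rule Bochner_Integration.integrable_bound[OF f])
    have [measurable]: "A \<in> sets borel" by (rule that)
    show "(\<lambda>s. if s \<in> A then f s else 0) \<in> borel_measurable ?M" by measurable
  qed auto
  have "(\<integral>s. (if s \<in> {..T} then f s else 0) \<partial>?M) = (\<integral>s. f s \<partial>?M)"
    by (intro Bochner_Integration.integral_cong) auto
  then have whole: "(\<integral>s. f s \<partial>?M) = 0"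
    using zero[of T] T by simp
  have upper: "(\<integral>s. (if s \<in> {x<..} then f s else 0) \<partial>?M) = 0" for x
  proof (cases "0 \<le> x \<and> x \<le> T")
    case True
    have "(\<integral>s. (if s \<in> {x<..} then f s else 0) \<partial>?M) = (\<integral>s. f s - (if s \<in> {..x} then f s else 0) \<partial>?M)"
      by (intro Bochner_Integration.integral_cong) auto
    then show ?thesis
      using True zero[of x] whole f int[of "{..x}"] by (simp add: Bochner_Integration.integral_diff)
  next
    case False
    then have "(\<integral>s. (if s \<in> {x<..} then f s else 0) \<partial>?M) = (\<integral>s. (if x < 0 then f s else 0) \<partial>?M)"
      by (intro Bochner_Integration.integral_cong) auto
    then show ?thesis using whole by (cases "x < 0") simp_all
  qed
  define p where "p g = distr (density ?M (\<lambda>s. ennreal (g s))) borel (\<lambda>s. s)" for g :: "real \<Rightarrow> real"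
  have p: "emeasure (p g) A = (\<integral>\<^sup>+s. ennreal (if s \<in> A then g s else 0) \<partial>?M)"
    if [measurable]: "A \<in> sets borel" "g \<in> borel_measurable ?M" for A g
  proof -
    have "emeasure (p g) A = (\<integral>\<^sup>+s. ennreal (g s) * indicator ((\<lambda>s. s) -` A \<inter> space ?M) s \<partial>?M)"
      unfolding p_def by (simp add: emeasure_distr emeasure_density)
    also have "\<dots> = (\<integral>\<^sup>+s. ennreal (if s \<in> A then g s else 0) \<partial>?M)"
      by (intro nn_integral_cong) (auto simp: indicator_def)
    finally show ?thesis .
  qed
  have p_minus: "emeasure (p (\<lambda>s. - f s)) A = (\<integral>\<^sup>+s. ennreal (- (if s \<in> A then f s else 0)) \<partial>?M)"
    if "A \<in> sets borel" for A
    using that by (subst p) (auto intro!: nn_integral_cong)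
  have "p f = p (\<lambda>s. - f s)"
  proof (rule measure_eqI_lessThan)
    fix x :: real
    have "emeasure (p f) {x<..} \<le> (\<integral>\<^sup>+s. ennreal \<bar>f s\<bar> \<partial>?M)"
      by (subst p) (auto intro!: nn_integral_mono ennreal_leI)
    also have "\<dots> < \<infinity>"
      using f by (simp add: integrable_iff_bounded)
    finally show "emeasure (p f) {x<..} < \<infinity>" .
    have "emeasure (p f) {x<..} = (\<integral>\<^sup>+s. ennreal (if s \<in> {x<..} then f s else 0) \<partial>?M)"
      by (rule p) auto
    also have "\<dots> = emeasure (p (\<lambda>s. - f s)) {x<..}"
      using upper[of x] integral_eq_0_iff_balanced[OF int[of "{x<..}"]] p_minus[of "{x<..}"] by simp
    finally show "emeasure (p f) {x<..} = emeasure (p (\<lambda>s. - f s)) {x<..}" .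
  qed (auto simp: p_def)
  then have borel: "(\<integral>s. (if s \<in> A then f s else 0) \<partial>?M) = 0" if "A \<in> sets borel" for A
    using \<open>p f = p (\<lambda>s. - f s)\<close> p[OF that, of f] p_minus[OF that] integral_eq_0_iff_balanced[OF int[OF that]]
    by simp
  have "(\<integral>s\<in>A. f s \<partial>?M) = (\<integral>s\<in>A. 0 \<partial>?M)" if A: "A \<in> sets ?M" for A
  proof -
    have "A \<in> sets lebesgue"
      using A by (auto simp: sets_restrict_space_iff)
    then obtain S N N' where S: "A = S \<union> N" "N \<subseteq> N'" "N' \<in> null_sets lborel" "S \<in> sets lborel"
      by (rule sets_completionE)
    have "AE s in lebesgue. s \<notin> N'"
      using S(3) by (intro AE_completion AE_not_in)
    then have "AE s in ?M. s \<notin> N'"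
      by (subst AE_restrict_space_iff) (auto elim: eventually_mono)
    then have "AE s in ?M. indicator A s *\<^sub>R f s = (if s \<in> S then f s else 0)"
      by eventually_elim (use S(1,2) in \<open>auto simp: indicator_def\<close>)
    then have "(\<integral>s\<in>A. f s \<partial>?M) = (\<integral>s. (if s \<in> S then f s else 0) \<partial>?M)"
      unfolding set_lebesgue_integral_def using A int[of S] S(4)
      by (intro integral_cong_AE) auto
    then show ?thesis
      using borel[of S] S(4) by (simp add: set_lebesgue_integral_def)
  qed
  then show ?thesis
    by (intro density_unique_real f) auto
qed

context volterra_gaussian
begin

lemma prob_space_P: "prob_space P"
  using brownian by (simp add: brownian_motion_def)

lemma brownian_increment:
  assumes "0 \<le> s" "s < t" "t \<le> T"
  shows "(\<lambda>\<omega>. W t \<omega> - W s \<omega>) \<in> L2 P" "(\<integral>\<omega>. W t \<omega> - W s \<omega> \<partial>P) = 0"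
    "l2_norm P (\<lambda>\<omega>. W t \<omega> - W s \<omega>) = sqrt (t - s)"
proof -
  interpret prob_space P by (rule prob_space_P)
  let ?X = "\<lambda>\<omega>. W t \<omega> - W s \<omega>"
  have D: "distributed P lborel ?X (normal_density 0 (sqrt (t - s)))"
    using brownian assms by (auto simp: brownian_motion_def)
  have pos: "0 < sqrt (t - s)" using assms by simp
  have [measurable]: "?X \<in> borel_measurable P"
    using distributed_measurable[OF D] by simp
  have "integrable P (\<lambda>\<omega>. (?X \<omega>)\<^sup>2)"
    using distributed_integrable[OF D, of "\<lambda>x. x\<^sup>2"] integrable_normal_moment[OF pos, of 0 2] by simp
  then show "?X \<in> L2 P" by (simp add: L2_def)
  show mean: "(\<integral>\<omega>. ?X \<omega> \<partial>P) = 0"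
    by (rule normal_distributed_expectation[OF pos D])
  show "l2_norm P ?X = sqrt (t - s)"
    using normal_distributed_variance[OF pos D] mean assms by (simp add: l2_norm_def)
qed

lemma W_zero: "AE \<omega> in P. W 0 \<omega> = 0"
  using brownian by (simp add: brownian_motion_def)

lemma W_measurable: "t \<in> {0..T} \<Longrightarrow> W t \<in> borel_measurable P"
  using brownian by (simp add: brownian_motion_def)

lemma W_moments:
  assumes t: "t \<in> {0..T}"
  shows "W t \<in> L2 P" "(\<integral>\<omega>. W t \<omega> \<partial>P) = 0" "l2_inner P (W t) (W t) = t"
proof -
  have [measurable]: "W t \<in> borel_measurable P" "W 0 \<in> borel_measurable P"
    using t T_pos by (auto intro!: W_measurable)
  have "W t \<in> L2 P \<and> (\<integral>\<omega>. W t \<omega> \<partial>P) = 0 \<and> l2_norm P (W t) = sqrt t"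
  proof (cases "t = 0")
    case True
    have "(\<integral>\<omega>. W t \<omega> \<partial>P) = (\<integral>\<omega>. 0 \<partial>P)"
      using W_zero True by (intro integral_cong_AE) auto
    moreover have "l2_norm P (W t) = l2_norm P (\<lambda>_. 0)"
      using W_zero True by (intro l2_norm_cong_AE) auto
    moreover have "W t \<in> L2 P"
      using W_zero True by (intro L2_cong_AE[OF L2_zero]) (auto elim: eventually_mono)
    ultimately show ?thesis using True by (simp add: l2_norm_def)
  next
    case False
    then have t': "0 \<le> (0::real)" "0 < t" "t \<le> T" using t by auto
    have eq: "AE \<omega> in P. W t \<omega> - W 0 \<omega> = W t \<omega>"
      using W_zero by eventually_elim simp
    have "(\<integral>\<omega>. W t \<omega> \<partial>P) = (\<integral>\<omega>. W t \<omega> - W 0 \<omega> \<partial>P)"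
      using eq by (intro integral_cong_AE) (auto elim: eventually_mono)
    moreover have "l2_norm P (\<lambda>\<omega>. W t \<omega> - W 0 \<omega>) = l2_norm P (W t)"
      using eq by (intro l2_norm_cong_AE) auto
    moreover have "W t \<in> L2 P"
      by (rule L2_cong_AE[OF brownian_increment(1)[OF t'] _ eq]) measurable
    ultimately show ?thesis
      using brownian_increment(2,3)[OF t'] by simp
  qed
  then show "W t \<in> L2 P" "(\<integral>\<omega>. W t \<omega> \<partial>P) = 0" "l2_inner P (W t) (W t) = t"
    using t by (auto simp: l2_norm_square[symmetric])
qed

text \<open>Polarisation of the variance \<open>t - s\<close> of an increment.\<close>

lemma W_covariance:
  assumes s: "s \<in> {0..T}" and t: "t \<in> {0..T}"
  shows "l2_inner P (W s) (W t) = min s t"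
proof -
  have *: "l2_inner P (W t) (W s) = s" if "s < t" "s \<in> {0..T}" "t \<in> {0..T}" for s t
  proof -
    have "(l2_norm P (\<lambda>\<omega>. W t \<omega> - W s \<omega>))\<^sup>2 = t - s"
      using brownian_increment(3)[of s t] that by simp
    then show ?thesis
      using that by (simp add: l2_norm_diff_square W_moments)
  qed
  show ?thesis
    using *[of s t] *[of t s] W_moments(3)[OF s] s t
    by (cases s t rule: linorder_cases) (auto simp: l2_inner_commute min_def)
qed

abbreviation leb :: "real measure" where "leb \<equiv> lebesgue_on {0..T}"

lemma indicator_L2: "indicator {0..<t} \<in> L2 leb"
proof -
  have meas: "indicat_real {0..<t} \<in> borel_measurable leb"
    by (intro measurable_restrict_space1 borel_measurable_indicator) auto
  have "finite_measure leb"
    by (rule finite_measure_lebesgue_on) auto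
  then have "integrable leb (indicat_real {0..<t})"
    using meas by (intro finite_measure.integrable_const_bound[where B=1]) auto
  moreover have "(\<lambda>s. (indicat_real {0..<t} s)\<^sup>2) = indicat_real {0..<t}"
    by (auto simp: indicator_def)
  ultimately show ?thesis
    using meas by (simp add: L2_def)
qed

lemma indicator_covariance:
  assumes s: "s \<in> {0..T}" and t: "t \<in> {0..T}"
  shows "l2_inner leb (indicator {0..<s}) (indicator {0..<t}) = min s t"
proof -
  have sub: "{0..<min s t} \<subseteq> {0..T}"
    using s t by auto
  have "l2_inner leb (indicator {0..<s}) (indicator {0..<t}) = (\<integral>u. indicator {0..<min s t} u \<partial>leb)"
    unfolding l2_inner_def by (intro Bochner_Integration.integral_cong) (auto simp: indicator_def)
  also have "\<dots> = measure leb {0..<min s t}"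
    by (simp add: Int_absorb2[OF sub])
  also have "\<dots> = min s t"
    using s t sub by (subst measure_restrict_space) auto
  finally show ?thesis .
qed

lemma wiener_sequence:
  assumes "has_wiener_integral P T W h Y"
  obtains S c where "\<And>n::nat. S n \<subseteq> {0..T}"
    "(\<lambda>n. l2_norm leb (\<lambda>s. (\<Sum>t\<in>S n. c n t * indicator {0..<t} s) - h s)) \<longlonglongrightarrow> 0"
    "(\<lambda>n. l2_norm P (\<lambda>\<omega>. (\<Sum>t\<in>S n. c n t * W t \<omega>) - Y \<omega>)) \<longlonglongrightarrow> 0"
proof -
  have ex: "\<exists>S c. S \<subseteq> {0..T} \<and>
     l2_norm leb (\<lambda>s. h s - (\<Sum>t\<in>S. c t * indicator {0..<t} s)) < inverse (Suc n) \<and>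
     l2_norm P (\<lambda>\<omega>. Y \<omega> - (\<Sum>t\<in>S. c t * W t \<omega>)) < inverse (Suc n)" for n :: nat
    using assms unfolding has_wiener_integral_def
    by (meson inverse_positive_iff_positive of_nat_0_less_iff zero_less_Suc)
  have "\<exists>S c. \<forall>n::nat. S n \<subseteq> {0..T} \<and>
     l2_norm leb (\<lambda>s. h s - (\<Sum>t\<in>S n. c n t * indicator {0..<t} s)) < inverse (Suc n) \<and>
     l2_norm P (\<lambda>\<omega>. Y \<omega> - (\<Sum>t\<in>S n. c n t * W t \<omega>)) < inverse (Suc n)"
    by (rule choice_pair) (rule ex)
  then obtain S c where S: "\<forall>n::nat. S n \<subseteq> {0..T} \<and>
     l2_norm leb (\<lambda>s. h s - (\<Sum>t\<in>S n. c n t * indicator {0..<t} s)) < inverse (Suc n) \<and>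
     l2_norm P (\<lambda>\<omega>. Y \<omega> - (\<Sum>t\<in>S n. c n t * W t \<omega>)) < inverse (Suc n)"
    by (elim exE)
  show ?thesis
  proof (rule that)
    show "S n \<subseteq> {0..T}" for n using S by blast
    show "(\<lambda>n. l2_norm leb (\<lambda>s. (\<Sum>t\<in>S n. c n t * indicator {0..<t} s) - h s)) \<longlonglongrightarrow> 0"
      by (rule Lim_null_comparison[OF _ LIMSEQ_inverse_real_of_nat], rule always_eventually)
        (use S in \<open>auto simp: l2_norm_commute[of leb _ h] intro: less_imp_le\<close>)
    show "(\<lambda>n. l2_norm P (\<lambda>\<omega>. (\<Sum>t\<in>S n. c n t * W t \<omega>) - Y \<omega>)) \<longlonglongrightarrow> 0"
      by (rule Lim_null_comparison[OF _ LIMSEQ_inverse_real_of_nat], rule always_eventually)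
        (use S in \<open>auto simp: l2_norm_commute[of P _ Y] intro: less_imp_le\<close>)
  qed
qed

text \<open>The approximating sums on both sides have the same inner products, as \<open>min s t\<close> is both the
  covariance of the Brownian motion and the product of \<open>1\<^bsub>[0,s)\<^esub>\<close> and \<open>1\<^bsub>[0,t)\<^esub>\<close>.\<close>

lemma wiener_isometry:
  assumes "has_wiener_integral P T W h Y" "has_wiener_integral P T W h' Y'"
  shows "l2_inner P Y Y' = l2_inner leb h h'"
proof -
  obtain S c where 1: "\<And>n::nat. S n \<subseteq> {0..T}"
    "(\<lambda>n. l2_norm leb (\<lambda>s. (\<Sum>t\<in>S n. c n t * indicator {0..<t} s) - h s)) \<longlonglongrightarrow> 0"
    "(\<lambda>n. l2_norm P (\<lambda>\<omega>. (\<Sum>t\<in>S n. c n t * W t \<omega>) - Y \<omega>)) \<longlonglongrightarrow> 0"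
    using assms(1) by (rule wiener_sequence) blast
  obtain S' c' where 2: "\<And>n::nat. S' n \<subseteq> {0..T}"
    "(\<lambda>n. l2_norm leb (\<lambda>s. (\<Sum>t\<in>S' n. c' n t * indicator {0..<t} s) - h' s)) \<longlonglongrightarrow> 0"
    "(\<lambda>n. l2_norm P (\<lambda>\<omega>. (\<Sum>t\<in>S' n. c' n t * W t \<omega>) - Y' \<omega>)) \<longlonglongrightarrow> 0"
    using assms(2) by (rule wiener_sequence) blast
  have L2: "h \<in> L2 leb" "Y \<in> L2 P" "h' \<in> L2 leb" "Y' \<in> L2 P"
    using assms by (auto simp: has_wiener_integral_def)
  have WL2: "(\<lambda>\<omega>. \<Sum>t\<in>A. a t * W t \<omega>) \<in> L2 P" if "A \<subseteq> {0..T}" for A a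
    using that by (intro L2_sum L2_scale W_moments) auto
  have IL2: "(\<lambda>s. \<Sum>t\<in>A. a t * indicat_real {0..<t} s) \<in> L2 leb" for A a
    by (intro L2_sum L2_scale indicator_L2)
  have eq: "l2_inner P (\<lambda>\<omega>. \<Sum>t\<in>S n. c n t * W t \<omega>) (\<lambda>\<omega>. \<Sum>t\<in>S' n. c' n t * W t \<omega>)
    = l2_inner leb (\<lambda>s. \<Sum>t\<in>S n. c n t * indicator {0..<t} s) (\<lambda>s. \<Sum>t\<in>S' n. c' n t * indicator {0..<t} s)" for n
  proof -
    have "l2_inner P (\<lambda>\<omega>. \<Sum>t\<in>S n. c n t * W t \<omega>) (\<lambda>\<omega>. \<Sum>t\<in>S' n. c' n t * W t \<omega>)
      = (\<Sum>s\<in>S n. \<Sum>t\<in>S' n. c n s * c' n t * l2_inner P (W s) (W t))"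
      using 1(1)[of n] 2(1)[of n] by (intro l2_inner_sum_sum W_moments) auto
    also have "\<dots> = (\<Sum>s\<in>S n. \<Sum>t\<in>S' n. c n s * c' n t * l2_inner leb (indicator {0..<s}) (indicator {0..<t}))"
      using 1(1)[of n] 2(1)[of n]
      by (intro sum.cong refl) (simp add: W_covariance indicator_covariance subset_iff)
    also have "\<dots> = l2_inner leb (\<lambda>s. \<Sum>t\<in>S n. c n t * indicator {0..<t} s) (\<lambda>s. \<Sum>t\<in>S' n. c' n t * indicator {0..<t} s)"
      by (intro l2_inner_sum_sum[symmetric] indicator_L2)
    finally show ?thesis .
  qed
  have "(\<lambda>n. l2_inner P (\<lambda>\<omega>. \<Sum>t\<in>S n. c n t * W t \<omega>) (\<lambda>\<omega>. \<Sum>t\<in>S' n. c' n t * W t \<omega>)) \<longlonglongrightarrow> l2_inner P Y Y'"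
    by (rule l2_inner_tendsto[OF WL2[OF 1(1)] L2(2) WL2[OF 2(1)] L2(4) 1(3) 2(3)])
  moreover have "(\<lambda>n. l2_inner leb (\<lambda>s. \<Sum>t\<in>S n. c n t * indicator {0..<t} s) (\<lambda>s. \<Sum>t\<in>S' n. c' n t * indicator {0..<t} s)) \<longlonglongrightarrow> l2_inner leb h h'"
    by (rule l2_inner_tendsto[OF IL2 L2(1) IL2 L2(3) 1(2) 2(2)])
  ultimately show ?thesis
    unfolding eq by (rule LIMSEQ_unique)
qed

lemma wiener_mean_zero:
  assumes "has_wiener_integral P T W h Y"
  shows "(\<integral>\<omega>. Y \<omega> \<partial>P) = 0"
proof -
  interpret prob_space P by (rule prob_space_P)
  obtain S c where 1: "\<And>n::nat. S n \<subseteq> {0..T}"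
    "(\<lambda>n. l2_norm leb (\<lambda>s. (\<Sum>t\<in>S n. c n t * indicator {0..<t} s) - h s)) \<longlonglongrightarrow> 0"
    "(\<lambda>n. l2_norm P (\<lambda>\<omega>. (\<Sum>t\<in>S n. c n t * W t \<omega>) - Y \<omega>)) \<longlonglongrightarrow> 0"
    using assms(1) by (rule wiener_sequence) blast
  have L2: "Y \<in> L2 P" "(\<lambda>_. 1) \<in> L2 P"
    using assms by (auto simp: has_wiener_integral_def L2_def)
  have WL2: "(\<lambda>\<omega>. \<Sum>t\<in>A. a t * W t \<omega>) \<in> L2 P" if "A \<subseteq> {0..T}" for A a
    using that by (intro L2_sum L2_scale W_moments) auto
  have "l2_inner P (\<lambda>\<omega>. \<Sum>t\<in>S n. c n t * W t \<omega>) (\<lambda>_. 1) = (\<Sum>t\<in>S n. c n t * l2_inner P (W t) (\<lambda>_. 1))" for n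
    using 1(1)[of n] L2(2) by (intro l2_inner_sum_left W_moments) auto
  then have "l2_inner P (\<lambda>\<omega>. \<Sum>t\<in>S n. c n t * W t \<omega>) (\<lambda>_. 1) = 0" for n
    using 1(1)[of n] W_moments(2) by (auto simp: l2_inner_def intro!: sum.neutral)
  moreover have "(\<lambda>n. l2_inner P (\<lambda>\<omega>. \<Sum>t\<in>S n. c n t * W t \<omega>) (\<lambda>_. 1)) \<longlonglongrightarrow> l2_inner P Y (\<lambda>_. 1)"
    by (rule l2_inner_tendsto[OF WL2[OF 1(1)] L2(1) L2(2) L2(2) 1(3)]) (simp add: l2_norm_def)
  ultimately show ?thesis
    by (simp add: l2_inner_def LIMSEQ_const_iff)
qed

lemma coord_L2: "t \<in> {0..T} \<Longrightarrow> coord t \<in> L2 P"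
  using representation[of t] by (simp add: has_wiener_integral_def)

lemma kernel_section_L2:
  assumes "t \<in> {0..T}"
  shows "z t \<in> L2 leb"
proof -
  have L2: "(\<lambda>s. indicator {0..<t} s * z t s) \<in> L2 leb"
    using representation[OF assms] by (simp add: has_wiener_integral_def)
  have eq: "indicator {0..<t} s * z t s = z t s" if "s \<in> space leb" for s
    using kernel_volterra[OF assms, of s] that by (auto simp: indicator_def)
  have "z t \<in> borel_measurable leb"
    using L2_measurable[OF L2] eq by (subst measurable_cong[of _ _ "\<lambda>s. indicator {0..<t} s * z t s"]) auto
  then show ?thesis
    by (rule L2_cong_AE[OF L2 _ AE_I2[OF eq]])
qed

lemma coord_inner:
  assumes s: "s \<in> {0..T}" and t: "t \<in> {0..T}"
  shows "l2_inner P (coord s) (coord t) = l2_inner leb (z s) (z t)"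
proof -
  have eq: "indicator {0..<t} u * z t u = z t u" if "u \<in> space leb" "t \<in> {0..T}" for t u
    using kernel_volterra[OF that(2), of u] that by (auto simp: indicator_def)
  have "l2_inner P (coord s) (coord t)
      = l2_inner leb (\<lambda>u. indicator {0..<s} u * z s u) (\<lambda>u. indicator {0..<t} u * z t u)"
    by (rule wiener_isometry[OF representation[OF s] representation[OF t]])
  also have "\<dots> = l2_inner leb (z s) (z t)"
    unfolding l2_inner_def using s t
    by (intro Bochner_Integration.integral_cong refl arg_cong2[where f="(*)"] eq)
  finally show ?thesis .
qed

lemma R_cov_eq:
  assumes "s \<in> {0..T}" "t \<in> {0..T}"
  shows "R_cov P s t = l2_inner P (coord s) (coord t)"
  using wiener_mean_zero[OF representation] assms by (simp add: R_cov_def covariance_def l2_inner_def)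

section \<open>The bracket as a rank function\<close>

abbreviation mu :: "real measure" where "mu \<equiv> dbracket T z"
abbreviation F :: "real \<Rightarrow> real" where "F \<equiv> bracket T z"

lemma T_in: "T \<in> {0..T}"
  using T_pos by simp

lemma zT_L2: "z T \<in> L2 leb"
  by (rule kernel_section_L2[OF T_in])

lemma zT_measurable [measurable]: "z T \<in> borel_measurable leb"
  by (rule L2_measurable[OF zT_L2])

lemma sets_mu [measurable_cong, simp]: "sets mu = sets leb"
  by (simp add: dbracket_def)

lemma space_mu [simp]: "space mu = {0..T}"
  by (simp add: dbracket_def)

lemma borel_measurable_mu [simp]: "borel_measurable mu = borel_measurable leb"
  by (rule measurable_cong_sets) simp_all

lemma AE_mu_iff: "(AE s in mu. Q s) \<longleftrightarrow> (AE s in leb. Q s)"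
proof -
  have "(AE s in mu. Q s) \<longleftrightarrow> (AE s in leb. 0 < ennreal ((z T s)\<^sup>2) \<longrightarrow> Q s)"
    unfolding dbracket_def by (rule AE_density) simp
  also have "\<dots> \<longleftrightarrow> (AE s in leb. Q s)"
    using kernel_T_nonzero by (intro iffI) (auto elim: eventually_elim2 eventually_mono)
  finally show ?thesis .
qed

lemma integral_mu: "f \<in> borel_measurable leb \<Longrightarrow> (\<integral>s. f s \<partial>mu) = (\<integral>s. (z T s)\<^sup>2 * f s \<partial>leb)"
  unfolding dbracket_def by (subst integral_density) auto

lemma integrable_mu: "f \<in> borel_measurable leb \<Longrightarrow> integrable mu f \<longleftrightarrow> integrable leb (\<lambda>s. (z T s)\<^sup>2 * f s)"
  unfolding dbracket_def by (subst integrable_density) auto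

lemma l2_inner_mu:
  assumes [measurable]: "f \<in> borel_measurable leb" "g \<in> borel_measurable leb"
  shows "l2_inner mu f g = l2_inner leb (\<lambda>s. f s * z T s) (\<lambda>s. g s * z T s)"
  unfolding l2_inner_def
  by (subst integral_mu) (auto intro!: Bochner_Integration.integral_cong simp: power2_eq_square)

lemma L2_mu_iff:
  assumes [measurable]: "f \<in> borel_measurable leb"
  shows "f \<in> L2 mu \<longleftrightarrow> (\<lambda>s. f s * z T s) \<in> L2 leb"
  unfolding L2_def using integrable_mu[of "\<lambda>s. (f s)\<^sup>2"]
  by (simp add: power_mult_distrib mult.commute)

definition kernel_quotient :: "real \<Rightarrow> real \<Rightarrow> real" where
  "kernel_quotient t s = z t s / z T s"

lemma kernel_quotient_times: "AE s in leb. kernel_quotient t s * z T s = z t s"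
  using kernel_T_nonzero by eventually_elim (simp add: kernel_quotient_def)

lemma kernel_quotient_measurable: "t \<in> {0..T} \<Longrightarrow> kernel_quotient t \<in> borel_measurable leb"
  unfolding kernel_quotient_def[abs_def] by (intro borel_measurable_divide L2_measurable kernel_section_L2 T_in)

lemma kernel_quotient_times_measurable: "t \<in> {0..T} \<Longrightarrow> (\<lambda>s. kernel_quotient t s * z T s) \<in> borel_measurable leb"
  using kernel_quotient_measurable by simp

lemma kernel_quotient_L2:
  assumes t: "t \<in> {0..T}"
  shows "kernel_quotient t \<in> L2 mu"
  unfolding L2_mu_iff[OF kernel_quotient_measurable[OF t]]
  by (rule L2_cong_AE[OF kernel_section_L2[OF t] kernel_quotient_times_measurable[OF t]])
    (use kernel_quotient_times[of t] in \<open>auto elim: eventually_mono\<close>)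

lemma kernel_quotient_inner:
  assumes "s \<in> {0..T}" "t \<in> {0..T}"
  shows "l2_inner mu (kernel_quotient s) (kernel_quotient t) = R_cov P s t"
proof -
  have "l2_inner mu (kernel_quotient s) (kernel_quotient t) = l2_inner leb (z s) (z t)"
    unfolding l2_inner_mu[OF kernel_quotient_measurable kernel_quotient_measurable, OF assms] using assms
    by (intro l2_inner_cong_AE kernel_quotient_times kernel_quotient_times_measurable L2_measurable kernel_section_L2)
  then show ?thesis
    using assms by (simp add: R_cov_eq coord_inner)
qed

text \<open>Multiplication by \<open>z(T,\<cdot>)\<close> is an isometry from \<open>L\<^sup>2(\<mu>)\<close> to \<open>L\<^sup>2([0,T])\<close> that carries the
  quotients to the kernels, which are total by non-degeneracy.\<close>

lemma kernel_quotient_total: "l2_closed_span mu {0<..T} kernel_quotient = L2 mu"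
proof (intro equalityI subsetI)
  fix f assume f: "f \<in> L2 mu"
  then have [measurable]: "f \<in> borel_measurable leb"
    using L2_measurable[OF f] by simp
  let ?g = "\<lambda>s. f s * z T s"
  have g: "?g \<in> l2_closed_span leb {0<..T} z"
    using f L2_mu_iff[of f] kernel_dense by simp
  have norm: "l2_norm mu (\<lambda>s. f s - (\<Sum>t\<in>S. c t * kernel_quotient t s)) = l2_norm leb (\<lambda>s. ?g s - (\<Sum>t\<in>S. c t * z t s))"
    if S: "finite S" "S \<subseteq> {0<..T}" for S c
  proof -
    have [measurable]: "kernel_quotient t \<in> borel_measurable leb" "z t \<in> borel_measurable leb" if "t \<in> S" for t
      using that S(2) by (auto intro!: kernel_quotient_measurable L2_measurable[OF kernel_section_L2])
    have sums [measurable]: "(\<lambda>s. \<Sum>t\<in>S. c t * kernel_quotient t s) \<in> borel_measurable leb"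
      "(\<lambda>s. \<Sum>t\<in>S. c t * z t s) \<in> borel_measurable leb"
      by (auto intro!: borel_measurable_sum borel_measurable_times)
    have "AE s in leb. \<forall>t\<in>S. kernel_quotient t s * z T s = z t s"
      using S(1) kernel_quotient_times by (intro AE_finite_allI) auto
    then have "AE s in leb. (f s - (\<Sum>t\<in>S. c t * kernel_quotient t s)) * z T s = ?g s - (\<Sum>t\<in>S. c t * z t s)"
      by eventually_elim (simp add: left_diff_distrib sum_distrib_right mult.assoc)
    then show ?thesis
      by (intro l2_norm_eqI, subst l2_inner_mu) (auto intro!: l2_inner_cong_AE)
  qed
  show "f \<in> l2_closed_span mu {0<..T} kernel_quotient"
    unfolding l2_closed_span_def mem_Collect_eq
  proof (intro conjI allI impI f)
    fix r :: real assume "r > 0"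
    with g obtain S c where S: "finite S" "S \<subseteq> {0<..T}"
      "l2_norm leb (\<lambda>s. ?g s - (\<Sum>t\<in>S. c t * z t s)) < r"
      unfolding l2_closed_span_def by blast
    then show "\<exists>S c. finite S \<and> S \<subseteq> {0<..T} \<and> l2_norm mu (\<lambda>s. f s - (\<Sum>t\<in>S. c t * kernel_quotient t s)) < r"
      by (intro exI[of _ S] exI[of _ c] conjI) (simp_all only: norm)
  qed
qed (simp add: l2_closed_span_def)

lemma finite_mu: "finite_measure mu"
proof
  have "integrable leb (\<lambda>s. (z T s)\<^sup>2)"
    using zT_L2 by (simp add: L2_def)
  then have "(\<integral>\<^sup>+s. ennreal ((z T s)\<^sup>2) \<partial>leb) < \<infinity>"
    by (simp add: integrable_iff_bounded)
  moreover have "emeasure mu (space mu) = (\<integral>\<^sup>+s. ennreal ((z T s)\<^sup>2) \<partial>leb)"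
    unfolding dbracket_def by (subst emeasure_density) (auto intro!: nn_integral_cong)
  ultimately show "emeasure mu (space mu) \<noteq> \<infinity>" by simp
qed

lemma AE_leb_neq: "AE s in leb. s \<noteq> a"
proof -
  have "AE s in lebesgue. s \<noteq> a"
    by (intro AE_completion AE_lborel_singleton)
  then show ?thesis
    by (subst AE_restrict_space_iff) (auto elim: eventually_mono)
qed

lemma interval_sets: "0 \<le> a \<Longrightarrow> b \<le> T \<Longrightarrow> {a<..b} \<in> sets leb" "0 \<le> a \<Longrightarrow> b \<le> T \<Longrightarrow> {a..b} \<in> sets leb"
  by (auto simp: sets_restrict_space_iff)

text \<open>Since \<open>z(T,\<cdot>)\<close> vanishes almost nowhere, an interval of \<open>\<mu>\<close>-measure zero has length zero.\<close>

lemma bracket_strict_mono: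
  assumes "0 \<le> a" "a < b" "b \<le> T"
  shows "F a < F b"
proof (rule ccontr)
  assume "\<not> F a < F b"
  then have "emeasure mu {a<..b} = 0"
    using emeasure_dbracket[of z T a b] zT_L2 assms by (simp add: ennreal_neg)
  then have "AE s in mu. s \<notin> {a<..b}"
    using assms by (intro AE_not_in) (simp add: null_sets_def interval_sets)
  then have "AE s in leb. s \<notin> {a<..b}"
    by (simp add: AE_mu_iff)
  then have "emeasure leb {a<..b} = 0"
    using assms by (subst (asm) AE_iff_measurable[OF interval_sets(1)[of a b]]) auto
  then show False
    using assms by (subst (asm) emeasure_restrict_space) auto
qed

lemma bracket_mono_iff: "s \<in> {0..T} \<Longrightarrow> t \<in> {0..T} \<Longrightarrow> F s \<le> F t \<longleftrightarrow> s \<le> t"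
  using bracket_strict_mono[of s t] bracket_strict_mono[of t s]
  by (cases s t rule: linorder_cases) auto

lemma bracket_eq_integral:
  shows "(\<lambda>s. (z T s)\<^sup>2) integrable_on {0..T}"
    and "t \<in> {0..T} \<Longrightarrow> F t = integral {0..t} (\<lambda>s. (z T s)\<^sup>2)"
proof -
  have int: "set_integrable lebesgue {0..T} (\<lambda>s. (z T s)\<^sup>2)"
    using zT_L2 by (simp add: L2_def integrable_restrict_space set_integrable_def)
  then show "(\<lambda>s. (z T s)\<^sup>2) integrable_on {0..T}"
    by (rule set_lebesgue_integral_eq_integral(1))
  show "F t = integral {0..t} (\<lambda>s. (z T s)\<^sup>2)" if "t \<in> {0..T}"
    unfolding bracket_def using that
    by (intro set_lebesgue_integral_eq_integral(2) set_integrable_subset[OF int]) auto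
qed

lemma bracket_zero: "F 0 = 0"
  using bracket_eq_integral(2)[of 0] T_pos by simp

lemma bracket_continuous: "continuous_on {0..T} F"
proof -
  have "continuous_on {0..T} (\<lambda>t. integral {0..t} (\<lambda>s. (z T s)\<^sup>2))"
    by (intro indefinite_integral_continuous_1 bracket_eq_integral(1))
  then show ?thesis
    by (subst continuous_on_cong[OF refl bracket_eq_integral(2)])
qed

lemma bracket_measurable [measurable]: "F \<in> borel_measurable leb"
  by (rule continuous_imp_measurable_on_sets_lebesgue[OF bracket_continuous]) auto

lemma bracket_bounds: "s \<in> {0..T} \<Longrightarrow> 0 \<le> F s \<and> F s \<le> F T"
  using bracket_mono_iff[of 0 s] bracket_mono_iff[of s T] bracket_zero T_pos by auto

lemma bracket_pos: "0 < F T"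
  using bracket_strict_mono[of 0 T] bracket_zero T_pos by simp

lemma bracket_onto:
  assumes "0 \<le> y" "y \<le> F T"
  obtains t where "t \<in> {0..T}" "F t = y"
  using IVT'[of F 0 y T] assms bracket_zero T_pos bracket_continuous by auto

lemma measure_mu_interval:
  assumes "0 \<le> a" "a \<le> b" "b \<le> T"
  shows "measure mu {a..b} = F b - F a"
proof -
  have "measure mu {a..b} = measure mu {a<..b}"
    using AE_leb_neq[of a] assms interval_sets
    by (intro measure_eq_AE) (auto simp: AE_mu_iff elim: eventually_mono)
  moreover have "F a \<le> F b"
    using assms by (simp add: bracket_mono_iff)
  ultimately show ?thesis
    using emeasure_dbracket[of z T a b] zT_L2 assms by (simp add: measure_def)
qed

lemma initial_integrals_determine:
  fixes g :: "real \<Rightarrow> real"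
  assumes g: "integrable mu g"
    and zero: "\<And>t. t \<in> {0..T} \<Longrightarrow> (\<integral>s. (if s \<le> t then g s else 0) \<partial>mu) = 0"
  shows "AE s in mu. g s = 0"
proof -
  have [measurable]: "g \<in> borel_measurable leb"
    using g by (auto dest: borel_measurable_integrable)
  have id [measurable]: "(\<lambda>s. s) \<in> borel_measurable leb"
    by (rule continuous_imp_measurable_on_sets_lebesgue) auto
  have "AE s in leb. (z T s)\<^sup>2 * g s = 0"
  proof (rule AE_zero_if_initial_integrals_zero)
    show "integrable leb (\<lambda>s. (z T s)\<^sup>2 * g s)"
      using g by (simp add: integrable_mu)
    fix t assume t: "0 \<le> t" "t \<le> T"
    have "(\<integral>s. (if s \<le> t then (z T s)\<^sup>2 * g s else 0) \<partial>leb) = (\<integral>s. (z T s)\<^sup>2 * (if s \<le> t then g s else 0) \<partial>leb)"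
      by (intro Bochner_Integration.integral_cong) auto
    also have "\<dots> = (\<integral>s. (if s \<le> t then g s else 0) \<partial>mu)"
      by (rule integral_mu[symmetric]) measurable
    finally show "(\<integral>s. (if s \<le> t then (z T s)\<^sup>2 * g s else 0) \<partial>leb) = 0"
      using zero t by simp
  qed (rule T_pos)
  then show ?thesis
    unfolding AE_mu_iff using kernel_T_nonzero by eventually_elim simp
qed

lemma forward_rank: "uniform_rank mu F (F T)"
proof (intro uniform_rank.intro uniform_rank_axioms.intro finite_mu)
  show "F \<in> borel_measurable mu" by simp
  show "0 \<le> F s" "F s \<le> F T" if "s \<in> space mu" for s
    using bracket_bounds that by auto
  show "0 < F T" by (rule bracket_pos)
  fix y assume "0 \<le> y" "y \<le> F T"
  then obtain t where t: "t \<in> {0..T}" "F t = y" by (rule bracket_onto)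
  have "{s \<in> space mu. F s \<le> y} = {0..t}"
    using t bracket_mono_iff[of _ t] by auto
  then show "measure mu {s \<in> space mu. F s \<le> y} = y"
    using t measure_mu_interval[of 0 t] bracket_zero by simp
next
  fix g :: "real \<Rightarrow> real" assume g: "integrable mu g"
    and zero: "\<And>y. 0 \<le> y \<Longrightarrow> y \<le> F T \<Longrightarrow> (\<integral>s. (if F s \<le> y then g s else 0) \<partial>mu) = 0"
  show "AE s in mu. g s = 0"
  proof (rule initial_integrals_determine[OF g])
    fix t assume t: "t \<in> {0..T}"
    have "(\<integral>s. (if s \<le> t then g s else 0) \<partial>mu) = (\<integral>s. (if F s \<le> F t then g s else 0) \<partial>mu)"
      using t by (intro Bochner_Integration.integral_cong) (auto simp: bracket_mono_iff)
    then show "(\<integral>s. (if s \<le> t then g s else 0) \<partial>mu) = 0"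
      using zero[of "F t"] bracket_bounds[OF t] by simp
  qed
qed

text \<open>Here \<open>{G \<le> y}\<close> is a terminal interval \<open>[t,T]\<close>; as points are null sets, integrals over initial
  intervals are differences of integrals over terminal ones.\<close>

lemma backward_rank: "uniform_rank mu (\<lambda>s. F T - F s) (F T)"
proof (intro uniform_rank.intro uniform_rank_axioms.intro finite_mu)
  show "(\<lambda>s. F T - F s) \<in> borel_measurable mu" by simp
  show "0 \<le> F T - F s" "F T - F s \<le> F T" if "s \<in> space mu" for s
    using bracket_bounds[of s] that by auto
  show "0 < F T" by (rule bracket_pos)
  fix y assume "0 \<le> y" "y \<le> F T"
  then obtain t where t: "t \<in> {0..T}" "F t = F T - y"
    using bracket_onto[of "F T - y"] by auto
  have "{s \<in> space mu. F T - F s \<le> y} = {s \<in> {0..T}. F t \<le> F s}"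
    using t(2) by auto
  also have "\<dots> = {t..T}"
    using t(1) bracket_mono_iff[OF t(1)] by auto
  finally have "{s \<in> space mu. F T - F s \<le> y} = {t..T}" .
  then show "measure mu {s \<in> space mu. F T - F s \<le> y} = y"
    using t measure_mu_interval[of t T] by simp
next
  fix g :: "real \<Rightarrow> real" assume g: "integrable mu g"
    and zero: "\<And>y. 0 \<le> y \<Longrightarrow> y \<le> F T \<Longrightarrow> (\<integral>s. (if F T - F s \<le> y then g s else 0) \<partial>mu) = 0"
  have id [measurable]: "(\<lambda>s. s) \<in> borel_measurable leb"
    by (rule continuous_imp_measurable_on_sets_lebesgue) auto
  have [measurable]: "g \<in> borel_measurable leb"
    using g by (auto dest: borel_measurable_integrable)
  have upper: "(\<integral>s. (if t \<le> s then g s else 0) \<partial>mu) = 0" if t: "t \<in> {0..T}" for t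
  proof -
    have "(\<integral>s. (if t \<le> s then g s else 0) \<partial>mu) = (\<integral>s. (if F T - F s \<le> F T - F t then g s else 0) \<partial>mu)"
      using t by (intro Bochner_Integration.integral_cong) (auto simp: bracket_mono_iff)
    then show ?thesis
      using zero[of "F T - F t"] bracket_bounds[OF t] by simp
  qed
  have "(\<integral>s. g s \<partial>mu) = (\<integral>s. (if 0 \<le> s then g s else 0) \<partial>mu)"
    by (intro Bochner_Integration.integral_cong) auto
  then have whole: "(\<integral>s. g s \<partial>mu) = 0"
    using upper[of 0] T_pos by simp
  show "AE s in mu. g s = 0"
  proof (rule initial_integrals_determine[OF g])
    fix t assume t: "t \<in> {0..T}"
    have int: "integrable mu (\<lambda>s. if t \<le> s then g s else 0)"
      by (rule Bochner_Integration.integrable_bound[OF g]) auto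
    have "(\<integral>s. (if s \<le> t then g s else 0) \<partial>mu) = (\<integral>s. g s - (if t \<le> s then g s else 0) \<partial>mu)"
      using AE_leb_neq[of t] by (intro integral_cong_AE) (auto simp: AE_mu_iff elim!: eventually_mono)
    also have "\<dots> = 0"
      using whole upper[OF t] by (simp add: Bochner_Integration.integral_diff g int)
    finally show "(\<integral>s. (if s \<le> t then g s else 0) \<partial>mu) = 0" .
  qed
qed

lemma rank_of_operators:
  assumes "i \<in> {1, 2}"
  obtains G where "uniform_rank mu G (F T)"
    "\<And>f s. s \<in> {0..T} \<Longrightarrow> alpha_M T z i f s = uniform_rank.alpha mu G f s"
    "\<And>f s. s \<in> {0..T} \<Longrightarrow> beta_M T z i f s = uniform_rank.beta mu G f s"
proof (cases "i = 1")
  case True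
  interpret uniform_rank mu F "F T" by (rule forward_rank)
  show ?thesis
  proof (rule that[OF forward_rank])
    fix f :: "real \<Rightarrow> real" and s assume s: "s \<in> {0..T}"
    have "(LINT u:{0..s}|mu. f u) = (\<integral>u. (if F u \<le> F s then f u else 0) \<partial>mu)"
      unfolding set_lebesgue_integral_def
      by (intro Bochner_Integration.integral_cong refl) (use s in \<open>simp add: bracket_mono_iff indicator_def\<close>)
    then show "alpha_M T z i f s = alpha f s"
      using True by (simp only: alpha_M_def alpha_def lower_mean_def simp_thms if_True if_False)
    have "(LINT u:{s..T}|mu. f u / F u) = (\<integral>u. (if F s \<le> F u then f u / F u else 0) \<partial>mu)"
      unfolding set_lebesgue_integral_def
      by (intro Bochner_Integration.integral_cong refl) (use s in \<open>simp add: bracket_mono_iff indicator_def\<close>)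
    then show "beta_M T z i f s = beta f s"
      using True by (simp only: beta_M_def beta_def upper_integral_def simp_thms if_True if_False)
  qed
next
  case False
  interpret uniform_rank mu "\<lambda>s. F T - F s" "F T" by (rule backward_rank)
  show ?thesis
  proof (rule that[OF backward_rank])
    fix f :: "real \<Rightarrow> real" and s assume s: "s \<in> {0..T}"
    have "(LINT u:{s..T}|mu. f u) = (\<integral>u. (if F T - F u \<le> F T - F s then f u else 0) \<partial>mu)"
      unfolding set_lebesgue_integral_def
      by (intro Bochner_Integration.integral_cong refl) (use s in \<open>simp add: bracket_mono_iff indicator_def\<close>)
    then show "alpha_M T z i f s = alpha f s"
      using False by (simp only: alpha_M_def alpha_def lower_mean_def simp_thms if_True if_False)
    have "(LINT u:{0..s}|mu. f u / (F T - F u)) = (\<integral>u. (if F T - F s \<le> F T - F u then f u / (F T - F u) else 0) \<partial>mu)"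
      unfolding set_lebesgue_integral_def
      by (intro Bochner_Integration.integral_cong refl) (use s in \<open>simp add: bracket_mono_iff indicator_def\<close>)
    then show "beta_M T z i f s = beta f s"
      using False by (simp only: beta_M_def beta_def upper_integral_def simp_thms if_True if_False)
  qed
qed

end

section \<open>The Gaussian spaces\<close>

locale volterra_completion = volterra_gaussian T z P W for T z P W +
  fixes J :: "(real \<Rightarrow> real) \<Rightarrow> 'h::{real_inner,complete_space}"
  assumes J_completion: "Lambda_completion P T J"
begin

definition e :: "real \<Rightarrow> 'h" where
  "e t = J (indicator {0..<t})"

lemma J_add: "f \<in> step_functions T \<Longrightarrow> g \<in> step_functions T \<Longrightarrow> J (\<lambda>s. f s + g s) = J f + J g"
  using J_completion by (simp add: Lambda_completion_def)

lemma J_scale: "f \<in> step_functions T \<Longrightarrow> J (\<lambda>s. a * f s) = a *\<^sub>R J f"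
  using J_completion by (simp add: Lambda_completion_def)

lemma step_function_sum: "finite S \<Longrightarrow> S \<subseteq> {0<..T} \<Longrightarrow> (\<lambda>s. \<Sum>t\<in>S. c t * indicator {0..<t} s) \<in> step_functions T"
  unfolding step_functions_def mem_Collect_eq by (intro exI[of _ S] exI[of _ c] conjI refl)

lemma step_function_indicator: "t \<in> {0<..T} \<Longrightarrow> (indicator {0..<t} :: real \<Rightarrow> real) \<in> step_functions T"
  using step_function_sum[of "{t}" "\<lambda>_. 1"] by simp

lemma J_zero: "J (\<lambda>_. 0) = 0"
  using J_scale[OF step_function_sum[of "{}"], of 0] by simp

lemma e_zero: "e 0 = 0"
proof -
  have "(indicator {0..<0} :: real \<Rightarrow> real) = (\<lambda>_. 0)" by auto
  then show ?thesis by (simp only: e_def J_zero)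
qed

lemma J_sum:
  assumes "finite S" "S \<subseteq> {0<..T}"
  shows "J (\<lambda>s. \<Sum>t\<in>S. c t * indicator {0..<t} s) = (\<Sum>t\<in>S. c t *\<^sub>R e t)"
  using assms
proof (induction S rule: finite_induct)
  case empty
  then show ?case by (simp add: J_zero)
next
  case (insert t S)
  have "(\<lambda>s. c t * indicat_real {0..<t} s) \<in> step_functions T"
    using step_function_sum[of "{t}" c] insert.prems
    by (simp only: sum.insert finite.intros empty_iff not_False_eq_True sum.empty add_0_right insert_subset empty_subsetI simp_thms)
  moreover have "(\<lambda>s. \<Sum>t\<in>S. c t * indicat_real {0..<t} s) \<in> step_functions T"
    using insert by (intro step_function_sum) auto
  moreover have "J (\<lambda>s. c t * indicat_real {0..<t} s) = c t *\<^sub>R e t"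
    unfolding e_def using insert.prems by (intro J_scale step_function_indicator) auto
  ultimately show ?case
    using insert by (simp only: sum.insert J_add insert_subset simp_thms)
qed

lemma e_dense: "closure (span (e ` {0<..T})) = UNIV"
proof -
  have "J ` step_functions T \<subseteq> span (e ` {0<..T})"
  proof
    fix x assume "x \<in> J ` step_functions T"
    then obtain S c where "finite S" "S \<subseteq> {0<..T}" "x = J (\<lambda>s. \<Sum>t\<in>S. c t * indicator {0..<t} s)"
      unfolding step_functions_def by blast
    then show "x \<in> span (e ` {0<..T})"
      by (simp only: J_sum sum_in_span_image)
  qed
  then have "closure (J ` step_functions T) \<subseteq> closure (span (e ` {0<..T}))"
    by (rule closure_mono)
  then show ?thesis
    using J_completion by (auto simp: Lambda_completion_def)
qed

lemma e_dense_closed: "closure (span (e ` {0..T})) = UNIV"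
proof -
  have "closure (span (e ` {0<..T})) \<subseteq> closure (span (e ` {0..T}))"
    by (intro closure_mono span_mono image_mono) auto
  then show ?thesis using e_dense by auto
qed

lemma coord_zero_norm: "l2_inner P (coord 0) (coord t) = 0" if "t \<in> {0..T}"
proof -
  have "0 \<in> {0..T}" using T_pos by simp
  then have "l2_inner P (coord 0) (coord t) = l2_inner leb (z 0) (z t)"
    using that by (rule coord_inner)
  also have "\<dots> = (\<integral>s. 0 \<partial>leb)"
    unfolding l2_inner_def
    by (intro Bochner_Integration.integral_cong refl) (use kernel_volterra[of 0] in auto)
  finally show ?thesis by simp
qed

lemma e_inner: "s \<in> {0..T} \<Longrightarrow> t \<in> {0..T} \<Longrightarrow> inner (e s) (e t) = R_cov P s t"
proof (cases "s = 0 \<or> t = 0")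
  case True
  moreover assume "s \<in> {0..T}" "t \<in> {0..T}"
  ultimately show ?thesis
    using coord_zero_norm[of s] coord_zero_norm[of t]
    by (auto simp: e_zero R_cov_eq l2_inner_commute[of P "coord s" "coord 0"])
next
  case False
  moreover assume "s \<in> {0..T}" "t \<in> {0..T}"
  ultimately show ?thesis
    using J_completion by (auto simp: Lambda_completion_def e_def)
qed

abbreviation \<Phi> :: "'h \<Rightarrow> (real \<Rightarrow> real) \<Rightarrow> real" where "\<Phi> \<equiv> wiener_X P T J"
abbreviation \<kappa> :: "'h \<Rightarrow> real \<Rightarrow> real" where "\<kappa> \<equiv> kappa T z J"

lemma wiener_X_spec:
  "isometric_isomorphism \<Phi> P (Gamma_space P T coord)"
  "t \<in> {0<..T} \<Longrightarrow> AE \<omega> in P. \<Phi> (e t) \<omega> = coord t \<omega>"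
proof -
  have "\<exists>\<Phi>. isometric_isomorphism \<Phi> P (l2_closed_span P {0..T} coord) \<and>
    (\<forall>t\<in>{0..T}. AE \<omega> in P. \<Phi> (e t) \<omega> = coord t \<omega>)"
    by (rule isometric_isomorphism_exists[OF coord_L2 _ e_dense_closed]) (simp_all add: e_inner R_cov_eq)
  then have "\<exists>\<Phi>. isometric_isomorphism \<Phi> P (Gamma_space P T coord) \<and>
    (\<forall>t\<in>{0<..T}. AE \<omega> in P. \<Phi> (J (indicator {0..<t})) \<omega> = coord t \<omega>)"
    unfolding Gamma_space_def e_def by (metis greaterThanAtMost_iff atLeastAtMost_iff less_imp_le)
  from someI_ex[OF this]
  show "isometric_isomorphism \<Phi> P (Gamma_space P T coord)"
    "t \<in> {0<..T} \<Longrightarrow> AE \<omega> in P. \<Phi> (e t) \<omega> = coord t \<omega>"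
    unfolding wiener_X_def e_def by auto
qed

lemma kappa_spec:
  "isometric_isomorphism \<kappa> mu (L2 mu)"
  "t \<in> {0<..T} \<Longrightarrow> AE s in mu. \<kappa> (e t) s = z t s / z T s"
proof -
  have "\<exists>\<Phi>. isometric_isomorphism \<Phi> mu (l2_closed_span mu {0<..T} kernel_quotient) \<and>
    (\<forall>t\<in>{0<..T}. AE s in mu. \<Phi> (e t) s = kernel_quotient t s)"
    by (rule isometric_isomorphism_exists[OF kernel_quotient_L2 _ e_dense]) (auto simp: e_inner kernel_quotient_inner)
  then have "\<exists>\<Phi>. isometric_isomorphism \<Phi> mu (L2 mu) \<and>
    (\<forall>t\<in>{0<..T}. AE s in mu. \<Phi> (J (indicator {0..<t})) s = z t s / z T s)"
    unfolding kernel_quotient_total kernel_quotient_def e_def .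
  from someI_ex[OF this]
  show "isometric_isomorphism \<kappa> mu (L2 mu)"
    "t \<in> {0<..T} \<Longrightarrow> AE s in mu. \<kappa> (e t) s = z t s / z T s"
    unfolding kappa_def e_def by auto
qed

lemma kappa_kappa_inv:
  assumes "f \<in> L2 mu"
  shows "AE s in mu. \<kappa> (kappa_inv T z J f) s = f s"
proof -
  obtain h where h: "AE s in mu. \<kappa> h s = f s"
    using kappa_spec(1) assms by (auto simp: isometric_isomorphism_def)
  have "kappa_inv T z J f = h"
    unfolding kappa_inv_def
  proof (rule the_equality)
    show "AE s in mu. \<kappa> h s = f s" by (rule h)
    fix g assume "AE s in mu. \<kappa> g s = f s"
    with h have "AE s in mu. \<kappa> g s = \<kappa> h s" by eventually_elim simp
    then show "g = h"
      by (rule isometry_inject[OF kappa_spec(1) subset_refl])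
  qed
  with h show ?thesis by simp
qed

lemma kappa_e_T: "AE s in mu. \<kappa> (e T) s = 1"
  using kappa_spec(2)[of T] kernel_T_nonzero T_pos
  by (auto simp: AE_mu_iff elim: eventually_elim2)

lemma R_cov_T_pos: "0 < R_cov P T T"
proof -
  interpret uniform_rank mu F "F T" by (rule forward_rank)
  have "R_cov P T T = l2_inner mu (\<kappa> (e T)) (\<kappa> (e T))"
    using T_pos by (simp add: isometry_inner[OF kappa_spec(1) subset_refl] e_inner)
  also have "\<dots> = l2_inner mu (\<lambda>_. 1) (\<lambda>_. 1)"
    by (intro l2_inner_cong_AE kappa_e_T L2_measurable const_L2 isometry_L2[OF kappa_spec(1) subset_refl])
  also have "\<dots> = F T"
    using total_measure by (simp add: l2_inner_def)
  finally show ?thesis using bracket_pos by simp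
qed

lemma Gamma_subset: "Gamma_space P T coord \<subseteq> L2 P"
  by (auto simp: Gamma_space_def l2_closed_span_def)

lemmas Phi_L2 = isometry_L2[OF wiener_X_spec(1) Gamma_subset]
  and Gamma_eq = l2_closed_span_isometry[OF wiener_X_spec(1) Gamma_subset]

lemma Phi_e:
  assumes t: "t \<in> {0..T}"
  shows "AE \<omega> in P. coord t \<omega> = \<Phi> (e t) \<omega>"
proof (cases "t = 0")
  case True
  have "(l2_norm P (coord 0))\<^sup>2 = 0"
    using coord_zero_norm[of 0] T_pos by (simp add: l2_norm_square)
  then have "AE \<omega> in P. coord 0 \<omega> = 0"
    using l2_norm_eq_0_iff[OF coord_L2[of 0]] T_pos by simp
  then show ?thesis
    using isometry_zero[OF wiener_X_spec(1) Gamma_subset] unfolding True e_zero by eventually_elim simp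
next
  case False
  then show ?thesis
    using wiener_X_spec(2)[of t] t by (auto elim: eventually_mono)
qed

lemma Gamma_coord: "Gamma_space P T coord = {Z \<in> L2 P. \<exists>h. AE \<omega> in P. Z \<omega> = \<Phi> h \<omega>}"
  unfolding Gamma_space_def using Gamma_eq[of "{0..T}" coord e] coord_L2 Phi_e e_dense_closed by simp

text \<open>A vector orthogonal to \<open>e\<^sub>T\<close> and to all \<open>e\<^sub>t - c\<^sub>t e\<^sub>T\<close> is orthogonal to every \<open>e\<^sub>t\<close>.\<close>

lemma Gamma_bridge: "Gamma_space P T (bridge P T) = {Z \<in> L2 P. \<exists>h. inner (e T) h = 0 \<and> (AE \<omega> in P. Z \<omega> = \<Phi> h \<omega>)}"
proof -
  define y where "y t = e t - (R_cov P t T / R_cov P T T) *\<^sub>R e T" for t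
  have "closure (span (y ` {0..T})) = {v. inner (e T) v = 0}"
  proof (rule closure_span_eq_orthogonal)
    fix x assume "x \<in> y ` {0..T}"
    then obtain t where t: "t \<in> {0..T}" "x = y t" by blast
    then show "inner (e T) x = 0"
      using R_cov_T_pos T_in e_inner[of T t] e_inner[of t T] e_inner[of T T]
      by (simp add: y_def inner_diff_right inner_commute)
  next
    fix v assume v: "inner (e T) v = 0" "\<And>x. x \<in> y ` {0..T} \<Longrightarrow> inner v x = 0"
    have ve: "inner v (e t) = 0" if "t \<in> {0..T}" for t
      using v(2)[of "y t"] v(1) that by (simp add: y_def inner_diff_right inner_commute)
    have "inner v v = 0"
      by (rule inner_bounded_linear_vanishes[OF bounded_linear_ident e_dense_closed]) (auto simp: ve)
    then show "v = 0" by simp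
  qed
  moreover have "l2_closed_span P {0..T} (bridge P T) =
      {Z \<in> L2 P. \<exists>h\<in>closure (span (y ` {0..T})). AE \<omega> in P. Z \<omega> = \<Phi> h \<omega>}"
  proof (rule Gamma_eq)
    fix t assume t: "t \<in> {0..T}"
    show "bridge P T t \<in> L2 P"
      unfolding bridge_def[abs_def] by (intro L2_diff L2_scale coord_L2 t T_in)
    show "AE \<omega> in P. bridge P T t \<omega> = \<Phi> (y t) \<omega>"
      using Phi_e[OF t] Phi_e[OF T_in]
        isometry_diff[OF wiener_X_spec(1) Gamma_subset, of "e t" "(R_cov P t T / R_cov P T T) *\<^sub>R e T"]
        isometry_scale[OF wiener_X_spec(1) Gamma_subset, of "R_cov P t T / R_cov P T T" "e T"]
      by eventually_elim (simp add: bridge_def y_def)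
  qed
  ultimately show ?thesis
    by (auto simp: Gamma_space_def)
qed

lemma Gamma_processes:
  assumes i: "i \<in> {1, 2}"
  shows "Gamma_space P T (T_proc T z P J i) = Gamma_space P T (bridge P T)"
    and "Gamma_space P T (B_proc T z P J i) = Gamma_space P T coord"
proof -
  obtain G where rank: "uniform_rank mu G (F T)"
    and alpha: "\<And>f s. s \<in> {0..T} \<Longrightarrow> alpha_M T z i f s = uniform_rank.alpha mu G f s"
    and beta: "\<And>f s. s \<in> {0..T} \<Longrightarrow> beta_M T z i f s = uniform_rank.beta mu G f s"
    using i by (rule rank_of_operators) blast
  interpret uniform_rank mu G "F T" by (rule rank)
  note kappa_L2 = isometry_L2[OF kappa_spec(1) subset_refl]
  have image: "AE s in mu. \<kappa> (kappa_inv T z J f) s = g s"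
    if "g \<in> L2 mu" "\<And>s. s \<in> {0..T} \<Longrightarrow> f s = g s" for f g
  proof -
    have "f \<in> borel_measurable mu"
      using L2_measurable[OF that(1)] that(2) by (subst measurable_cong[of _ f g]) auto
    then have "f \<in> L2 mu"
      by (rule L2_cong_AE[OF that(1)]) (use that(2) in \<open>auto intro!: AE_I2\<close>)
    then show ?thesis
      using kappa_kappa_inv[of f] that(2) AE_space[of mu] by (auto elim: eventually_elim2)
  qed
  have A: "AE s in mu. \<kappa> (alpha_X T z J i h) s = local.alpha (\<kappa> h) s" for h
    unfolding alpha_X_def using alpha_bounded kappa_L2 alpha
    by (intro image) (auto simp: l2_bounded_operator_def)
  have B: "AE s in mu. \<kappa> (beta_X T z J i h) s = local.beta (\<kappa> h) s" for h
    unfolding beta_X_def using beta_bounded kappa_L2 beta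
    by (intro image) (auto simp: l2_bounded_operator_def)
  have "l2_closed_span P {0..T} (B_proc T z P J i) =
      {Z \<in> L2 P. \<exists>h\<in>closure (span ((\<lambda>t. alpha_X T z J i (e t)) ` {0..T})). AE \<omega> in P. Z \<omega> = \<Phi> h \<omega>}"
    by (rule Gamma_eq) (simp_all add: B_proc_def e_def Phi_L2)
  also have "closure (span ((\<lambda>t. alpha_X T z J i (e t)) ` {0..T})) = UNIV"
    using alpha_range_dense[where B="alpha_X T z J i", OF kappa_spec(1) e_dense_closed A]
    by (simp add: image_image)
  finally show "Gamma_space P T (B_proc T z P J i) = Gamma_space P T coord"
    by (simp add: Gamma_coord) (simp add: Gamma_space_def)
  have "l2_closed_span P {0..T} (T_proc T z P J i) =
      {Z \<in> L2 P. \<exists>h\<in>closure (span ((\<lambda>t. beta_X T z J i (e t)) ` {0..T})). AE \<omega> in P. Z \<omega> = \<Phi> h \<omega>}"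
    by (rule Gamma_eq) (simp_all add: T_proc_def e_def Phi_L2)
  also have "closure (span ((\<lambda>t. beta_X T z J i (e t)) ` {0..T})) = {v. inner (e T) v = 0}"
    using beta_range_closure[where B="beta_X T z J i", OF kappa_spec(1) e_dense_closed B kappa_e_T]
    by (simp add: image_image)
  finally show "Gamma_space P T (T_proc T z P J i) = Gamma_space P T (bridge P T)"
    unfolding Gamma_bridge by (simp add: Gamma_space_def)
qed

end

theorem mainTheorem2:
  fixes T :: real
    and z :: "real \<Rightarrow> real \<Rightarrow> real"
    and P :: "(real \<Rightarrow> real) measure"
    and W :: "real \<Rightarrow> (real \<Rightarrow> real) \<Rightarrow> real"
    and J :: "(real \<Rightarrow> real) \<Rightarrow> 'h::{real_inner,complete_space}"
    and i :: nat
  assumes "volterra_gaussian T z P W"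
    and "Lambda_completion P T J"
    and "i \<in> {1, 2}"
  shows "Gamma_space P T (T_proc T z P J i) = Gamma_space P T (bridge P T) \<and>
         Gamma_space P T (B_proc T z P J i) = Gamma_space P T coord"
proof -
  interpret volterra_completion T z P W J
    using assms(1,2) by (intro volterra_completion.intro volterra_completion_axioms.intro)
  show ?thesis
    using Gamma_processes[OF assms(3)] by blast
qed

end
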